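(* Let $q$ be an odd prime power. Let $n,j,i,k$ be non-negative integers with $i\leq j$ and $i,k\leq n-j$. Let $\delta,\varepsilon,\zeta,\eta\in\{0,\pm1\}$ and $\lambda\in\{\pm1\}$ with $1\equiv j-i-\delta\equiv n-\varepsilon\equiv k-\zeta\equiv k+j-\eta\pmod{2}$. Below, the notation $(i,j,\delta(,\lambda))$ stands for $(i,j,\delta)$ if $n(j-i)$ is even and for $(i,j,0,\lambda)$ if $n(j-i)$ is odd. If $k+j$ is even or $j-i$ is even, then \[ \gamma_{(i,j,\delta(,\lambda)),(n,\varepsilon),(k,\zeta),\eta}=\beta_{(i,j,\delta(,\lambda)),(n,\varepsilon),(k+j,\eta)}\;\gamma_{(i,j,\delta),(k+j,\eta),(k,\zeta),\eta}. \] If $k+j$ and $j-i$ are both odd (so $\delta=\eta=0$), then \[ \gamma_{(i,j,0(,\lambda)),(n,\varepsilon),(k,\zeta),0}=\sum_{\nu\in\{\pm1\}}\beta^{\nu}_{(i,j,0(,\lambda)),(n,\varepsilon),(k+j,0)}\;\gamma_{(i,j,0,\nu),(k+j,0),(k,\zeta),0}. \]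
   Context: Forms and types. $q$ is an odd prime power. A quadratic form $Q$ on $\mathbb{F}_q^m$ has an associated symmetric bilinear form $f$ with $Q(v)=f(v,v)$; its radical is $\{v:\forall w,\ f(v,w)=0\}$, and $Q$ is non-degenerate if its radical is $0$. A non-degenerate quadratic form on $\mathbb{F}_q^m$ has a type: $0$ (parabolic) if $m$ is odd; if $m$ is even, the type is $1$ (hyperbolic) if the maximum dimension of a totally isotropic subspace (one on which $Q$ vanishes) is $m/2$, and $-1$ (elliptic) if it is $m/2-1$. The $0$-dimensional space has type $1$. "A quadratic form of type $\varepsilon$ on $\mathbb{F}_q^n$" always means a non-degenerate one. All subspace dimensions are vector space dimensions. Given such a form, a subspace $\pi$ is $i$-singular if the radical of the form restricted to $\pi$ has dimension $i$; non-singular means $0$-singular. The type of an $i$-singular $j$-space $\pi$ is the type of the non-degenerate form induced on $\pi/\mathrm{rad}(\pi)$. Let $\perp$ be the orthogonal polarity $\pi\mapsto\pi^\perp=\{x: f(x,y)=0\ \forall y\in\pi\}$. If $n$ and $j-i$ are both odd, the perp type of an $i$-singular $j$-space $\pi$ (which has type $0$) is the type, $1$ or $-1$, of the $i$-singular $(n-j)$-space $\pi^\perp$. If $\sigma\supseteq\pi$ is a non-singular subspace of odd dimension and $j-i$ is odd, the perp type of $\pi$ in $\sigma$ is its perp type with respect to the form restricted to $\sigma$, i.e. the type of $\pi^\perp\cap\sigma$. Counts. Fix a quadratic form of type $\varepsilon$ on $\mathbb{F}_q^n$ and an $i$-singular $j$-space $\pi$ of type $\delta$, and of perp type $\lambda$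 when $n(j-i)$ is odd. $\beta$: the number of non-singular $k$-spaces $\sigma\supseteq\pi$ of type $\zeta$ is denoted $\beta_{(i,j,\delta),(n,\varepsilon),(k,\zeta)}$ if $n(j-i)$ is even (or $n=i+j$), and $\beta_{(i,j,0,\lambda),(n,0),(k,\zeta)}$ if $n(j-i)$ is odd. If $k$ and $j-i$ are odd, the number of non-singular $k$-spaces $\sigma\supseteq\pi$ (necessarily of type $0$) such that $\pi$ has perp type $\nu$ in $\sigma$ is denoted $\beta^{\nu}_{(i,j,0),(n,\varepsilon),(k,0)}$ if $n$ is even and $\beta^{\nu}_{(i,j,0,\lambda),(n,0),(k,0)}$ if $n$ is odd. $\gamma$: the number of non-singular $k$-spaces $\sigma$ of type $\zeta$ such that $\sigma\cap\pi$ is trivial and $\langle\pi,\sigma\rangle$ is a non-singular $(k+j)$-space of type $\eta$ is denoted $\gamma_{(i,j,\delta),(n,\varepsilon),(k,\zeta),\eta}$ if $n(j-i)$ is even (or $n=i+j$), and $\gamma_{(i,j,0,\lambda),(n,0),(k,\zeta),\eta}$ if $n(j-i)$ is odd. On the right-hand side of the claim, the $\gamma$'s are these numbers for a form of type $\eta$ on $\mathbb{F}_q^{k+j}$. These numbers do not depend on the choice of $\pi$. The statement is for parameters for which the fixed $\pi$ in $\mathbb{F}_q^n$ exists; a product with a factor $0$ is read as $0$ even if the other factor is undefined because no suitable subspace exists. *)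

theory Defs
  imports Complex_Main "HOL-Library.Function_Algebras" "HOL-Library.Cardinality"
begin

(* The finite field F_q is a type 'a :: {field, finite} with q = CARD('a). Since the dimension
   varies inside the statement, F_q^n is the subspace of those sequences nat => 'a that vanish
   from index n on; addition and 0 are pointwise, by Function_Algebras. A form on F_q^n is
   a function on all sequences of which only the values on coord_space n matter. *)

definition vscale :: "'a::field \<Rightarrow> (nat \<Rightarrow> 'a) \<Rightarrow> (nat \<Rightarrow> 'a)" where
  "vscale c v = (\<lambda>i. c * v i)"

global_interpretation Fq: vector_space "vscale :: 'a::field \<Rightarrow> (nat \<Rightarrow> 'a) \<Rightarrow> (nat \<Rightarrow> 'a)"
  by unfold_locales (auto simp: vscale_def fun_eq_iff algebra_simps)

definition coord_space :: "nat \<Rightarrow> (nat \<Rightarrow> 'a::field) set" where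
  "coord_space n = {v. \<forall>i\<ge>n. v i = 0}"

(* The symmetric bilinear form f with f(v,v) = Q(v), in characteristic other than 2. *)
definition polar :: "((nat \<Rightarrow> 'a::field) \<Rightarrow> 'a) \<Rightarrow> (nat \<Rightarrow> 'a) \<Rightarrow> (nat \<Rightarrow> 'a) \<Rightarrow> 'a" where
  "polar Q v w = (Q (v + w) - Q v - Q w) / 2"

definition quadratic_form :: "nat \<Rightarrow> ((nat \<Rightarrow> 'a::field) \<Rightarrow> 'a) \<Rightarrow> bool" where
  "quadratic_form n Q \<longleftrightarrow>
     (\<forall>c. \<forall>v\<in>coord_space n. Q (vscale c v) = c\<^sup>2 * Q v) \<and>
     (\<forall>u\<in>coord_space n. \<forall>v\<in>coord_space n. \<forall>w\<in>coord_space n.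
        polar Q (u + v) w = polar Q u w + polar Q v w) \<and>
     (\<forall>c. \<forall>v\<in>coord_space n. \<forall>w\<in>coord_space n. polar Q (vscale c v) w = c * polar Q v w)"

lemma polar_sym: "polar Q v w = polar Q w v"
  by (simp add: polar_def add.commute)

lemma polar_self:
  fixes Q :: "(nat \<Rightarrow> 'a::field) \<Rightarrow> 'a"
  assumes Q: "quadratic_form n Q" and v: "v \<in> coord_space n" and two: "(2::'a) \<noteq> 0"
  shows "polar Q v v = Q v"
proof -
  have "v + v = vscale 2 v"
    by (simp add: vscale_def fun_eq_iff)
  then have "Q (v + v) = 2\<^sup>2 * Q v"
    using Q v by (simp add: quadratic_form_def)
  then have "polar Q v v = (2 * Q v) / 2"
    by (simp add: polar_def power2_eq_square algebra_simps)
  with two show ?thesis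
    by simp
qed

definition radical :: "((nat \<Rightarrow> 'a::field) \<Rightarrow> 'a) \<Rightarrow> (nat \<Rightarrow> 'a) set \<Rightarrow> (nat \<Rightarrow> 'a) set" where
  "radical Q U = {v \<in> U. \<forall>w\<in>U. polar Q v w = 0}"

definition perp :: "nat \<Rightarrow> ((nat \<Rightarrow> 'a::field) \<Rightarrow> 'a) \<Rightarrow> (nat \<Rightarrow> 'a) set \<Rightarrow> (nat \<Rightarrow> 'a) set" where
  "perp n Q U = {x \<in> coord_space n. \<forall>y\<in>U. polar Q x y = 0}"

definition totally_isotropic :: "((nat \<Rightarrow> 'a::field) \<Rightarrow> 'a) \<Rightarrow> (nat \<Rightarrow> 'a) set \<Rightarrow> bool" where
  "totally_isotropic Q W \<longleftrightarrow> Fq.subspace W \<and> (\<forall>v\<in>W. Q v = 0)"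

definition max_isotropic_dim :: "nat \<Rightarrow> ((nat \<Rightarrow> 'a::field) \<Rightarrow> 'a) \<Rightarrow> nat" where
  "max_isotropic_dim m Q = Max {Fq.dim W |W. totally_isotropic Q W \<and> W \<subseteq> coord_space m}"

(* A non-degenerate quadratic form of type e on F_q^m; e = -1 is written so as not to subtract
   in nat. The form on the 0-dimensional space gets type 1 (and not -1). *)
definition form_of_type :: "nat \<Rightarrow> int \<Rightarrow> ((nat \<Rightarrow> 'a::field) \<Rightarrow> 'a) \<Rightarrow> bool" where
  "form_of_type m e Q \<longleftrightarrow>
     quadratic_form m Q \<and> radical Q (coord_space m) = {0} \<and>
     (odd m \<and> e = 0 \<or>
      even m \<and> e = 1 \<and> max_isotropic_dim m Q = m div 2 \<or>
      even m \<and> e = -1 \<and> max_isotropic_dim m Q + 1 = m div 2)"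

(* The type of the form that Q induces on U / rad(U). The quotient is identified with F_q^m by
   a linear map p that sends U onto F_q^m and whose kernel on U is rad(U); the induced form Q'
   is then given by Q'(p v) = Q v. Values of p outside U are irrelevant (a linear map on U
   extends to all sequences). *)
definition space_has_type ::
  "((nat \<Rightarrow> 'a::field) \<Rightarrow> 'a) \<Rightarrow> (nat \<Rightarrow> 'a) set \<Rightarrow> int \<Rightarrow> bool" where
  "space_has_type Q U e \<longleftrightarrow>
     (\<exists>m p Q'. Vector_Spaces.linear vscale vscale p \<and> p ` U = coord_space m \<and>
        {v \<in> U. p v = 0} = radical Q U \<and> (\<forall>v\<in>U. Q' (p v) = Q v) \<and> form_of_type m e Q')"

definition singular_space ::
  "nat \<Rightarrow> ((nat \<Rightarrow> 'a::field) \<Rightarrow> 'a) \<Rightarrow> nat \<Rightarrow> nat \<Rightarrow> int \<Rightarrow> (nat \<Rightarrow> 'a) set \<Rightarrow> bool" where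
  "singular_space n Q i j d U \<longleftrightarrow>
     Fq.subspace U \<and> U \<subseteq> coord_space n \<and> Fq.dim U = j \<and> Fq.dim (radical Q U) = i \<and>
     space_has_type Q U d"

definition perp_type :: "nat \<Rightarrow> ((nat \<Rightarrow> 'a::field) \<Rightarrow> 'a) \<Rightarrow> (nat \<Rightarrow> 'a) set \<Rightarrow> int \<Rightarrow> bool" where
  "perp_type n Q U l \<longleftrightarrow> space_has_type Q (perp n Q U) l"

definition perp_type_in ::
  "nat \<Rightarrow> ((nat \<Rightarrow> 'a::field) \<Rightarrow> 'a) \<Rightarrow> (nat \<Rightarrow> 'a) set \<Rightarrow> (nat \<Rightarrow> 'a) set \<Rightarrow> int \<Rightarrow> bool" where
  "perp_type_in n Q S U l \<longleftrightarrow> space_has_type Q (perp n Q U \<inter> S) l"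

(* The subscripts (i,j,d) and (i,j,d,l) are (i, j, d, None) and (i, j, d, Some l). *)
fun has_params ::
  "nat \<Rightarrow> ((nat \<Rightarrow> 'a::field) \<Rightarrow> 'a) \<Rightarrow> nat \<times> nat \<times> int \<times> int option \<Rightarrow> (nat \<Rightarrow> 'a) set \<Rightarrow> bool" where
  "has_params n Q (i, j, d, None) U \<longleftrightarrow> singular_space n Q i j d U"
| "has_params n Q (i, j, d, Some l) U \<longleftrightarrow> singular_space n Q i j d U \<and> perp_type n Q U l"

(* The common value of count Q U over all forms Q of type e on F_q^n and all subspaces U with the
   given parameters. It is unspecified if there is no such pair (Q, U), which is harmless in
   a product with 0, and also if there is no common value. *)
definition common_count ::
  "nat \<times> nat \<times> int \<times> int option \<Rightarrow> nat \<times> int \<Rightarrow>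
   (((nat \<Rightarrow> 'a::field) \<Rightarrow> 'a) \<Rightarrow> (nat \<Rightarrow> 'a) set \<Rightarrow> nat) \<Rightarrow> nat" where
  "common_count t ne count =
     (THE c. \<forall>Q U. form_of_type (fst ne) (snd ne) Q \<and> has_params (fst ne) Q t U \<longrightarrow> count Q U = c)"

fun beta ::
  "'a::{field,finite} itself \<Rightarrow> nat \<times> nat \<times> int \<times> int option \<Rightarrow> nat \<times> int \<Rightarrow> nat \<times> int \<Rightarrow> nat" where
  "beta _ t (n, e) (k, z) = common_count t (n, e)
     (\<lambda>(Q :: (nat \<Rightarrow> 'a) \<Rightarrow> 'a) U. card {S. singular_space n Q 0 k z S \<and> U \<subseteq> S})"

fun beta_perp ::
  "'a::{field,finite} itself \<Rightarrow> int \<Rightarrow> nat \<times> nat \<times> int \<times> int option \<Rightarrow> nat \<times> int \<Rightarrow> nat \<times> int \<Rightarrow> nat" where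
  "beta_perp _ v t (n, e) (k, z) = common_count t (n, e)
     (\<lambda>(Q :: (nat \<Rightarrow> 'a) \<Rightarrow> 'a) U.
        card {S. singular_space n Q 0 k z S \<and> U \<subseteq> S \<and> perp_type_in n Q S U v})"

fun gamma ::
  "'a::{field,finite} itself \<Rightarrow> nat \<times> nat \<times> int \<times> int option \<Rightarrow> nat \<times> int \<Rightarrow> nat \<times> int \<Rightarrow> int \<Rightarrow> nat" where
  "gamma _ (i, j, d, lo) (n, e) (k, z) h = common_count (i, j, d, lo) (n, e)
     (\<lambda>(Q :: (nat \<Rightarrow> 'a) \<Rightarrow> 'a) U.
        card {S. singular_space n Q 0 k z S \<and> S \<inter> U = {0} \<and>
                 singular_space n Q 0 (k + j) h (Fq.span (U \<union> S))})"

end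

(* Grouping the spaces S counted on the left by T = span (U Un S) gives a sum over the non-singular
   (k + j)-spaces T containing U. Coordinates on T turn the contribution of T into a count of the
   same kind for a form on F_q^(k + j), which only depends on the type of T and, if k + j and j - i
   are odd, on the perp type of U in T.

   This uses that the counts depend on the parameters only: any two pairs (form, subspace) with
   equal parameters are related by a similarity. No extension theorem of Witt is needed. If R is the
   radical of U, then U = D + R and F_q^n = D _|_ W, W = H _|_ A, where H is a hyperbolic space
   with R as a maximal totally isotropic subspace, so it suffices to find similarities with a common
   multiplier for D and for A. Each of these is a hyperbolic space plus an anisotropic kernel of
   dimension at most 2, and over a finite field of odd order the kernel is determined by its
   dimension, up to a scalar if the dimension is 1. *)

theory Submission
  imports Defs "HOL-Library.FuncSet"
begin

section \<open>Finite subspaces of the sequence space\<close>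

text \<open>Multiplying a form by a nonzero scalar changes neither radicals nor types, so
  similarities preserve everything that is counted. Isometries would be too few: the non-degenerate
  forms of a given odd dimension fall into two isometry classes, both of type 0 and exchanged by a
  nonsquare scalar, whereas in even dimension a form is isometric to all its nonzero multiples. The
  obstacle is therefore the common multiplier. Removing \<open>H\<close> does not change the type,
  so \<open>D\<close> _|_ \<open>A\<close> has type \<epsilon>. If \<open>D\<close> or
  \<open>A\<close> has even dimension, it accepts whatever multiplier the other one dictates,
  provided that the type of \<open>A\<close> is known. That type follows from parity or from
  \<delta> and \<epsilon>, unless \<open>dim D\<close> is odd and \<open>dim A\<close> is even: then
  \<delta> = \<epsilon> = 0 carry no information and the perp type has to supply it. As
  \<open>dim D = j - i\<close> and \<open>dim D + dim A = n - 2 i\<close>, this is exactly the case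
  of odd \<open>n (j - i)\<close>. Inside a \<open>(k + j)\<close>-space it is the case where
  \<open>k + j\<close> and \<open>j - i\<close> are odd, whence the sum over \<nu>.\<close>

global_interpretation Fq2: vector_space_pair
  "vscale :: 'a::field \<Rightarrow> (nat \<Rightarrow> 'a) \<Rightarrow> (nat \<Rightarrow> 'a)"
  "vscale :: 'a::field \<Rightarrow> (nat \<Rightarrow> 'a) \<Rightarrow> (nat \<Rightarrow> 'a)"
  ..

abbreviation lin :: "((nat \<Rightarrow> 'a::field) \<Rightarrow> (nat \<Rightarrow> 'a)) \<Rightarrow> bool" where
  "lin \<equiv> Vector_Spaces.linear vscale vscale"

lemma
  assumes "lin g"
  shows lin_add: "g (u + v) = g u + g v" and lin_scale: "g (vscale c u) = vscale c (g u)"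
    and lin_zero: "g 0 = 0"
proof -
  interpret Vector_Spaces.linear vscale vscale g by fact
  show "g (u + v) = g u + g v" "g (vscale c u) = vscale c (g u)" "g 0 = 0"
    by (rule add scale zero)+
qed

text \<open>The induction methods eta-expand the zero function, and the simplifier rewrites the result
  \<open>\<lambda>x. 0 x\<close> further to \<open>\<lambda>x. 0\<close>; this rule undoes that.\<close>

lemma fun_zero_eta [simp]: "(\<lambda>x. 0) = 0"
  by (simp add: fun_eq_iff)

section \<open>Sums of subspaces and extension of linear maps\<close>

definition ssum :: "(nat \<Rightarrow> 'a::field) set \<Rightarrow> (nat \<Rightarrow> 'a) set \<Rightarrow> (nat \<Rightarrow> 'a) set" where
  "ssum A B = {a + b |a b. a \<in> A \<and> b \<in> B}"

lemma subspace_ssum: "Fq.subspace A \<Longrightarrow> Fq.subspace B \<Longrightarrow> Fq.subspace (ssum A B)"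
  unfolding ssum_def by (rule Fq.subspace_sums)

lemma ssumI: "a \<in> A \<Longrightarrow> b \<in> B \<Longrightarrow> a + b \<in> ssum A B"
  by (auto simp: ssum_def)

lemma ssum_superset1: "Fq.subspace B \<Longrightarrow> A \<subseteq> ssum A B"
  using ssumI[of _ A 0 B] Fq.subspace_0 by fastforce

lemma ssum_superset2: "Fq.subspace A \<Longrightarrow> B \<subseteq> ssum A B"
  using ssumI[of 0 A _ B] Fq.subspace_0 by fastforce

lemma ssum_subset:
  "Fq.subspace V \<Longrightarrow> A \<subseteq> V \<Longrightarrow> B \<subseteq> V \<Longrightarrow> ssum A B \<subseteq> V"
  by (auto simp: ssum_def intro: Fq.subspace_add)

lemma finite_ssum: "finite A \<Longrightarrow> finite B \<Longrightarrow> finite (ssum A B)"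
  using finite_image_set2[of "\<lambda>a. a \<in> A" "\<lambda>b. b \<in> B" "(+)"] by (simp add: ssum_def)

lemma ssum_unique:
  assumes "Fq.subspace A" "Fq.subspace B" "A \<inter> B = {0}"
    and "a \<in> A" "a' \<in> A" "b \<in> B" "b' \<in> B" "a + b = a' + b'"
  shows "a = a'" "b = b'"
proof -
  have "a - a' = b' - b" using assms(8) by (simp add: algebra_simps)
  then have "a - a' \<in> A \<inter> B"
    using assms by (metis Fq.subspace_diff IntI)
  then have "a - a' = 0" using assms(3) by blast
  then show "a = a'" "b = b'" using assms(8) by auto
qed

lemma card_ssum:
  assumes "Fq.subspace A" "Fq.subspace B" "A \<inter> B = {0}"
  shows "card (ssum A B) = card A * card B"
proof -
  have eq: "ssum A B = (\<lambda>(a, b). a + b) ` (A \<times> B)" by (auto simp: ssum_def)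
  have "inj_on (\<lambda>(a, b). a + b) (A \<times> B)"
    by (rule inj_onI) (use ssum_unique[OF assms] in auto)
  then show ?thesis unfolding eq by (simp add: card_image card_cartesian_product)
qed

text \<open>The linear map that agrees with \<open>f\<close> on a basis of \<open>V\<close> agrees
  with it on a subspace, hence on \<open>V\<close>. Maps given by a formula on a subspace thus
  become linear maps on all sequences, as the definition of types demands.\<close>

lemma linear_on_extend:
  fixes f :: "(nat \<Rightarrow> 'a::field) \<Rightarrow> (nat \<Rightarrow> 'a)"
  assumes V: "Fq.subspace V"
    and add: "\<And>u v. u \<in> V \<Longrightarrow> v \<in> V \<Longrightarrow> f (u + v) = f u + f v"
    and scale: "\<And>c v. v \<in> V \<Longrightarrow> f (vscale c v) = vscale c (f v)"
  shows "\<exists>g. lin g \<and> (\<forall>v\<in>V. g v = f v)"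
proof -
  obtain B where B: "B \<subseteq> V" "Fq.independent B" "V \<subseteq> Fq.span B"
    using Fq.basis_exists by metis
  obtain g where g: "lin g" "\<forall>x\<in>B. g x = f x"
    using Fq2.linear_independent_extend[OF B(2)] by blast
  have "f 0 = 0" using scale[of 0 0] Fq.subspace_0[OF V] by simp
  then have "Fq.subspace {v \<in> V. g v = f v}"
    using V g(1) unfolding Fq.subspace_def
    by (simp add: add scale lin_add[OF g(1)] lin_scale[OF g(1)] lin_zero[OF g(1)])
  moreover have "B \<subseteq> {v \<in> V. g v = f v}" using B(1) g(2) by auto
  ultimately have "Fq.span B \<subseteq> {v \<in> V. g v = f v}" by (rule Fq.span_minimal[rotated])
  with B(3) g(1) show ?thesis by blast
qed

lemma linear_glue:
  assumes ss: "Fq.subspace A" "Fq.subspace B" "A \<inter> B = {0}" and lA: "lin gA" and lB: "lin gB"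
  shows "\<exists>g. lin g \<and> (\<forall>a\<in>A. g a = gA a) \<and> (\<forall>b\<in>B. g b = gB b)"
proof -
  \<comment> \<open>The component in \<open>A\<close> of a vector of \<open>ssum A B\<close>;
    directness of the sum makes the description unique.\<close>
  define pa where "pa v = (THE a. a \<in> A \<and> (\<exists>b\<in>B. v = a + b))" for v
  have pa: "pa (a + b) = a" if "a \<in> A" "b \<in> B" for a b
    unfolding pa_def
  proof (rule the_equality)
    show "a \<in> A \<and> (\<exists>b'\<in>B. a + b = a + b')" using that by blast
  next
    fix a' assume "a' \<in> A \<and> (\<exists>b'\<in>B. a + b = a' + b')"
    then show "a' = a" using ssum_unique(1)[OF ss] that by metis
  qed
  define f where "f v = gA (pa v) + gB (v - pa v)" for v
  have f: "f (a + b) = gA a + gB b" if "a \<in> A" "b \<in> B" for a b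
    using pa[OF that] by (simp add: f_def)
  have dec: "\<exists>a b. v = a + b \<and> a \<in> A \<and> b \<in> B" if "v \<in> ssum A B" for v
    using that by (auto simp: ssum_def)
  have "\<exists>g. lin g \<and> (\<forall>v\<in>ssum A B. g v = f v)"
  proof (rule linear_on_extend[OF subspace_ssum[OF ss(1,2)]])
    fix u v assume "u \<in> ssum A B" "v \<in> ssum A B"
    then obtain a b a' b' where *: "u = a + b" "a \<in> A" "b \<in> B" "v = a' + b'" "a' \<in> A" "b' \<in> B"
      using dec by metis
    have "u + v = (a + a') + (b + b')" using * by (simp add: algebra_simps)
    then have "f (u + v) = gA (a + a') + gB (b + b')"
      using f[of "a + a'" "b + b'"] * ss by (metis Fq.subspace_add)
    then show "f (u + v) = f u + f v"
      using * f by (simp add: lin_add[OF lA] lin_add[OF lB] algebra_simps)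
  next
    fix k v assume "v \<in> ssum A B"
    then obtain a b where *: "v = a + b" "a \<in> A" "b \<in> B" using dec by metis
    have "vscale k v = vscale k a + vscale k b" using * by (simp add: Fq.scale_right_distrib)
    then have "f (vscale k v) = gA (vscale k a) + gB (vscale k b)"
      using f[of "vscale k a" "vscale k b"] * ss by (metis Fq.subspace_scale)
    then show "f (vscale k v) = vscale k (f v)"
      using * f by (simp add: lin_scale[OF lA] lin_scale[OF lB] Fq.scale_right_distrib)
  qed
  then obtain g where g: "lin g" "\<forall>v\<in>ssum A B. g v = f v" by blast
  have gab: "g (a + b) = gA a + gB b" if "a \<in> A" "b \<in> B" for a b
    using g(2) f[OF that] ssumI[OF that] by simp
  have "g a = gA a" if "a \<in> A" for a
    using gab[OF that Fq.subspace_0[OF ss(2)]] lin_zero[OF lB] by simp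
  moreover have "g b = gB b" if "b \<in> B" for b
    using gab[OF Fq.subspace_0[OF ss(1)] that] lin_zero[OF lA] by simp
  ultimately show ?thesis using g(1) by blast
qed

lemma image_ssum:
  assumes "lin g"
  shows "g ` ssum A B = ssum (g ` A) (g ` B)"
proof (intro equalityI subsetI)
  fix x assume "x \<in> g ` ssum A B"
  then obtain a b where "x = g (a + b)" "a \<in> A" "b \<in> B" by (auto simp: ssum_def)
  then show "x \<in> ssum (g ` A) (g ` B)" by (simp add: lin_add[OF assms] ssumI)
next
  fix x assume "x \<in> ssum (g ` A) (g ` B)"
  then obtain a b where "x = g a + g b" "a \<in> A" "b \<in> B" by (auto simp: ssum_def)
  then have "x = g (a + b)" "a + b \<in> ssum A B" by (simp_all add: lin_add[OF assms] ssumI)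
  then show "x \<in> g ` ssum A B" by blast
qed

section \<open>Dimension by counting over a finite field\<close>

lemma card_span_independent:
  fixes B :: "(nat \<Rightarrow> 'a::{field,finite}) set"
  assumes "finite B" "Fq.independent B"
  shows "card (Fq.span B) = CARD('a) ^ card B \<and> finite (Fq.span B)"
  using assms
proof (induction B rule: finite_induct)
  case empty
  then show ?case by simp
next
  case (insert b B)
  have ind: "Fq.independent B" "b \<notin> Fq.span B"
    using insert by (simp_all add: Fq.independent_insert)
  have b0: "b \<noteq> 0" using ind(2) Fq.span_zero by metis
  have "Fq.span (insert b B) = ssum (Fq.span {b}) (Fq.span B)"
    using Fq.span_Un[of "{b}" B] by (simp add: ssum_def)
  moreover have "Fq.span {b} \<inter> Fq.span B = {0}"
  proof -
    have "x = 0" if x: "x \<in> Fq.span {b}" "x \<in> Fq.span B" for x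
    proof -
      obtain c where c: "x = vscale c b" using x(1) by (auto simp: Fq.span_singleton)
      show "x = 0"
      proof (cases "c = 0")
        case False
        then have "b = vscale (1 / c) x" by (simp add: c vscale_def)
        then have "b \<in> Fq.span B" using x(2) by (simp add: Fq.span_scale)
        with ind(2) show ?thesis by simp
      qed (simp add: c)
    qed
    then show ?thesis using Fq.span_zero by blast
  qed
  moreover have "card (Fq.span {b}) = CARD('a)"
    unfolding Fq.span_singleton using b0 by (subst card_image) (auto simp: inj_on_def)
  moreover have "finite (Fq.span {b})"
    unfolding Fq.span_singleton by simp
  ultimately show ?case
    using insert ind by (simp add: card_ssum finite_ssum)
qed

lemma card_subspace:
  fixes V :: "(nat \<Rightarrow> 'a::{field,finite}) set"
  assumes "Fq.subspace V" "finite V"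
  shows "card V = CARD('a) ^ Fq.dim V"
proof -
  obtain B where B: "B \<subseteq> V" "Fq.independent B" "V \<subseteq> Fq.span B" "card B = Fq.dim V"
    by (rule Fq.basis_exists)
  have "Fq.span B = V" using B assms by (simp add: Fq.span_subspace)
  with card_span_independent[of B] B assms(2) show ?thesis
    by (metis finite_subset)
qed

lemma card_field_gt_1: "CARD('a::{field,finite}) > 1"
proof -
  have "card {0, 1 :: 'a} \<le> CARD('a)" by (rule card_mono) auto
  then show ?thesis by simp
qed

lemma dim_eq_iff_card:
  fixes V W :: "(nat \<Rightarrow> 'a::{field,finite}) set"
  assumes "Fq.subspace V" "finite V" "Fq.subspace W" "finite W"
  shows "Fq.dim V = Fq.dim W \<longleftrightarrow> card V = card W"
  using assms card_field_gt_1[where 'a='a] by (simp add: card_subspace)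

lemma subspace_eq_if_dim:
  fixes V W :: "(nat \<Rightarrow> 'a::{field,finite}) set"
  assumes "Fq.subspace V" "finite V" "Fq.subspace W" "W \<subseteq> V" "Fq.dim W = Fq.dim V"
  shows "W = V"
  using assms by (metis card_subset_eq card_subspace finite_subset)

lemma dim_ssum:
  fixes A B :: "(nat \<Rightarrow> 'a::{field,finite}) set"
  assumes "Fq.subspace A" "Fq.subspace B" "A \<inter> B = {0}" "finite A" "finite B"
  shows "Fq.dim (ssum A B) = Fq.dim A + Fq.dim B"
proof -
  have "CARD('a) ^ Fq.dim (ssum A B) = CARD('a) ^ (Fq.dim A + Fq.dim B)"
    using card_ssum[OF assms(1-3)] assms
    by (simp add: power_add card_subspace subspace_ssum finite_ssum)
  then show ?thesis using card_field_gt_1[where 'a='a] power_inject_exp by blast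
qed

lemma dim_0_iff:
  fixes V :: "(nat \<Rightarrow> 'a::{field,finite}) set"
  assumes "Fq.subspace V" "finite V"
  shows "Fq.dim V = 0 \<longleftrightarrow> V = {0}"
proof
  assume "Fq.dim V = 0"
  then have "card V = 1" using card_subspace[OF assms] by simp
  then show "V = {0}" using Fq.subspace_0[OF assms(1)] card_1_singletonE by blast
next
  assume "V = {0}"
  then have "CARD('a) ^ Fq.dim V = 1" using card_subspace[OF assms] by simp
  then show "Fq.dim V = 0" using card_field_gt_1[where 'a='a] by simp
qed

lemma dim_singleton: "v \<noteq> 0 \<Longrightarrow> Fq.dim {v} = 1"
  by (subst Fq.dim_eq_card_independent) auto

lemma dim_0_zero [simp]: "Fq.dim {0 :: nat \<Rightarrow> 'a::{field,finite}} = 0"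
  by (subst dim_0_iff) auto

lemma subspace_complement:
  fixes V W :: "(nat \<Rightarrow> 'a::field) set"
  assumes "Fq.subspace V" "Fq.subspace W" "W \<subseteq> V"
  shows "\<exists>C. Fq.subspace C \<and> C \<subseteq> V \<and> C \<inter> W = {0} \<and> ssum C W = V"
proof -
  obtain B where B: "B \<subseteq> W" "Fq.independent B" "W \<subseteq> Fq.span B"
    using Fq.basis_exists by metis
  obtain D where D: "B \<subseteq> D" "D \<subseteq> V" "Fq.independent D" "V \<subseteq> Fq.span D"
    using Fq.maximal_independent_subset_extend[of B V] B assms by blast
  have W: "Fq.span B = W" using B assms by (simp add: Fq.span_subspace)
  have V: "Fq.span D = V" using D assms by (simp add: Fq.span_subspace)
  define C where "C = Fq.span (D - B)"
  have "ssum C W = Fq.span ((D - B) \<union> B)"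
    unfolding Fq.span_Un ssum_def C_def W ..
  also have "(D - B) \<union> B = D" using D by blast
  finally have 1: "ssum C W = V" using V by simp
  \<comment> \<open>The projection onto \<open>W\<close> along \<open>C\<close>: it is the identity
    on \<open>W\<close> and zero on \<open>C\<close>, so a common vector is zero.\<close>
  obtain g where g: "lin g" "\<forall>x\<in>D. g x = (if x \<in> B then x else 0)"
    using Fq2.linear_independent_extend[OF D(3), of "\<lambda>x. if x \<in> B then x else 0"] by blast
  have gW: "g x = x" if "x \<in> W" for x
    using Fq2.linear_eq_on[OF g(1) Fq.linear_ident, of x B] that W g(2) D(1) by (metis subsetD)
  have gC: "g x = 0" if "x \<in> C" for x
    using Fq2.linear_eq_on[OF g(1) Fq2.linear_zero, of x "D - B"] that g(2)
    unfolding C_def by auto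
  have "C \<inter> W = {0}"
    using gW gC Fq.subspace_0[OF assms(2)] Fq.span_zero[of "D - B"] unfolding C_def
    by force
  moreover have "C \<subseteq> V" unfolding C_def using V D Fq.span_mono[of "D - B" D] by blast
  ultimately show ?thesis using 1 unfolding C_def by blast
qed

section \<open>Coordinate spaces\<close>

lemma subspace_coord_space: "Fq.subspace (coord_space n)"
  by (auto simp: Fq.subspace_def coord_space_def vscale_def)

lemma card_coord_space:
  "card (coord_space n :: (nat \<Rightarrow> 'a::{field,finite}) set) = CARD('a) ^ n \<and>
   finite (coord_space n :: (nat \<Rightarrow> 'a) set)"
proof -
  let ?S = "coord_space n :: (nat \<Rightarrow> 'a) set" and ?E = "{..<n} \<rightarrow>\<^sub>E (UNIV :: 'a set)"
  have "bij_betw (\<lambda>v. restrict v {..<n}) ?S ?E"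
    by (rule bij_betw_byWitness[where f' = "\<lambda>v i. if i < n then v i else 0"])
      (auto simp: coord_space_def fun_eq_iff PiE_def extensional_def)
  moreover have "finite ?E" "card ?E = CARD('a) ^ n"
    by (simp_all add: finite_PiE card_PiE)
  ultimately show ?thesis by (metis bij_betw_same_card bij_betw_finite)
qed

lemmas finite_coord_space = card_coord_space[THEN conjunct2]

lemma dim_coord_space: "Fq.dim (coord_space n :: (nat \<Rightarrow> 'a::{field,finite}) set) = n"
proof -
  have "CARD('a) ^ Fq.dim (coord_space n :: (nat \<Rightarrow> 'a) set) = CARD('a) ^ n"
    using card_subspace[OF subspace_coord_space finite_coord_space, of n, where 'a='a]
      card_coord_space[of n, where 'a='a] by simp
  then show ?thesis using card_field_gt_1[where 'a='a] power_inject_exp by blast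
qed

lemma subspace_isomorphism:
  fixes V W :: "(nat \<Rightarrow> 'a::{field,finite}) set"
  assumes "Fq.subspace V" "finite V" "Fq.subspace W" "finite W" "Fq.dim V = Fq.dim W"
  shows "\<exists>g. lin g \<and> inj_on g V \<and> g ` V = W"
proof -
  obtain B where B: "B \<subseteq> V" "Fq.independent B" "V \<subseteq> Fq.span B" "card B = Fq.dim V"
    by (rule Fq.basis_exists)
  obtain C where C: "C \<subseteq> W" "Fq.independent C" "W \<subseteq> Fq.span C" "card C = Fq.dim W"
    by (rule Fq.basis_exists)
  have "finite B" "finite C" using assms B C finite_subset by blast+
  with Fq2.finite_basis_to_basis_subspace_isomorphism[of V W B C] assms B C
  show ?thesis by auto
qed

lemma dim_image_inj:
  fixes V :: "(nat \<Rightarrow> 'a::{field,finite}) set"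
  assumes "lin g" "inj_on g V" "Fq.subspace V" "finite V"
  shows "Fq.dim (g ` V) = Fq.dim V"
  using assms by (subst dim_eq_iff_card)
    (auto simp: card_image intro: module_hom.subspace_image[OF Vector_Spaces.linear.axioms(3)])

lemma subspace_image: "lin g \<Longrightarrow> Fq.subspace V \<Longrightarrow> Fq.subspace (g ` V)"
  by (rule module_hom.subspace_image[OF Vector_Spaces.linear.axioms(3)])

section \<open>Quadratic spaces and orthogonal sums\<close>

text \<open>Only vectors of \<open>V\<close> are constrained and \<open>V\<close> may be degenerate,
  so the locale passes to every subspace, including \<open>U\<close> and its radical.\<close>

locale qspace =
  fixes Q :: "(nat \<Rightarrow> 'a::{field,finite}) \<Rightarrow> 'a" and V :: "(nat \<Rightarrow> 'a) set"
  assumes two: "(2::'a) \<noteq> 0"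
    and subspace: "Fq.subspace V"
    and finite: "finite V"
    and Q_scale: "v \<in> V \<Longrightarrow> Q (vscale c v) = c\<^sup>2 * Q v"
    and polar_add: "u \<in> V \<Longrightarrow> v \<in> V \<Longrightarrow> w \<in> V \<Longrightarrow> polar Q (u + v) w = polar Q u w + polar Q v w"
    and polar_scale: "v \<in> V \<Longrightarrow> w \<in> V \<Longrightarrow> polar Q (vscale c v) w = c * polar Q v w"
begin

lemma zero_mem [simp]: "0 \<in> V"
  using subspace by (rule Fq.subspace_0)

lemma add_mem [simp]: "u \<in> V \<Longrightarrow> v \<in> V \<Longrightarrow> u + v \<in> V"
  using subspace by (rule Fq.subspace_add)

lemma scale_mem [simp]: "v \<in> V \<Longrightarrow> vscale c v \<in> V"
  using subspace by (rule Fq.subspace_scale)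

lemma diff_mem [simp]: "u \<in> V \<Longrightarrow> v \<in> V \<Longrightarrow> u - v \<in> V"
  using subspace by (rule Fq.subspace_diff)

lemma polar_add_right:
  "u \<in> V \<Longrightarrow> v \<in> V \<Longrightarrow> w \<in> V \<Longrightarrow> polar Q w (u + v) = polar Q w u + polar Q w v"
  using polar_add polar_sym by metis

lemma polar_scale_right: "v \<in> V \<Longrightarrow> w \<in> V \<Longrightarrow> polar Q w (vscale c v) = c * polar Q w v"
  using polar_scale polar_sym by metis

lemma polar_zero [simp]: "w \<in> V \<Longrightarrow> polar Q 0 w = 0"
  using polar_scale[of 0 w 0] by simp

lemma polar_zero_right [simp]: "w \<in> V \<Longrightarrow> polar Q w 0 = 0"
  using polar_zero polar_sym by metis

lemma polar_diff:
  assumes "u \<in> V" "v \<in> V" "w \<in> V"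
  shows "polar Q (u - v) w = polar Q u w - polar Q v w"
proof -
  have "polar Q u w = polar Q (u - v) w + polar Q v w"
    using polar_add[of "u - v" v w] assms by simp
  then show ?thesis by simp
qed

lemma polar_diff_right:
  "u \<in> V \<Longrightarrow> v \<in> V \<Longrightarrow> w \<in> V \<Longrightarrow> polar Q w (u - v) = polar Q w u - polar Q w v"
  using polar_diff polar_sym by metis

lemmas polar_simps = polar_add polar_add_right polar_scale polar_scale_right
  polar_diff polar_diff_right

lemma polar_same [simp]: "v \<in> V \<Longrightarrow> polar Q v v = Q v"
proof -
  assume v: "v \<in> V"
  have "v + v = vscale 2 v" by (simp add: vscale_def fun_eq_iff)
  then have "Q (v + v) = 2 * (2 * Q v)" using Q_scale[OF v, of 2] by (simp add: power2_eq_square)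
  then show ?thesis using two by (simp add: polar_def)
qed

lemma Q_zero [simp]: "Q 0 = 0"
  using Q_scale[of 0 0] by simp

lemma Q_add: "Q (v + w) = Q v + Q w + 2 * polar Q v w"
  using two by (simp add: polar_def field_simps)

lemma polar_isotropic:
  assumes "Fq.subspace R" "\<And>x. x \<in> R \<Longrightarrow> Q x = 0" "x \<in> R" "y \<in> R"
  shows "polar Q x y = 0"
  unfolding polar_def assms(2)[OF assms(3)] assms(2)[OF assms(4)]
    assms(2)[OF Fq.subspace_add[OF assms(1,3,4)]] by simp

lemma qspace_subspace: "Fq.subspace W \<Longrightarrow> W \<subseteq> V \<Longrightarrow> qspace Q W"
  by unfold_locales
    (use two finite finite_subset in \<open>auto simp: Q_scale polar_add polar_scale subset_iff\<close>)

lemma subspace_orth: "W \<subseteq> V \<Longrightarrow> Fq.subspace {v \<in> V. \<forall>w\<in>W. polar Q v w = 0}"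
  by (rule Fq.subspaceI) (auto simp: polar_add polar_scale subset_iff)

lemma subspace_radical: "Fq.subspace (radical Q V)"
  unfolding radical_def by (rule subspace_orth) simp

text \<open>The linear functional \<open>polar Q _ x\<close> is nonzero at \<open>w\<close>, so its
  kernel in \<open>W\<close> is a hyperplane complementary to the line of \<open>w\<close>.\<close>

lemma hyperplane_split:
  assumes "Fq.subspace W" "W \<subseteq> V" "x \<in> V" "w \<in> W" "polar Q w x \<noteq> 0"
  defines "W1 \<equiv> {v \<in> W. polar Q v x = 0}"
  shows "Fq.subspace W1" "W = ssum (Fq.span {w}) W1" "Fq.span {w} \<inter> W1 = {0}"
    "Fq.dim W = Suc (Fq.dim W1)"
proof -
  interpret W: qspace Q W using assms by (simp add: qspace_subspace)
  have wV: "w \<in> V" using assms by auto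
  show 1: "Fq.subspace W1"
    unfolding W1_def using assms by (intro Fq.subspaceI) (auto simp: polar_add polar_scale subset_iff)
  show 2: "W = ssum (Fq.span {w}) W1"
  proof (intro equalityI subsetI)
    fix v assume v: "v \<in> W"
    let ?c = "polar Q v x / polar Q w x"
    have "v \<in> V" using v assms by auto
    then have "v - vscale ?c w \<in> W1"
      unfolding W1_def using v assms wV by (simp add: polar_simps)
    moreover have "vscale ?c w \<in> Fq.span {w}" by (simp add: Fq.span_base Fq.span_scale)
    ultimately have "vscale ?c w + (v - vscale ?c w) \<in> ssum (Fq.span {w}) W1" by (intro ssumI)
    then show "v \<in> ssum (Fq.span {w}) W1" by simp
  next
    fix v assume "v \<in> ssum (Fq.span {w}) W1"
    then show "v \<in> W"
      using ssum_subset[OF assms(1), of "Fq.span {w}" W1] Fq.span_minimal[of "{w}" W] assms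
      by (auto simp: W1_def)
  qed
  show 3: "Fq.span {w} \<inter> W1 = {0}"
  proof -
    have "vscale k w = 0" if "vscale k w \<in> W1" for k
      using that wV assms(3,5) by (simp add: W1_def polar_scale)
    then show ?thesis
      using Fq.subspace_0[OF 1] by (auto simp: Fq.span_singleton intro: range_eqI[of _ _ 0])
  qed
  have "w \<noteq> 0" using assms(3,5) by auto
  have "Fq.span {w} \<subseteq> W" using assms by (intro Fq.span_minimal) auto
  then have "finite (Fq.span {w})" "finite W1" using W.finite
    by (auto simp: W1_def intro: finite_subset)
  then have "Fq.dim (ssum (Fq.span {w}) W1) = Fq.dim (Fq.span {w}) + Fq.dim W1"
    using 1 3 by (intro dim_ssum) auto
  then show "Fq.dim W = Suc (Fq.dim W1)"
    using 2 dim_singleton[OF \<open>w \<noteq> 0\<close>] by simp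
qed

text \<open>Orthogonal projection onto \<open>A\<close> by Gram-Schmidt. If every vector of
  \<open>A\<close> is isotropic, then \<open>A\<close> is its own radical, hence zero; otherwise a
  vector \<open>u\<close> with \<open>Q u \<noteq> 0\<close> is split off and the induction
  continues in the part of \<open>A\<close> orthogonal to \<open>u\<close>.\<close>

lemma nondegenerate_projection:
  assumes "Fq.subspace A" "A \<subseteq> V" "radical Q A = {0}" "v \<in> V"
  shows "\<exists>a\<in>A. \<forall>x\<in>A. polar Q (v - a) x = 0"
  using assms
proof (induction "Fq.dim A" arbitrary: A v rule: less_induct)
  case less
  interpret A: qspace Q A using less by (simp add: qspace_subspace)
  show ?case
  proof (cases "\<forall>u\<in>A. Q u = 0")
    case True
    then have "radical Q A = A"
      using polar_isotropic[OF less(2)] by (auto simp: radical_def)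
    then have "A = {0}" using less by simp
    then show ?thesis using less by simp
  next
    case False
    then obtain u where u: "u \<in> A" "Q u \<noteq> 0" by blast
    have uV: "u \<in> V" using u less by auto
    have pu: "polar Q u u \<noteq> 0" using u by simp
    define B where "B = {a \<in> A. polar Q a u = 0}"
    note sp = hyperplane_split[OF less(2,3) uV u(1) pu, folded B_def]
    have BV: "B \<subseteq> V" "B \<subseteq> A" using less by (auto simp: B_def)
    have dec: "\<exists>k b. a = vscale k u + b \<and> b \<in> B" if "a \<in> A" for a
      using that unfolding sp(2) by (auto simp: ssum_def Fq.span_singleton)
    have orthA: "\<forall>a\<in>A. polar Q x a = 0"
      if x: "x \<in> V" "polar Q x u = 0" "\<forall>b\<in>B. polar Q x b = 0" for x
    proof
      fix a assume "a \<in> A"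
      then obtain k b where "a = vscale k u + b" "b \<in> B" using dec by blast
      then show "polar Q x a = 0" using x uV BV by (auto simp: polar_simps subset_iff)
    qed
    have "radical Q B = {0}"
    proof -
      have "x = 0" if "x \<in> radical Q B" for x
      proof -
        have "x \<in> radical Q A"
          using that orthA[of x] BV by (auto simp: radical_def B_def)
        then show ?thesis using less by simp
      qed
      then show ?thesis
        using Fq.subspace_0[OF sp(1)] BV by (auto simp: radical_def subset_iff)
    qed
    \<comment> \<open>\<open>?v'\<close> is orthogonal to \<open>u\<close>, and stays so after
      subtracting a vector of \<open>B\<close>, because \<open>B\<close> is orthogonal to
      \<open>u\<close>.\<close>
    moreover have "v - vscale (polar Q v u / Q u) u \<in> V" (is "?v' \<in> V")
      using less uV by simp
    ultimately obtain a where a: "a \<in> B" "\<forall>b\<in>B. polar Q (?v' - a) b = 0"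
      using less(1)[of B ?v'] sp(1,4) BV by auto
    have aV: "a \<in> V" using a BV by auto
    have "polar Q (?v' - a) u = 0"
      using a(1) u uV less(5) aV by (simp add: polar_simps B_def)
    then have "\<forall>x\<in>A. polar Q (?v' - a) x = 0"
      using orthA[of "?v' - a"] a(2) aV less uV by simp
    moreover have "?v' - a = v - (vscale (polar Q v u / Q u) u + a)" by simp
    ultimately show ?thesis
      using a BV u by (intro bexI[of _ "vscale (polar Q v u / Q u) u + a"]) auto
  qed
qed

end

lemma qspace_coord_space:
  "(2::'a::{field,finite}) \<noteq> 0 \<Longrightarrow> quadratic_form n (Q :: (nat \<Rightarrow> 'a) \<Rightarrow> 'a) = qspace Q (coord_space n)"
  by (auto simp: quadratic_form_def qspace_def subspace_coord_space finite_coord_space)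

section \<open>Orthogonal direct sums\<close>

definition osum ::
  "((nat \<Rightarrow> 'a::field) \<Rightarrow> 'a) \<Rightarrow> (nat \<Rightarrow> 'a) set \<Rightarrow> (nat \<Rightarrow> 'a) set \<Rightarrow> (nat \<Rightarrow> 'a) set \<Rightarrow> bool" where
  "osum Q V A B \<longleftrightarrow> Fq.subspace A \<and> Fq.subspace B \<and> A \<inter> B = {0} \<and> V = ssum A B \<and>
     (\<forall>a\<in>A. \<forall>b\<in>B. polar Q a b = 0)"

lemma osum_subset: "osum Q V A B \<Longrightarrow> A \<subseteq> V" "osum Q V A B \<Longrightarrow> B \<subseteq> V"
  by (auto simp: osum_def dest: ssum_superset1 ssum_superset2)

lemma ssum_commute:
  fixes A B :: "(nat \<Rightarrow> 'a::field) set"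
  shows "ssum A B = ssum B A"
proof -
  have "ssum A B \<subseteq> ssum B A" for A B :: "(nat \<Rightarrow> 'a) set"
  proof
    fix x assume "x \<in> ssum A B"
    then obtain a b where "x = b + a" "a \<in> A" "b \<in> B" unfolding ssum_def using add.commute by blast
    then show "x \<in> ssum B A" by (simp add: ssumI)
  qed
  then show ?thesis by blast
qed

lemma ssum_assoc: "ssum (ssum A B) C = ssum A (ssum B C)"
proof (intro equalityI subsetI)
  fix x assume "x \<in> ssum (ssum A B) C"
  then obtain a b c where "x = a + (b + c)" "a \<in> A" "b \<in> B" "c \<in> C"
    unfolding ssum_def using add.assoc by blast
  then show "x \<in> ssum A (ssum B C)" by (simp add: ssumI)
next
  fix x assume "x \<in> ssum A (ssum B C)"
  then obtain a b c where "x = (a + b) + c" "a \<in> A" "b \<in> B" "c \<in> C"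
    unfolding ssum_def using add.assoc[symmetric] by blast
  then show "x \<in> ssum (ssum A B) C" by (simp add: ssumI del: add.assoc)
qed

lemma ssum_zero [simp]: "ssum {0} A = A"
  by (auto simp: ssum_def)

lemma osum_commute: "osum Q V A B \<Longrightarrow> osum Q V B A"
  unfolding osum_def by (metis Int_commute polar_sym ssum_commute)

text \<open>Lets a hyperbolic plane \<open>C\<close> be peeled off the first summand of an
  orthogonal sum, which is how \<open>witt_decomp_osum\<close> carries a decomposition
  along.\<close>

lemma osum_assoc:
  assumes "qspace Q V" "osum Q V A B" "osum Q A C D"
  shows "osum Q V C (ssum D B)" "osum Q (ssum D B) D B"
proof -
  interpret qspace Q V by fact
  have sub: "A \<subseteq> V" "B \<subseteq> V" "C \<subseteq> A" "D \<subseteq> A"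
    using osum_subset[OF assms(2)] osum_subset[OF assms(3)] by auto
  have ss: "Fq.subspace A" "Fq.subspace B" "Fq.subspace C" "Fq.subspace D"
    using assms by (auto simp: osum_def)
  have V: "V = ssum C (ssum D B)" using assms by (simp add: osum_def ssum_assoc)
  have "D \<inter> B = {0}" using assms sub ss Fq.subspace_0 by (auto simp: osum_def)
  then show "osum Q (ssum D B) D B" using assms sub ss by (auto simp: osum_def subset_iff)
  have "x = 0" if x: "x \<in> C" "x \<in> ssum D B" for x
  proof -
    obtain d b where db: "x = d + b" "d \<in> D" "b \<in> B" using x(2) by (auto simp: ssum_def)
    have "b = 0" using ssum_unique(2)[of A B x d 0 b] assms(2) db x sub ss
      by (auto simp: osum_def subset_iff Fq.subspace_0)
    then show ?thesis using assms(3) db x by (auto simp: osum_def)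
  qed
  then have "C \<inter> ssum D B = {0}"
    using Fq.subspace_0[OF ss(3)] Fq.subspace_0[OF subspace_ssum[OF ss(4,2)]] by auto
  moreover have "polar Q c x = 0" if "c \<in> C" "x \<in> ssum D B" for c x
    using that assms sub unfolding osum_def by (auto simp: ssum_def polar_simps subset_iff)
  ultimately show "osum Q V C (ssum D B)"
    using V ss by (auto simp: osum_def subspace_ssum)
qed

lemma osum_dim:
  assumes "qspace Q V" "osum Q V A B"
  shows "Fq.dim V = Fq.dim A + Fq.dim B"
proof -
  have "finite A" "finite B"
    using osum_subset[OF assms(2)] qspace.finite[OF assms(1)] by (auto intro: finite_subset)
  then show ?thesis using assms(2) by (simp add: osum_def dim_ssum)
qed

text \<open>Radicals add up over an orthogonal sum, since testing a vector against one summand only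
  sees its component there.\<close>

lemma osum_nondegenerate_iff:
  assumes "qspace Q V" "osum Q V A B"
  shows "radical Q V = {0} \<longleftrightarrow> radical Q A = {0} \<and> radical Q B = {0}"
proof -
  interpret qspace Q V by fact
  have sub: "A \<subseteq> V" "B \<subseteq> V" using osum_subset[OF assms(2)] by auto
  have ss: "Fq.subspace A" "Fq.subspace B" and V: "V = ssum A B"
    and orth: "\<And>a b. a \<in> A \<Longrightarrow> b \<in> B \<Longrightarrow> polar Q a b = 0"
    using assms(2) by (auto simp: osum_def)
  have orth': "polar Q b a = 0" if "a \<in> A" "b \<in> B" for a b
    using orth[OF that] by (simp add: polar_sym)
  have z: "0 \<in> radical Q A" "0 \<in> radical Q B" "0 \<in> radical Q V"
    using Fq.subspace_0[OF ss(1)] Fq.subspace_0[OF ss(2)] sub by (auto simp: radical_def subset_iff)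
  have 1: "radical Q A \<subseteq> radical Q V" "radical Q B \<subseteq> radical Q V"
    using sub by (auto simp: radical_def V ssum_def orth orth' polar_add_right subset_iff)
  have 2: "radical Q V \<subseteq> ssum (radical Q A) (radical Q B)"
  proof
    fix x assume x: "x \<in> radical Q V"
    then obtain a b where ab: "x = a + b" "a \<in> A" "b \<in> B" by (auto simp: V radical_def ssum_def)
    have "polar Q a a' = 0" if "a' \<in> A" for a'
    proof -
      have "polar Q x a' = 0" using x that sub by (auto simp: radical_def)
      then show ?thesis using ab that sub orth' by (auto simp: polar_add subset_iff)
    qed
    moreover have "polar Q b b' = 0" if "b' \<in> B" for b'
    proof -
      have "polar Q x b' = 0" using x that sub by (auto simp: radical_def)
      then show ?thesis using ab that sub orth by (auto simp: polar_add subset_iff)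
    qed
    ultimately show "x \<in> ssum (radical Q A) (radical Q B)"
      using ab by (auto simp: radical_def intro: ssumI)
  qed
  show ?thesis using 1 2 z by (auto simp: ssum_def)
qed

text \<open>\<open>A\<close> meets its orthogonal space in its radical, which is zero, and the
  orthogonal projection onto \<open>A\<close> shows that the two span \<open>V\<close>.\<close>

lemma osum_orth:
  assumes "qspace Q V" "Fq.subspace A" "A \<subseteq> V" "radical Q A = {0}"
  shows "osum Q V A {v \<in> V. \<forall>a\<in>A. polar Q v a = 0}" (is "osum Q V A ?B")
proof -
  interpret qspace Q V by fact
  interpret A: qspace Q A using assms by (simp add: qspace_subspace)
  have B: "Fq.subspace ?B" using assms(3) by (rule subspace_orth)
  have "A \<inter> ?B = radical Q A" using assms(3) by (auto simp: radical_def)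
  moreover have "V \<subseteq> ssum A ?B"
  proof
    fix v assume v: "v \<in> V"
    obtain a where a: "a \<in> A" "\<forall>x\<in>A. polar Q (v - a) x = 0"
      using nondegenerate_projection[OF assms(2-4) v] by blast
    have "v - a \<in> ?B" using a v assms(3) by auto
    then have "a + (v - a) \<in> ssum A ?B" using a by (intro ssumI)
    then show "v \<in> ssum A ?B" by simp
  qed
  moreover have "ssum A ?B \<subseteq> V" using assms by (intro ssum_subset) (auto simp: subspace)
  ultimately show ?thesis
    using assms B unfolding osum_def by (auto simp: polar_sym)
qed

section \<open>Similarities and Witt decompositions\<close>

definition sim ::
  "'a::field \<Rightarrow> ((nat \<Rightarrow> 'a) \<Rightarrow> 'a) \<Rightarrow> (nat \<Rightarrow> 'a) set \<Rightarrow> ((nat \<Rightarrow> 'a) \<Rightarrow> 'a) \<Rightarrow> (nat \<Rightarrow> 'a) set \<Rightarrow>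
    ((nat \<Rightarrow> 'a) \<Rightarrow> (nat \<Rightarrow> 'a)) \<Rightarrow> bool" where
  "sim c Q V Q' V' g \<longleftrightarrow> lin g \<and> inj_on g V \<and> g ` V = V' \<and> (\<forall>v\<in>V. Q' (g v) = c * Q v)"

lemma sim_polar:
  assumes "sim c Q V Q' V' g" "Fq.subspace V" "v \<in> V" "w \<in> V"
  shows "polar Q' (g v) (g w) = c * polar Q v w"
proof -
  have "g v + g w = g (v + w)" using assms(1) lin_add[of g v w] by (simp add: sim_def)
  then show ?thesis
    using assms Fq.subspace_add[OF assms(2-4)]
    by (simp add: sim_def polar_def algebra_simps diff_divide_distrib add_divide_distrib)
qed

lemma sim_subspace:
  assumes "sim c Q V Q' V' g" "W \<subseteq> V"
  shows "sim c Q W Q' (g ` W) g"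
  using assms unfolding sim_def by (auto intro: inj_on_subset)

lemma sim_inverse:
  assumes "sim c Q V Q' V' g" "Fq.subspace V" "c \<noteq> 0"
  shows "\<exists>h. sim (1 / c) Q' V' Q V h \<and> (\<forall>v\<in>V. h (g v) = v)"
proof -
  obtain h where h: "lin h" "\<forall>v\<in>V. h (g v) = v"
    using Fq2.linear_exists_left_inverse_on[of g V] assms by (auto simp: sim_def)
  have V': "V' = g ` V" using assms(1) by (simp add: sim_def)
  have "inj_on h V'" using h by (auto simp: V' inj_on_def)
  moreover have "h ` V' = V" using h by (force simp: V')
  moreover have "Q (h w) = 1 / c * Q' w" if "w \<in> V'" for w
    using that h assms by (auto simp: V' sim_def)
  ultimately show ?thesis using h by (auto simp: sim_def)
qed

text \<open>On \<open>a + b\<close> the cross terms vanish on both sides, so the values simply add.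
  This is where the two summands must share the multiplier \<open>c\<close>.\<close>

lemma sim_glue:
  assumes V: "qspace Q V" and V': "qspace Q' V'"
    and o: "osum Q V A B" and o': "osum Q' V' A' B'"
    and gA: "sim c Q A Q' A' gA" and gB: "sim c Q B Q' B' gB"
  shows "\<exists>g. sim c Q V Q' V' g \<and> (\<forall>a\<in>A. g a = gA a) \<and> (\<forall>b\<in>B. g b = gB b)"
proof -
  interpret V: qspace Q V by fact
  interpret V': qspace Q' V' by fact
  have ss: "Fq.subspace A" "Fq.subspace B" "A \<inter> B = {0}" and VAB: "V = ssum A B"
    and orth: "\<forall>a\<in>A. \<forall>b\<in>B. polar Q a b = 0"
    using o by (auto simp: osum_def)
  have ss': "Fq.subspace A'" "Fq.subspace B'" "A' \<inter> B' = {0}" and VAB': "V' = ssum A' B'"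
    and orth': "\<forall>a\<in>A'. \<forall>b\<in>B'. polar Q' a b = 0"
    using o' by (auto simp: osum_def)
  have lA: "lin gA" and lB: "lin gB" using gA gB by (auto simp: sim_def)
  have dec: "\<exists>a b. v = a + b \<and> a \<in> A \<and> b \<in> B" if "v \<in> V" for v
    using that by (auto simp: VAB ssum_def)
  obtain g where g: "lin g" "\<forall>a\<in>A. g a = gA a" "\<forall>b\<in>B. g b = gB b"
    using linear_glue[OF ss lA lB] by blast
  have gab: "g (a + b) = gA a + gB b" if "a \<in> A" "b \<in> B" for a b
    using g that by (simp add: lin_add[OF g(1)])
  have imA: "gA a \<in> A'" if "a \<in> A" for a using gA that by (auto simp: sim_def)
  have imB: "gB b \<in> B'" if "b \<in> B" for b using gB that by (auto simp: sim_def)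
  have "inj_on g V"
  proof (rule inj_onI)
    fix u v assume "u \<in> V" "v \<in> V" "g u = g v"
    then obtain a b a' b' where *: "u = a + b" "a \<in> A" "b \<in> B" "v = a' + b'" "a' \<in> A" "b' \<in> B"
      using dec by metis
    then have "gA a + gB b = gA a' + gB b'" using gab \<open>g u = g v\<close> by metis
    then have "gA a = gA a'" "gB b = gB b'"
      using ssum_unique[OF ss' imA[OF *(2)] imA[OF *(5)] imB[OF *(3)] imB[OF *(6)]] by simp_all
    then show "u = v" using gA gB * by (auto simp: sim_def inj_on_def)
  qed
  moreover have "g ` V = V'"
  proof (intro equalityI subsetI)
    fix w assume "w \<in> g ` V"
    then obtain a b where "w = g (a + b)" "a \<in> A" "b \<in> B" using dec by blast
    then show "w \<in> V'" using gab imA imB by (auto simp: VAB' intro: ssumI)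
  next
    fix w assume "w \<in> V'"
    then obtain a' b' where "w = a' + b'" "a' \<in> A'" "b' \<in> B'" by (auto simp: VAB' ssum_def)
    moreover have "A' = gA ` A" "B' = gB ` B" using gA gB by (auto simp: sim_def)
    ultimately obtain a b where "w = gA a + gB b" "a \<in> A" "b \<in> B" by blast
    then show "w \<in> g ` V" using gab by (metis VAB imageI ssumI)
  qed
  moreover have "Q' (g v) = c * Q v" if v: "v \<in> V" for v
  proof -
    obtain a b where *: "v = a + b" "a \<in> A" "b \<in> B" using dec[OF v] by blast
    have "Q' (gA a) = c * Q a" "Q' (gB b) = c * Q b" using gA gB * by (auto simp: sim_def)
    moreover have "polar Q' (gA a) (gB b) = 0" "polar Q a b = 0"
      using orth orth' imA imB * by blast+
    ultimately show ?thesis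
      using * gab V.Q_add[of a b] V'.Q_add[of "gA a" "gB b"] by (simp add: algebra_simps)
  qed
  ultimately show ?thesis using g by (auto simp: sim_def)
qed

lemma sim_osum_subspace:
  assumes "qspace Q V" "qspace Q' V'" "osum Q V A B" "osum Q' V' A' B'"
    and "sim c Q A Q' A' gA" "sim c Q B Q' B' gB"
    and "gA ` R = R'" "gB ` S = S'" "R \<subseteq> A" "S \<subseteq> B"
  shows "\<exists>g. sim c Q V Q' V' g \<and> (\<forall>a\<in>A. g a = gA a) \<and> (\<forall>b\<in>B. g b = gB b) \<and>
    g ` ssum R S = ssum R' S'"
proof -
  obtain g where g: "sim c Q V Q' V' g" "\<forall>a\<in>A. g a = gA a" "\<forall>b\<in>B. g b = gB b"
    using sim_glue[OF assms(1-6)] by blast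
  have "lin g" using g by (simp add: sim_def)
  have "g ` R = gA ` R" "g ` S = gB ` S" using g assms(9,10) by (auto intro!: image_cong)
  then have "g ` ssum R S = ssum (gA ` R) (gB ` S)" by (simp add: image_ssum[OF \<open>lin g\<close>])
  then show ?thesis using g assms(7,8) by auto
qed

section \<open>Hyperbolic pairs and Witt decompositions\<close>

definition hyp_pair :: "((nat \<Rightarrow> 'a::field) \<Rightarrow> 'a) \<Rightarrow> (nat \<Rightarrow> 'a) \<Rightarrow> (nat \<Rightarrow> 'a) \<Rightarrow> bool" where
  "hyp_pair Q r s \<longleftrightarrow> Q r = 0 \<and> Q s = 0 \<and> polar Q r s = 1"

lemma span_pair: "x \<in> Fq.span {r, s} \<longleftrightarrow> (\<exists>a b. x = vscale a r + vscale b s)"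
proof -
  have "Fq.span {r, s} = {x + y |x y. x \<in> Fq.span {r} \<and> y \<in> Fq.span {s}}"
    using Fq.span_Un[of "{r}" "{s}"] by (simp add: insert_commute)
  then show ?thesis by (auto simp: Fq.span_singleton)
qed

lemma ssum_span_singleton:
  "x \<in> ssum (Fq.span {r}) R \<longleftrightarrow> (\<exists>a y. x = vscale a r + y \<and> y \<in> R)"
  unfolding ssum_def Fq.span_singleton by blast

context qspace begin

lemma hyp_pair_values:
  assumes "r \<in> V" "s \<in> V" "hyp_pair Q r s"
  shows "polar Q (vscale a r + vscale b s) r = b" "polar Q (vscale a r + vscale b s) s = a"
    "Q (vscale a r + vscale b s) = 2 * a * b"
proof -
  have "polar Q s r = 1" using assms by (simp add: hyp_pair_def polar_sym[of Q s])
  then show "polar Q (vscale a r + vscale b s) r = b" "polar Q (vscale a r + vscale b s) s = a"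
    "Q (vscale a r + vscale b s) = 2 * a * b"
    using assms by (simp_all add: polar_simps Q_add Q_scale hyp_pair_def)
qed

lemma hyp_pair_dim:
  assumes "r \<in> V" "s \<in> V" "hyp_pair Q r s"
  shows "Fq.dim (Fq.span {r, s}) = 2" "radical Q (Fq.span {r, s}) = {0}" "Fq.span {r, s} \<subseteq> V"
proof -
  show sub: "Fq.span {r, s} \<subseteq> V" using assms by (intro Fq.span_minimal) (auto simp: subspace)
  have s: "s \<noteq> 0" using assms by (auto simp: hyp_pair_def)
  have "r \<notin> Fq.span {s}"
  proof
    assume "r \<in> Fq.span {s}"
    then obtain k where "r = vscale k s" by (auto simp: Fq.span_singleton)
    then show False using assms by (auto simp: polar_scale hyp_pair_def)
  qed
  then have "Fq.independent {r, s}" "r \<noteq> s" using s by (auto simp: Fq.independent_insert Fq.span_base)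
  then show "Fq.dim (Fq.span {r, s}) = 2"
    by (subst Fq.dim_span_eq_card_independent) simp_all
  have "x = 0" if x: "x \<in> radical Q (Fq.span {r, s})" for x
  proof -
    obtain a b where ab: "x = vscale a r + vscale b s"
      using x by (auto simp: radical_def span_pair)
    have "polar Q x r = 0" "polar Q x s = 0" using x by (auto simp: radical_def Fq.span_base)
    then show ?thesis using hyp_pair_values(1,2)[OF assms, of a b] ab by simp
  qed
  moreover have "0 \<in> radical Q (Fq.span {r, s})"
    using sub by (auto simp: radical_def Fq.span_zero)
  ultimately show "radical Q (Fq.span {r, s}) = {0}" by blast
qed

lemma hyp_pair_exists:
  assumes "radical Q V = {0}" "r \<in> V" "Q r = 0" "r \<noteq> 0"
  shows "\<exists>s\<in>V. hyp_pair Q r s"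
proof -
  have "r \<notin> radical Q V" using assms by simp
  then obtain w where w: "w \<in> V" "polar Q r w \<noteq> 0" using assms by (auto simp: radical_def)
  define s0 where "s0 = vscale (1 / polar Q r w) w"
  have s0: "s0 \<in> V" "polar Q r s0 = 1" using w assms by (auto simp: s0_def polar_scale_right)
  \<comment> \<open>As \<open>r\<close> is isotropic and pairs to 1 with \<open>s0\<close>, adding
    \<open>t\<close> times \<open>r\<close> changes the value by \<open>2 * t\<close>; this
    \<open>t\<close> makes the result vanish.\<close>
  define t where "t = - Q s0 / 2"
  define s where "s = s0 + vscale t r"
  have "s \<in> V" "polar Q r s = 1" using s0 assms by (auto simp: s_def polar_simps)
  moreover have "polar Q s0 r = 1" using s0 by (simp add: polar_sym)
  then have "Q s = Q s0 + 2 * t"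
    using s0 assms by (simp add: s_def Q_add Q_scale polar_scale_right)
  then have "Q s = 0" using two by (simp add: t_def)
  ultimately show ?thesis using assms by (auto simp: hyp_pair_def)
qed

end

text \<open>\<open>witt_decomp Q V k R B\<close>: \<open>V\<close> is the orthogonal sum of \<open>k\<close> hyperbolic planes and \<open>B\<close>,
  and \<open>R\<close> is spanned by one isotropic vector from each plane.\<close>

inductive witt_decomp ::
  "((nat \<Rightarrow> 'a::field) \<Rightarrow> 'a) \<Rightarrow> (nat \<Rightarrow> 'a) set \<Rightarrow> nat \<Rightarrow> (nat \<Rightarrow> 'a) set \<Rightarrow> (nat \<Rightarrow> 'a) set \<Rightarrow> bool"
  for Q where
  base: "Fq.subspace B \<Longrightarrow> witt_decomp Q B 0 {0} B"
| step: "hyp_pair Q r s \<Longrightarrow> osum Q V (Fq.span {r, s}) V2 \<Longrightarrow> witt_decomp Q V2 k R B \<Longrightarrow>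
    witt_decomp Q V (Suc k) (ssum (Fq.span {r}) R) B"

lemma hyp_mem:
  "osum Q V (Fq.span {r, s}) V2 \<Longrightarrow> r \<in> V" "osum Q V (Fq.span {r, s}) V2 \<Longrightarrow> s \<in> V"
  using osum_subset(1)[of Q V "Fq.span {r, s}" V2] by (auto simp: Fq.span_base)

lemma hyp_decompose:
  assumes "osum Q V (Fq.span {r, s}) V2" "v \<in> V"
  shows "\<exists>a b w. v = vscale a r + vscale b s + w \<and> w \<in> V2"
proof -
  obtain x w where "v = x + w" "x \<in> Fq.span {r, s}" "w \<in> V2"
    using assms unfolding osum_def ssum_def by blast
  then show ?thesis by (auto simp: span_pair)
qed

lemma witt_decomp_subsets:
  assumes "witt_decomp Q V k R B"
  shows "Fq.subspace R \<and> Fq.subspace B \<and> R \<subseteq> V \<and> B \<subseteq> V"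
  using assms
proof induction
  case (base B)
  then show ?case by (simp add: Fq.subspace_0)
next
  case (step r s V V2 k R B)
  have sub: "Fq.span {r, s} \<subseteq> V" "V2 \<subseteq> V" "V = ssum (Fq.span {r, s}) V2"
    using osum_subset[OF step(2)] step(2) by (auto simp: osum_def)
  have "Fq.span {r} \<subseteq> Fq.span {r, s}" by (intro Fq.span_mono) auto
  then have "ssum (Fq.span {r}) R \<subseteq> ssum (Fq.span {r, s}) V2"
    using step.IH unfolding ssum_def by blast
  then show ?case using step.IH sub subspace_ssum by (metis Fq.subspace_span subset_trans)
qed

lemma witt_decomp_dim:
  assumes "witt_decomp Q V k R B" "qspace Q V"
  shows "Fq.dim V = 2 * k + Fq.dim B"
  using assms
proof induction
  case (base B)
  then show ?case by simp
next
  case (step r s V V2 k R B)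
  interpret qspace Q V by fact
  have rs: "r \<in> V" "s \<in> V" using step(2) hyp_mem by blast+
  have "qspace Q V2"
    using osum_subset[OF step(2)] step(2) by (intro qspace_subspace) (auto simp: osum_def)
  then show ?case
    using step.IH osum_dim[OF step(5,2)] hyp_pair_dim(1)[OF rs step(1)] by simp
qed

lemma witt_decomp_nondegenerate:
  assumes "witt_decomp Q V k R B" "qspace Q V"
  shows "radical Q V = {0} \<longleftrightarrow> radical Q B = {0}"
  using assms
proof induction
  case (base B)
  then show ?case by simp
next
  case (step r s V V2 k R B)
  interpret qspace Q V by fact
  have rs: "r \<in> V" "s \<in> V" using step(2) hyp_mem by blast+
  have "qspace Q V2"
    using osum_subset[OF step(2)] step(2) by (intro qspace_subspace) (auto simp: osum_def)
  then show ?case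
    using step.IH osum_nondegenerate_iff[OF step(5,2)] hyp_pair_dim(2)[OF rs step(1)] by simp
qed

text \<open>In each plane only the multiples of \<open>r\<close> are orthogonal to \<open>r\<close>,
  so what is orthogonal to \<open>R\<close> consists of \<open>R\<close> itself and the kernel. With
  the radical of \<open>U\<close> as \<open>R\<close>, this will describe the perp of
  \<open>U\<close>.\<close>

lemma witt_decomp_orth:
  assumes "witt_decomp Q V k R B" "qspace Q V"
  shows "{v \<in> V. \<forall>r\<in>R. polar Q v r = 0} = ssum R B \<and> R \<inter> B = {0} \<and> (\<forall>x\<in>R. Q x = 0) \<and> Fq.dim R = k"
  using assms
proof induction
  case (base B)
  interpret qspace Q B by fact
  show ?case by auto
next
  case (step r s V V2 k R B)
  interpret qspace Q V by fact
  have rs: "r \<in> V" "s \<in> V" using step(2) hyp_mem by blast+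
  have q2: "qspace Q V2"
    using osum_subset[OF step(2)] step(2) by (intro qspace_subspace) (auto simp: osum_def)
  note IH = step.IH[OF q2]
  have V2: "V2 \<subseteq> V" using osum_subset[OF step(2)] by simp
  have inter: "Fq.span {r, s} \<inter> V2 = {0}" using step(2) by (simp add: osum_def)
  have Vdec: "\<exists>a b w. v = vscale a r + vscale b s + w \<and> w \<in> V2" if "v \<in> V" for v
    using hyp_decompose[OF step(2) that] .
  have orth: "polar Q r w = 0" "polar Q s w = 0" "polar Q w r = 0" "polar Q w s = 0" if "w \<in> V2" for w
    using that step(2) unfolding osum_def by (auto simp: Fq.span_base polar_sym[of Q w])
  have RB: "R \<subseteq> V2" "B \<subseteq> V2" "Fq.subspace R" "Fq.subspace B" using witt_decomp_subsets[OF step(3)]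
    by auto
  have 0: "0 \<in> R" using RB Fq.subspace_0 by blast
  have Qr: "Q r = 0" "polar Q r s = 1" "polar Q s r = 1" using step(1)
    by (auto simp: hyp_pair_def polar_sym[of Q s])
  have rR: "Fq.span {r} \<inter> R = {0}"
    using inter RB 0 Fq.span_mono[of "{r}" "{r, s}"] Fq.span_zero[of "{r}"] by blast
  have dimR: "Fq.dim (ssum (Fq.span {r}) R) = Suc k"
  proof -
    have "r \<noteq> 0" using Qr rs by auto
    moreover have "finite (Fq.span {r})" "finite R"
      using rs RB V2 finite Fq.span_minimal[of "{r}" V] subspace by (auto intro: finite_subset)
    ultimately show ?thesis
      using IH RB rR by (simp add: dim_ssum dim_singleton)
  qed
  have RV: "R \<subseteq> V" using RB V2 by blast
  have Q0: "Q x = 0" if x: "x \<in> ssum (Fq.span {r}) R" for x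
  proof -
    obtain a y where xy: "x = vscale a r + y" "y \<in> R"
      using x unfolding ssum_span_singleton by blast
    have "y \<in> V2" "y \<in> V" using xy RB RV by auto
    then show ?thesis using xy IH Qr rs orth by (simp add: Q_add Q_scale polar_scale)
  qed
  have int0: "ssum (Fq.span {r}) R \<inter> B = {0}"
  proof -
    have "x = 0" if x: "x \<in> ssum (Fq.span {r}) R" "x \<in> B" for x
    proof -
      obtain y z where yz: "x = y + z" "y \<in> Fq.span {r}" "z \<in> R" using x by (auto simp: ssum_def)
      have "x - z \<in> V2" using x yz RB qspace.diff_mem[OF q2] by blast
      moreover have "x - z = y" using yz by simp
      moreover have "y \<in> Fq.span {r, s}" using yz Fq.span_mono[of "{r}" "{r, s}"] by auto
      ultimately have "y = 0" using inter by auto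
      then have "x \<in> R \<inter> B" using x yz by simp
      then show ?thesis using IH by simp
    qed
    then show ?thesis using RB(3,4) subspace_ssum[of "Fq.span {r}" R] Fq.subspace_0 by fastforce
  qed
  have "{v \<in> V. \<forall>x\<in>ssum (Fq.span {r}) R. polar Q v x = 0} = ssum (ssum (Fq.span {r}) R) B"
    (is "?L = ?M")
  proof (intro equalityI subsetI)
    fix v assume v: "v \<in> ?L"
    obtain a b w where w: "v = vscale a r + vscale b s + w" "w \<in> V2" using Vdec v by blast
    have wV: "w \<in> V" using w V2 by auto
    \<comment> \<open>Pairing with \<open>r\<close> reads off the coefficient of
      \<open>s\<close>.\<close>
    have "polar Q v r = 0"
      using v ssumI[of r "Fq.span {r}" 0 R] 0 by (auto simp: Fq.span_base)
    then have b: "b = 0" using w wV rs Qr orth by (simp add: polar_simps)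
    have "polar Q w x = 0" if x: "x \<in> R" for x
    proof -
      have "polar Q v x = 0"
        using v ssumI[of 0 "Fq.span {r}" x R] x by (auto simp: Fq.span_zero)
      then show ?thesis
        using w wV rs orth(1)[of x] x RB RV b by (auto simp: polar_simps subset_iff)
    qed
    then have "w \<in> ssum R B" using IH w by blast
    then have "vscale a r + w \<in> ssum (Fq.span {r}) (ssum R B)"
      by (intro ssumI) (auto simp: Fq.span_singleton)
    then show "v \<in> ?M" using w b by (simp add: ssum_assoc)
  next
    fix v assume "v \<in> ?M"
    then have "v \<in> ssum (Fq.span {r}) (ssum R B)" by (simp add: ssum_assoc)
    then obtain a w where w: "v = vscale a r + w" "w \<in> ssum R B"
      unfolding ssum_span_singleton by blast
    have wV2: "w \<in> V2" and wR: "\<forall>x\<in>R. polar Q w x = 0" using w(2) IH by blast+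
    have wV: "w \<in> V" using wV2 V2 by auto
    have "polar Q v x = 0" if "x \<in> ssum (Fq.span {r}) R" for x
    proof -
      obtain b y where x: "x = vscale b r + y" "y \<in> R"
        using \<open>x \<in> ssum _ _\<close> unfolding ssum_span_singleton by blast
      have "y \<in> V2" "y \<in> V" using x RB RV by auto
      then show ?thesis using w x rs wV wR Qr orth wV2 by (simp add: polar_simps)
    qed
    then show "v \<in> ?L" using w rs wV by simp
  qed
  then show ?case using int0 Q0 dimR by simp
qed

lemma witt_decomp_trans:
  assumes "witt_decomp Q V k R B" "witt_decomp Q B l S C"
  shows "witt_decomp Q V (k + l) (ssum R S) C"
  using assms
proof induction
  case (base B)
  then show ?case by simp
next
  case (step r s V V2 k R B)
  then show ?case using witt_decomp.step[OF step(1,2) step.IH] by (simp add: ssum_assoc)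
qed

text \<open>The planes of a summand are planes of the whole, and \<open>D\<close> joins the kernel.
  So the planes of both summands can be removed before the type of a sum is computed.\<close>

lemma witt_decomp_osum:
  assumes "witt_decomp Q A k R B" "qspace Q V" "osum Q V A D"
  shows "witt_decomp Q V k R (ssum B D) \<and> osum Q (ssum B D) B D"
  using assms
proof (induction arbitrary: V)
  case (base B)
  interpret qspace Q V by fact
  show ?case using base witt_decomp.base[OF subspace] by (auto simp: osum_def)
next
  case (step r s A A2 k R B V)
  interpret qspace Q V by fact
  note o = osum_assoc[OF step(5,6,2)]
  have "qspace Q (ssum A2 D)"
    using o(1) osum_subset[OF o(1)] by (intro qspace_subspace) (auto simp: osum_def)
  from step.IH[OF this o(2)] show ?case using witt_decomp.step[OF step(1) o(1)] by blast
qed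

text \<open>Choose \<open>r\<close> in \<open>R\<close> with a hyperbolic partner \<open>s\<close>.
  The vectors of \<open>R\<close> orthogonal to \<open>s\<close> form a hyperplane \<open>R1\<close>
  complementary to \<open>r\<close>; being orthogonal to \<open>r\<close> as well, since
  \<open>R\<close> is totally isotropic, they lie in the orthogonal space of the plane, where the
  induction applies.\<close>

lemma witt_decomp_isotropic_exists:
  assumes "qspace Q V" "radical Q V = {0}" "Fq.subspace R" "R \<subseteq> V" "\<forall>x\<in>R. Q x = 0"
  shows "\<exists>B. witt_decomp Q V (Fq.dim R) R B"
  using assms
proof (induction "Fq.dim R" arbitrary: V R)
  case 0
  interpret qspace Q V by fact
  have "finite R" using 0 finite by (auto intro: finite_subset)
  then have "R = {0}" using 0 by (simp add: dim_0_iff)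
  then show ?case using witt_decomp.base[OF subspace] by auto
next
  case (Suc n)
  interpret qspace Q V by fact
  have "R \<noteq> {0}" using Suc by auto
  then obtain r where r: "r \<in> R" "r \<noteq> 0" using Fq.subspace_0[OF Suc(5)] by auto
  then have rV: "r \<in> V" "Q r = 0" using Suc by auto
  obtain s where s: "s \<in> V" "hyp_pair Q r s" using hyp_pair_exists Suc rV r by blast
  have rs: "polar Q r s = 1" using s by (simp add: hyp_pair_def)
  define R1 where "R1 = {v \<in> R. polar Q v s = 0}"
  have "polar Q r s \<noteq> 0" using rs by simp
  note sp = hyperplane_split[OF Suc(5,6) s(1) r(1) this, folded R1_def]
  note hp = hyp_pair_dim[OF rV(1) s]
  define V2 where "V2 = {v \<in> V. \<forall>a\<in>Fq.span {r, s}. polar Q v a = 0}"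
  have o: "osum Q V (Fq.span {r, s}) V2"
    unfolding V2_def using hp by (intro osum_orth) (auto simp: qspace_axioms)
  have "R1 \<subseteq> V2"
  proof
    fix x assume x: "x \<in> R1"
    then have xR: "x \<in> R" "x \<in> V" "polar Q x s = 0" using Suc by (auto simp: R1_def)
    then have "polar Q x r = 0" using polar_isotropic[OF Suc(5), of x r] Suc r by blast
    then show "x \<in> V2" using xR rV s by (auto simp: V2_def span_pair polar_simps)
  qed
  moreover have q2: "qspace Q V2"
    using o osum_subset[OF o] by (intro qspace_subspace) (auto simp: osum_def)
  moreover have "radical Q V2 = {0}" using osum_nondegenerate_iff[OF Suc(3) o] Suc by simp
  moreover have "n = Fq.dim R1" using sp(4) Suc(2) by simp
  moreover have "\<forall>x\<in>R1. Q x = 0" using Suc by (auto simp: R1_def)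
  ultimately obtain B where "witt_decomp Q V2 n R1 B" using Suc(1)[of R1 V2] sp(1) by auto
  from witt_decomp.step[OF s(2) o this] show ?case using sp(2) Suc(2) by auto
qed

definition anisotropic :: "((nat \<Rightarrow> 'a::field) \<Rightarrow> 'a) \<Rightarrow> (nat \<Rightarrow> 'a) set \<Rightarrow> bool" where
  "anisotropic Q B \<longleftrightarrow> (\<forall>b\<in>B. Q b = 0 \<longrightarrow> b = 0)"

text \<open>As long as there is an isotropic vector, its line yields a hyperbolic plane and leaves a
  kernel of smaller dimension.\<close>

lemma witt_decomp_exists:
  assumes "qspace Q V" "radical Q V = {0}"
  shows "\<exists>k R B. witt_decomp Q V k R B \<and> anisotropic Q B"
  using assms
proof (induction "Fq.dim V" arbitrary: V rule: less_induct)
  case less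
  interpret qspace Q V by fact
  show ?case
  proof (cases "anisotropic Q V")
    case True
    then show ?thesis using witt_decomp.base[OF subspace] by blast
  next
    case False
    then obtain r where r: "r \<in> V" "Q r = 0" "r \<noteq> 0" by (auto simp: anisotropic_def)
    have sub: "Fq.span {r} \<subseteq> V" using r by (intro Fq.span_minimal) (auto simp: subspace)
    have "\<forall>x\<in>Fq.span {r}. Q x = 0" using r by (auto simp: Fq.span_singleton Q_scale)
    then obtain B where "witt_decomp Q V (Fq.dim (Fq.span {r})) (Fq.span {r}) B"
      using witt_decomp_isotropic_exists[OF less(2,3) Fq.subspace_span sub] by blast
    then have B: "witt_decomp Q V 1 (Fq.span {r}) B" using dim_singleton[OF r(3)] by simp
    have q: "qspace Q B" using witt_decomp_subsets[OF B] by (intro qspace_subspace) auto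
    have "Fq.dim B < Fq.dim V" using witt_decomp_dim[OF B less(2)] by simp
    moreover have "radical Q B = {0}" using witt_decomp_nondegenerate[OF B less(2)] less by simp
    ultimately obtain k R C where "witt_decomp Q B k R C" "anisotropic Q C" using less(1) q by blast
    then show ?thesis using witt_decomp_trans[OF B] by blast
  qed
qed

text \<open>Hence \<open>k\<close> is the maximal dimension of a totally isotropic subspace and does
  not depend on the decomposition. If the subspace contains \<open>r\<close>, its vectors orthogonal
  to \<open>s\<close> form a hyperplane inside \<open>V2\<close>, to which the induction applies;
  the other case is reduced to this one.\<close>

lemma witt_decomp_isotropic_dim_le:
  assumes "witt_decomp Q V k R B" "qspace Q V" "anisotropic Q B"
    and "Fq.subspace W" "W \<subseteq> V" "\<forall>x\<in>W. Q x = 0"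
  shows "Fq.dim W \<le> k"
  using assms
proof (induction arbitrary: W)
  case (base B)
  interpret qspace Q B by fact
  have "W = {0}" using base Fq.subspace_0 by (auto simp: anisotropic_def)
  then show ?case by simp
next
  case (step r s V V2 k R B W)
  interpret qspace Q V by fact
  have rs: "r \<in> V" "s \<in> V" using step(2) hyp_mem by blast+
  have q2: "qspace Q V2"
    using osum_subset[OF step(2)] step(2) by (intro qspace_subspace) (auto simp: osum_def)
  have Qr: "Q r = 0" "polar Q r s = 1" "polar Q s r = 1" using step(1)
    by (auto simp: hyp_pair_def polar_sym[of Q s])
  have mem2: "w \<in> V2" if "w \<in> V" "polar Q w r = 0" "polar Q w s = 0" for w
  proof -
    obtain a b v where w: "w = vscale a r + vscale b s + v" "v \<in> V2"
      using hyp_decompose[OF step(2) \<open>w \<in> V\<close>] by blast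
    have "v \<in> V" using w osum_subset[OF step(2)] by auto
    moreover have "polar Q v r = 0" "polar Q v s = 0"
      using step(2) w(2) unfolding osum_def by (auto simp: Fq.span_base polar_sym[of Q v])
    ultimately have "polar Q w r = b" "polar Q w s = a"
      using hyp_pair_values(1,2)[OF rs step(1), of a b] rs unfolding w(1)
      by (simp_all add: polar_add[of "vscale a r + vscale b s" v])
    then have "b = 0" "a = 0" using that by simp_all
    then show ?thesis using w by simp
  qed
  have contains_r: "Fq.dim X \<le> Suc k"
    if X: "Fq.subspace X" "X \<subseteq> V" "\<forall>x\<in>X. Q x = 0" "r \<in> X" for X
  proof -
    have "polar Q r s \<noteq> 0" using Qr by simp
    note sp = hyperplane_split[OF X(1,2) rs(2) X(4) this]
    have "{v \<in> X. polar Q v s = 0} \<subseteq> V2"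
      using X mem2 polar_isotropic[OF X(1), of _ r] by blast
    then have "Fq.dim {v \<in> X. polar Q v s = 0} \<le> k"
      using step.IH[OF q2 step(6) sp(1)] X by auto
    then show ?thesis using sp(4) by simp
  qed
  show ?case
  proof (cases "r \<in> W")
    case True
    then show ?thesis using contains_r step by blast
  next
    case False
    \<comment> \<open>\<open>W\<close> is traded for \<open>ssum (Fq.span {r}) W1\<close>: passing
      to \<open>W1\<close> loses at most one dimension, and adding \<open>r\<close> gains one
      back.\<close>
    define W1 where "W1 = {w \<in> W. polar Q w r = 0}"
    have sub: "W1 \<subseteq> V" "W1 \<subseteq> W" using step by (auto simp: W1_def)
    have W1: "Fq.subspace W1 \<and> Fq.dim W \<le> Suc (Fq.dim W1)"
    proof (cases "W1 = W")
      case True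
      then show ?thesis using step by simp
    next
      case False
      then obtain w where "w \<in> W" "polar Q w r \<noteq> 0" by (auto simp: W1_def)
      from hyperplane_split[OF step(7,8) rs(1) this] show ?thesis by (simp add: W1_def)
    qed
    have r0: "r \<noteq> 0" using Qr rs by auto
    have "Fq.span {r} \<inter> W1 = {0}"
    proof -
      have "vscale a r = 0" if "vscale a r \<in> W" for a
      proof (rule ccontr)
        assume "vscale a r \<noteq> 0"
        then have "r = vscale (1 / a) (vscale a r)" by simp
        then show False using that False Fq.subspace_scale[OF step(7)] by metis
      qed
      then show ?thesis
        using sub W1 Fq.subspace_0[of W1] by (auto simp: Fq.span_singleton Fq.span_zero)
    qed
    moreover have "Fq.span {r} \<subseteq> V" using rs by (intro Fq.span_minimal) (auto simp: subspace)
    moreover have "finite W1" "finite (Fq.span {r})"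
      using calculation sub finite by (auto intro: finite_subset)
    ultimately have "Fq.dim (ssum (Fq.span {r}) W1) = Suc (Fq.dim W1)"
      using W1 r0 by (simp add: dim_ssum dim_singleton)
    moreover have "Fq.dim (ssum (Fq.span {r}) W1) \<le> Suc k"
    proof (rule contains_r)
      show "Fq.subspace (ssum (Fq.span {r}) W1)" using W1 by (simp add: subspace_ssum)
      show "ssum (Fq.span {r}) W1 \<subseteq> V"
        using \<open>Fq.span {r} \<subseteq> V\<close> sub by (intro ssum_subset subspace)
      show "\<forall>x\<in>ssum (Fq.span {r}) W1. Q x = 0"
      proof
        fix x assume "x \<in> ssum (Fq.span {r}) W1"
        then obtain a w where "x = vscale a r + w" "w \<in> W1"
          unfolding ssum_span_singleton by blast
        then show "Q x = 0"
          using step(9) rs Qr sub by (auto simp: Q_add Q_scale polar_simps W1_def polar_sym[of Q r])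
      qed
      show "r \<in> ssum (Fq.span {r}) W1"
        using ssum_superset1[of W1 "Fq.span {r}"] W1 by (auto simp: Fq.span_base)
    qed
    ultimately show ?thesis using W1 by simp
  qed
qed

lemma hyp_pair_sim:
  assumes "qspace Q V" "qspace Q' V'" "r \<in> V" "s \<in> V" "r' \<in> V'" "s' \<in> V'"
    and "hyp_pair Q r s" "hyp_pair Q' r' s'" "c \<noteq> 0"
  shows "\<exists>g. sim c Q (Fq.span {r, s}) Q' (Fq.span {r', s'}) g \<and> g ` Fq.span {r} = Fq.span {r'}"
proof -
  interpret V: qspace Q V by fact
  interpret V': qspace Q' V' by fact
  \<comment> \<open>\<open>r\<close> goes to \<open>r'\<close> and \<open>s\<close> to
    \<open>c\<close> times \<open>s'\<close>. Putting the whole multiplier on one vector of the pair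
    keeps the lines of \<open>r\<close> and \<open>r'\<close> in correspondence.\<close>
  define f where "f v = vscale (polar Q v s) r' + vscale (c * polar Q v r) s'" for v
  have sub: "Fq.span {r, s} \<subseteq> V" using V.hyp_pair_dim assms by blast
  have "\<exists>g. lin g \<and> (\<forall>v\<in>Fq.span {r, s}. g v = f v)"
  proof (rule linear_on_extend)
    fix u v assume "u \<in> Fq.span {r, s}" "v \<in> Fq.span {r, s}"
    then have "u \<in> V" "v \<in> V" using sub by auto
    then show "f (u + v) = f u + f v"
      using assms(3,4) by (simp add: f_def V.polar_add Fq.scale_left_distrib distrib_left add_ac)
  next
    fix k v assume "v \<in> Fq.span {r, s}"
    then have "v \<in> V" using sub by auto
    then show "f (vscale k v) = vscale k (f v)"
      using assms(3,4) by (simp add: f_def V.polar_scale Fq.scale_right_distrib mult.left_commute)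
  qed simp
  then obtain g where g: "lin g" "\<forall>v\<in>Fq.span {r, s}. g v = f v" by blast
  have gv: "g (vscale a r + vscale b s) = vscale a r' + vscale (c * b) s'" for a b
  proof -
    have "vscale a r + vscale b s \<in> Fq.span {r, s}" by (auto simp: span_pair)
    then show ?thesis using g(2) V.hyp_pair_values[OF assms(3,4,7)] by (simp add: f_def)
  qed
  have "inj_on g (Fq.span {r, s})"
  proof (rule inj_onI)
    fix x y assume xy: "x \<in> Fq.span {r, s}" "y \<in> Fq.span {r, s}" "g x = g y"
    then obtain a b a' b' where *: "x = vscale a r + vscale b s" "y = vscale a' r + vscale b' s"
      by (auto simp: span_pair)
    then have "vscale a r' + vscale (c * b) s' = vscale a' r' + vscale (c * b') s'"
      using xy gv by metis
    then have "a = a'" "c * b = c * b'"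
      using V'.hyp_pair_values(1,2)[OF assms(5,6,8)] by metis+
    then show "x = y" using * assms(9) by simp
  qed
  moreover have "g ` Fq.span {r, s} = Fq.span {r', s'}"
  proof (intro equalityI subsetI)
    fix x assume "x \<in> g ` Fq.span {r, s}"
    then obtain a b where "x = vscale a r' + vscale (c * b) s'" using gv by (auto simp: span_pair)
    then show "x \<in> Fq.span {r', s'}" unfolding span_pair by blast
  next
    fix x assume "x \<in> Fq.span {r', s'}"
    then obtain a b where "x = vscale a r' + vscale b s'" by (auto simp: span_pair)
    then have "x = g (vscale a r + vscale (b / c) s)" using gv assms(9) by simp
    moreover have "vscale a r + vscale (b / c) s \<in> Fq.span {r, s}" unfolding span_pair by blast
    ultimately show "x \<in> g ` Fq.span {r, s}" by blast
  qed
  moreover have "Q' (g v) = c * Q v" if "v \<in> Fq.span {r, s}" for v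
    using that gv V.hyp_pair_values(3)[OF assms(3,4,7)] V'.hyp_pair_values(3)[OF assms(5,6,8)]
    by (auto simp: span_pair)
  moreover have "g ` Fq.span {r} = Fq.span {r'}"
    using gv[of _ 0] by (auto simp: Fq.span_singleton image_iff)
  ultimately show ?thesis using g(1) unfolding sim_def by blast
qed

text \<open>A hyperbolic plane accepts every nonzero multiplier, so a similarity of the kernels
  extends plane by plane, taking each chosen isotropic line to its counterpart.\<close>

lemma witt_decomp_sim:
  assumes "witt_decomp Q V k R B" "witt_decomp Q' V' k R' B'" "qspace Q V" "qspace Q' V'" "c \<noteq> 0"
    and "sim c Q B Q' B' gB"
  shows "\<exists>g. sim c Q V Q' V' g \<and> g ` R = R' \<and> (\<forall>b\<in>B. g b = gB b)"
  using assms
proof (induction arbitrary: V' R')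
  case (base B)
  from base(2) show ?case
  proof cases
    case base
    then show ?thesis
      using \<open>sim c Q B Q' B' gB\<close> lin_zero[of gB] by (intro exI[of _ gB]) (simp add: sim_def)
  qed
next
  case (step r s V V2 k R B V' R')
  from step(5) obtain r' s' V2' R2' where w':
    "R' = ssum (Fq.span {r'}) R2'" "hyp_pair Q' r' s'" "osum Q' V' (Fq.span {r', s'}) V2'"
    "witt_decomp Q' V2' k R2' B'"
    by cases auto
  have q2: "qspace Q V2" "qspace Q' V2'"
    using osum_subset[OF step(2)] step(2) osum_subset[OF w'(3)] w'(3)
      qspace.qspace_subspace[OF step(6)] qspace.qspace_subspace[OF step(7)]
    by (auto simp: osum_def)
  obtain g2 where g2: "sim c Q V2 Q' V2' g2" "g2 ` R = R2'" "\<forall>b\<in>B. g2 b = gB b"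
    using step.IH[OF w'(4) q2 step(8,9)] by blast
  obtain h where h: "sim c Q (Fq.span {r, s}) Q' (Fq.span {r', s'}) h"
    "h ` Fq.span {r} = Fq.span {r'}"
    using hyp_pair_sim[OF step(6,7) hyp_mem[OF step(2)] hyp_mem[OF w'(3)] step(1) w'(2) step(8)]
    by blast
  have "Fq.span {r} \<subseteq> Fq.span {r, s}" by (intro Fq.span_mono) auto
  moreover have "R \<subseteq> V2" "B \<subseteq> V2" using witt_decomp_subsets[OF step(3)] by auto
  ultimately obtain g where "sim c Q V Q' V' g" "\<forall>b\<in>V2. g b = g2 b"
    "g ` ssum (Fq.span {r}) R = ssum (Fq.span {r'}) R2'"
    using sim_osum_subspace[OF step(6,7,2) w'(3) h(1) g2(1) h(2) g2(2)] by blast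
  then show ?case using g2 w'(1) \<open>B \<subseteq> V2\<close> by (intro exI[of _ g]) auto
qed

section \<open>Anisotropic kernels over a finite field\<close>

definition is_square :: "'a::field \<Rightarrow> bool" where "is_square a \<longleftrightarrow> (\<exists>x. a = x\<^sup>2)"

text \<open>Squaring is two-to-one on the nonzero elements, and 0 has a single root.\<close>

lemma card_squares:
  assumes "(2::'a::{field,finite}) \<noteq> 0"
  shows "2 * card (range (\<lambda>x::'a. x\<^sup>2)) = CARD('a) + 1"
proof -
  let ?S = "range (\<lambda>x::'a. x\<^sup>2)"
  have fib: "card {x::'a. x\<^sup>2 = y} = 2" if "y \<in> ?S - {0}" for y
  proof -
    from that obtain z :: 'a where z: "y = z\<^sup>2" "z \<noteq> 0" by auto
    have "z \<noteq> - z"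
    proof
      assume "z = - z"
      then have "2 * z = 0" by (metis add.right_inverse mult_2)
      then show False using assms z by simp
    qed
    moreover have "{x. x\<^sup>2 = y} = {z, - z}" using z by (auto simp: power2_eq_iff)
    ultimately show ?thesis by simp
  qed
  have "CARD('a) = (\<Sum>x\<in>(UNIV::'a set). 1)" by simp
  also have "\<dots> = (\<Sum>y\<in>?S. \<Sum>x | x \<in> UNIV \<and> x\<^sup>2 = y. 1)" by (rule sum.image_gen) simp
  also have "\<dots> = (\<Sum>y\<in>?S. card {x::'a. x\<^sup>2 = y})" by simp
  also have "\<dots> = card {x::'a. x\<^sup>2 = 0} + (\<Sum>y\<in>?S - {0}. card {x::'a. x\<^sup>2 = y})"
    by (rule sum.remove) (auto intro: range_eqI[of _ _ 0])
  also have "{x::'a. x\<^sup>2 = 0} = {0}" by auto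
  also have "(\<Sum>y\<in>?S - {0}. card {x::'a. x\<^sup>2 = y}) = (\<Sum>y\<in>?S - {0}. 2)"
    using fib by (intro sum.cong) auto
  finally have "CARD('a) = 1 + 2 * card (?S - {0})" by simp
  moreover have "Suc (card (?S - {0})) = card ?S"
    by (rule card_Suc_Diff1) (auto intro: range_eqI[of _ _ 0])
  ultimately show ?thesis by linarith
qed

text \<open>Pigeonhole: the values of \<open>a * x\<^sup>2\<close> and those of
  \<open>c - b * y\<^sup>2\<close> each fill more than half of the field, so the two sets
  meet.\<close>

lemma binary_form_universal:
  assumes "(2::'a::{field,finite}) \<noteq> 0" "a \<noteq> 0" "b \<noteq> (0::'a)"
  shows "\<exists>x y. a * x\<^sup>2 + b * y\<^sup>2 = c"
proof -
  let ?S = "range (\<lambda>x::'a. x\<^sup>2)"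
  have "card ((\<lambda>s. a * s) ` ?S) = card ?S" "card ((\<lambda>s. c - b * s) ` ?S) = card ?S"
    using assms by (intro card_image; simp add: inj_on_def)+
  moreover have "card ((\<lambda>s. a * s) ` ?S \<union> (\<lambda>s. c - b * s) ` ?S) \<le> CARD('a)"
    by (rule card_mono) auto
  ultimately have "(\<lambda>s. a * s) ` ?S \<inter> (\<lambda>s. c - b * s) ` ?S \<noteq> {}"
    using card_squares[OF assms(1)] card_Un_disjoint[of "(\<lambda>s. a * s) ` ?S" "(\<lambda>s. c - b * s) ` ?S"]
    by fastforce
  then obtain x y where "a * x\<^sup>2 = c - b * y\<^sup>2" by blast
  then show ?thesis by (metis add.commute diff_add_cancel)
qed

text \<open>The multiples of the squares by the nonsquare \<open>a\<close> meet the squares only in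
  0. By counting, the two sets exhaust the field, so \<open>b\<close> is \<open>a\<close> times a
  square.\<close>

lemma nonsquare_mult:
  assumes "(2::'a::{field,finite}) \<noteq> 0" "\<not> is_square a" "\<not> is_square (b::'a)"
  shows "is_square (a * b)"
proof -
  let ?S = "range (\<lambda>x::'a. x\<^sup>2)"
  have a0: "a \<noteq> 0" using assms(2) by (auto simp: is_square_def)
  have card: "card ((\<lambda>s. a * s) ` ?S) = card ?S"
    using a0 by (intro card_image) (simp add: inj_on_def)
  have int: "(\<lambda>s. a * s) ` ?S \<inter> ?S = {0}"
  proof (intro equalityI subsetI)
    fix t assume "t \<in> (\<lambda>s. a * s) ` ?S \<inter> ?S"
    then obtain x y where xy: "t = a * x\<^sup>2" "t = y\<^sup>2" by blast
    have "x = 0"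
    proof (rule ccontr)
      assume "x \<noteq> 0"
      then have "a = (y / x)\<^sup>2" using xy by (simp add: power_divide field_simps)
      then show False using assms(2) by (auto simp: is_square_def)
    qed
    then show "t \<in> {0}" using xy by simp
  qed (auto intro!: image_eqI[of _ _ 0] range_eqI[of _ _ 0])
  have "card ((\<lambda>s. a * s) ` ?S) + card ?S =
      card ((\<lambda>s. a * s) ` ?S \<union> ?S) + card ((\<lambda>s. a * s) ` ?S \<inter> ?S)"
    by (rule card_Un_Int) auto
  then have "card ((\<lambda>s. a * s) ` ?S \<union> ?S) = CARD('a)"
    unfolding card int using card_squares[OF assms(1)] by simp
  then have "(\<lambda>s. a * s) ` ?S \<union> ?S = UNIV" by (intro card_subset_eq) auto
  moreover have "b \<notin> ?S" using assms(3) by (auto simp: is_square_def)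
  ultimately have "b \<in> (\<lambda>s. a * s) ` ?S" by blast
  then obtain x where "b = a * x\<^sup>2" by blast
  then have "a * b = (a * x)\<^sup>2" by (simp add: power2_eq_square)
  then show ?thesis unfolding is_square_def by blast
qed

lemma dim_1_span:
  assumes "Fq.subspace V" "Fq.dim V = 1"
  shows "\<exists>v. v \<noteq> 0 \<and> V = Fq.span {v}"
proof -
  obtain B where B: "B \<subseteq> V" "Fq.independent B" "V \<subseteq> Fq.span B" "card B = 1"
    using Fq.basis_exists[of V] assms(2) by metis
  then obtain v where "B = {v}" using card_1_singletonE by blast
  moreover have "V = Fq.span B" using B assms(1) Fq.span_subspace by blast
  ultimately show ?thesis using B(2) by auto
qed

lemma nonzero_vector_exists:
  fixes V :: "(nat \<Rightarrow> 'a::{field,finite}) set"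
  assumes "Fq.subspace V" "Fq.dim V > 0"
  shows "\<exists>v\<in>V. v \<noteq> 0"
proof (rule ccontr)
  assume "\<not> ?thesis"
  then have "V = {0}" using Fq.subspace_0[OF assms(1)] by blast
  then show False using assms(2) by simp
qed

section \<open>Anisotropic spaces\<close>

context qspace begin

lemma anisotropic_radical:
  assumes "anisotropic Q V"
  shows "radical Q V = {0}"
  using assms polar_same by (force simp: radical_def anisotropic_def)

lemma split_line:
  assumes "u \<in> V" "Q u \<noteq> 0"
  shows "\<exists>C. osum Q V (Fq.span {u}) C \<and> qspace Q C \<and> C \<subseteq> V \<and> Fq.dim V = Suc (Fq.dim C)"
proof -
  have sub: "Fq.span {u} \<subseteq> V" using assms by (intro Fq.span_minimal) (auto simp: subspace)
  have u0: "u \<noteq> 0" using assms by auto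
  have "radical Q (Fq.span {u}) = {0}"
    using assms sub
    by (auto simp: radical_def Fq.span_singleton polar_simps Fq.span_zero intro: range_eqI[of _ _ 0])
  from osum_orth[OF qspace_axioms Fq.subspace_span sub this]
  obtain C where C: "osum Q V (Fq.span {u}) C" by blast
  have "Fq.dim V = Suc (Fq.dim C)"
    using osum_dim[OF qspace_axioms C] u0 by (simp add: dim_singleton)
  moreover have "C \<subseteq> V" using osum_subset[OF C] by simp
  ultimately show ?thesis using C qspace_subspace by (auto simp: osum_def)
qed

text \<open>Given three orthogonal nonzero vectors \<open>u\<close>, \<open>v\<close>,
  \<open>w\<close>, some combination of \<open>u\<close> and \<open>v\<close> takes the value
  \<open>- Q w\<close>; adding \<open>w\<close> to it gives an isotropic vector.\<close>

lemma anisotropic_dim_le_2: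
  assumes "anisotropic Q V"
  shows "Fq.dim V \<le> 2"
proof (rule ccontr)
  assume d: "\<not> ?thesis"
  have nz: "Q v \<noteq> 0" if "v \<in> V" "v \<noteq> 0" for v using assms that by (auto simp: anisotropic_def)
  obtain u where u: "u \<in> V" "u \<noteq> 0" using nonzero_vector_exists[OF subspace] d by auto
  obtain C where C: "osum Q V (Fq.span {u}) C" "qspace Q C" "C \<subseteq> V" "Fq.dim V = Suc (Fq.dim C)"
    using split_line[OF u(1) nz[OF u]] by blast
  interpret C: qspace Q C by fact
  obtain v where v: "v \<in> C" "v \<noteq> 0" using nonzero_vector_exists[OF C.subspace] d C by auto
  have vV: "v \<in> V" using v C by auto
  obtain D where D: "osum Q C (Fq.span {v}) D" "qspace Q D" "D \<subseteq> C" "Fq.dim C = Suc (Fq.dim D)"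
    using C.split_line[OF v(1) nz[OF vV v(2)]] by blast
  obtain w where w: "w \<in> D" "w \<noteq> 0"
    using nonzero_vector_exists[OF qspace.subspace[OF D(2)]] d C D by auto
  have wV: "w \<in> V" "w \<in> C" using w C D by auto
  have o: "polar Q u v = 0" "polar Q u w = 0" "polar Q v w = 0"
    using C(1) D(1) v w wV unfolding osum_def by (auto simp: Fq.span_base)
  obtain x y where xy: "Q u * x\<^sup>2 + Q v * y\<^sup>2 = - Q w"
    using binary_form_universal[OF two nz[OF u] nz[OF vV v(2)]] by blast
  define z where "z = vscale x u + vscale y v + w"
  have "polar Q w u = 0" "polar Q w v = 0" using o by (simp_all add: polar_sym[of Q w])
  then have "Q z = 0"
    using xy u vV wV o by (simp add: z_def Q_add Q_scale polar_simps algebra_simps)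
  moreover have "z \<in> V" using u vV wV by (simp add: z_def)
  ultimately have "z = 0" using assms by (auto simp: anisotropic_def)
  moreover have "polar Q z w = Q w" using u vV wV o by (simp add: z_def polar_simps)
  ultimately show False using nz[OF wV(1) w(2)] wV by simp
qed

text \<open>An anisotropic plane takes every nonzero value. Prescribing the value \<open>c\<close>
  of the first basis vector lines up two planes for a similarity with multiplier \<open>c\<close>;
  anisotropy then fixes the square class of the second value.\<close>

lemma anisotropic_basis:
  assumes "anisotropic Q V" "Fq.dim V = 2" "c \<noteq> 0"
  shows "\<exists>u v. u \<in> V \<and> v \<in> V \<and> Q u = c \<and> v \<noteq> 0 \<and> osum Q V (Fq.span {u}) (Fq.span {v}) \<and>
    \<not> is_square (- (c * Q v))"
proof -
  have nz: "Q v \<noteq> 0" if "v \<in> V" "v \<noteq> 0" for v using assms that by (auto simp: anisotropic_def)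
  have line: "\<exists>v. v \<in> V \<and> v \<noteq> 0 \<and> osum Q V (Fq.span {u}) (Fq.span {v}) \<and> polar Q u v = 0"
    if u: "u \<in> V" "u \<noteq> 0" for u
  proof -
    obtain C where C: "osum Q V (Fq.span {u}) C" "qspace Q C" "C \<subseteq> V" "Fq.dim V = Suc (Fq.dim C)"
      using split_line[OF u(1) nz[OF u]] by blast
    then obtain v where v: "v \<noteq> 0" "C = Fq.span {v}"
      using dim_1_span[of C] assms(2) qspace.subspace by auto
    then show ?thesis using C by (intro exI[of _ v]) (auto simp: osum_def Fq.span_base)
  qed
  obtain u0 where u0: "u0 \<in> V" "u0 \<noteq> 0" using nonzero_vector_exists[OF subspace] assms by auto
  obtain v0 where v0: "v0 \<in> V" "v0 \<noteq> 0" "polar Q u0 v0 = 0" using line[OF u0] by blast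
  obtain x y where xy: "Q u0 * x\<^sup>2 + Q v0 * y\<^sup>2 = c"
    using binary_form_universal[OF two nz[OF u0] nz[OF v0(1,2)]] by blast
  define u where "u = vscale x u0 + vscale y v0"
  have u: "u \<in> V" "Q u = c"
    using xy u0 v0 by (simp_all add: u_def Q_add Q_scale polar_simps algebra_simps)
  then have "u \<noteq> 0" using assms(3) by auto
  then obtain v where v: "v \<in> V" "v \<noteq> 0" "osum Q V (Fq.span {u}) (Fq.span {v})" "polar Q u v = 0"
    using line u by blast
  have "\<not> is_square (- (c * Q v))"
  proof
    assume "is_square (- (c * Q v))"
    then obtain s where s: "- (c * Q v) = s\<^sup>2" by (auto simp: is_square_def)
    \<comment> \<open>The square root \<open>s\<close> of \<open>- (c * Q v)\<close> makes this
      vector isotropic, although its component along \<open>v\<close> is nonzero.\<close>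
    define z where "z = vscale s u + vscale c v"
    have "Q z = s\<^sup>2 * c + c\<^sup>2 * Q v" using u v by (simp add: z_def Q_add Q_scale polar_simps)
    also have "\<dots> = 0" unfolding s[symmetric] by (simp add: power2_eq_square)
    finally have "z = 0" using u v assms(1) by (simp add: anisotropic_def z_def)
    moreover have "polar Q z v = c * Q v" using u v by (simp add: z_def polar_simps)
    ultimately show False using nz[OF v(1,2)] assms(3) v by simp
  qed
  then show ?thesis using u v by blast
qed

end

lemma line_sim:
  assumes "qspace Q V" "qspace Q' V'" "u \<in> V" "u' \<in> V'" "u \<noteq> 0" "u' \<noteq> 0"
    and "t \<noteq> 0" "Q' u' * t\<^sup>2 = c * Q u"
  shows "\<exists>g. sim c Q (Fq.span {u}) Q' (Fq.span {u'}) g"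
proof -
  have "Fq.independent {u}" using assms(5) by simp
  then obtain g where g: "lin g" "g u = vscale t u'"
    using Fq2.linear_independent_extend[of "{u}" "\<lambda>_. vscale t u'"] by auto
  have gk: "g (vscale k u) = vscale (k * t) u'" for k
    using g(2) by (simp add: lin_scale[OF g(1)])
  have "Q' (g (vscale k u)) = c * Q (vscale k u)" for k
    using assms(8) qspace.Q_scale[OF assms(1,3)] qspace.Q_scale[OF assms(2,4)]
    by (simp add: gk power_mult_distrib algebra_simps)
  moreover have "inj_on g (Fq.span {u})"
    using gk assms by (auto simp: inj_on_def Fq.span_singleton)
  moreover have "g ` Fq.span {u} = Fq.span {u'}"
  proof (intro equalityI subsetI)
    fix x assume "x \<in> Fq.span {u'}"
    then obtain k where "x = vscale k u'" by (auto simp: Fq.span_singleton)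
    then have "x = g (vscale (k / t) u)" using gk assms(7) by simp
    then show "x \<in> g ` Fq.span {u}" unfolding Fq.span_singleton by blast
  qed (auto simp: gk Fq.span_singleton)
  ultimately show ?thesis using g by (auto simp: sim_def Fq.span_singleton)
qed

text \<open>Vectors with values 1 and \<open>c\<close> are matched first. Their orthogonal partners
  satisfy nonsquare conditions, and the product of two nonsquares is a square, so a suitable
  rescaling matches the partners too.\<close>

lemma anisotropic_sim:
  assumes V: "qspace Q V" and V': "qspace Q' V'" and an: "anisotropic Q V" "anisotropic Q' V'"
    and d: "Fq.dim V = 2" "Fq.dim V' = 2" and c: "c \<noteq> 0"
  shows "\<exists>g. sim c Q V Q' V' g"
proof -
  interpret V: qspace Q V by fact
  interpret V': qspace Q' V' by fact
  obtain u v where uv: "u \<in> V" "v \<in> V" "Q u = 1" "v \<noteq> 0" "osum Q V (Fq.span {u}) (Fq.span {v})"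
    "\<not> is_square (- (1 * Q v))"
    using V.anisotropic_basis[OF an(1) d(1), of 1] by auto
  obtain u' v' where uv': "u' \<in> V'" "v' \<in> V'" "Q' u' = c" "v' \<noteq> 0"
    "osum Q' V' (Fq.span {u'}) (Fq.span {v'})" "\<not> is_square (- (c * Q' v'))"
    using V'.anisotropic_basis[OF an(2) d(2) c] by auto
  have "is_square (- (1 * Q v) * - (c * Q' v'))" by (rule nonsquare_mult[OF V.two uv(6) uv'(6)])
  then obtain s where s: "Q v * (c * Q' v') = s\<^sup>2" by (auto simp: is_square_def)
  have nz: "Q v \<noteq> 0" "Q' v' \<noteq> 0" using uv uv' an by (auto simp: anisotropic_def)
  have "s \<noteq> 0" using s nz c by auto
  have "u \<noteq> 0" "u' \<noteq> 0" using uv uv' c by auto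
  then obtain g1 where g1: "sim c Q (Fq.span {u}) Q' (Fq.span {u'}) g1"
    using line_sim[OF V V' uv(1) uv'(1), of 1 c] uv uv' by auto
  \<comment> \<open>The scaled \<open>v'\<close> has value \<open>s\<^sup>2 / Q' v'\<close>, which
    is \<open>c * Q v\<close> by the choice of \<open>s\<close>.\<close>
  have "Q' v' * (s / Q' v')\<^sup>2 = c * Q v"
    unfolding power_divide s[symmetric] using nz by (simp add: power2_eq_square field_simps)
  then obtain g2 where "sim c Q (Fq.span {v}) Q' (Fq.span {v'}) g2"
    using line_sim[OF V V' uv(2) uv'(2) uv(4) uv'(4), of "s / Q' v'" c] nz \<open>s \<noteq> 0\<close> by auto
  from sim_glue[OF V V' uv(5) uv'(5) g1 this] show ?thesis by blast
qed

text \<open>The type is \<open>1 - dim B\<close>. In this form it makes sense on any subspace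
  without coordinates and can be followed through orthogonal sums.\<close>

definition witt_type :: "((nat \<Rightarrow> 'a::field) \<Rightarrow> 'a) \<Rightarrow> (nat \<Rightarrow> 'a) set \<Rightarrow> int \<Rightarrow> bool" where
  "witt_type Q V e \<longleftrightarrow> (\<exists>k R B. witt_decomp Q V k R B \<and> anisotropic Q B \<and>
     (Fq.dim B = 0 \<and> e = 1 \<or> Fq.dim B = 1 \<and> e = 0 \<or> Fq.dim B = 2 \<and> e = - 1))"

lemma witt_decomp_qspace: "witt_decomp Q V k R B \<Longrightarrow> qspace Q V \<Longrightarrow> qspace Q B"
  using witt_decomp_subsets[of Q V k R B] qspace.qspace_subspace by blast

lemma witt_type_exists:
  assumes "qspace Q V" "radical Q V = {0}"
  shows "\<exists>e. witt_type Q V e"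
proof -
  obtain k R B where w: "witt_decomp Q V k R B" "anisotropic Q B"
    using witt_decomp_exists[OF assms] by blast
  then have "Fq.dim B \<le> 2" using qspace.anisotropic_dim_le_2 witt_decomp_qspace assms by blast
  then have "Fq.dim B = 0 \<or> Fq.dim B = 1 \<or> Fq.dim B = 2" by linarith
  then show ?thesis using w unfolding witt_type_def by blast
qed

lemma witt_type_parity:
  assumes "qspace Q V" "witt_type Q V e"
  shows "e = 0 \<longleftrightarrow> odd (Fq.dim V)" "e \<in> {0, 1, -1}"
  using assms witt_decomp_dim[of Q V _ _ _] by (auto simp: witt_type_def)

lemma witt_type_nondegenerate:
  assumes "qspace Q V" "witt_type Q V e"
  shows "radical Q V = {0}"
  using assms witt_decomp_nondegenerate qspace.anisotropic_radical witt_decomp_qspace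
    unfolding witt_type_def by metis

lemma witt_index_le:
  assumes "witt_decomp Q V k R B" "qspace Q V" "anisotropic Q B"
    and "witt_decomp Q' V' k' R' B'" "qspace Q' V'" "anisotropic Q' B'"
    and "sim c Q V Q' V' g"
  shows "k \<le> k'"
proof -
  interpret qspace Q V by fact
  have R: "Fq.subspace R" "R \<subseteq> V" "\<forall>x\<in>R. Q x = 0" "Fq.dim R = k"
    using witt_decomp_subsets[OF assms(1)] witt_decomp_orth[OF assms(1,2)] by auto
  have "finite R" using R finite by (auto intro: finite_subset)
  moreover have g: "lin g" "inj_on g R" "g ` V = V'"
    using assms(7) R by (auto simp: sim_def intro: inj_on_subset)
  ultimately have "Fq.dim (g ` R) = k" using dim_image_inj R by metis
  moreover have "Fq.dim (g ` R) \<le> k'"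
    using witt_decomp_isotropic_dim_le[OF assms(4-6), of "g ` R"] subspace_image[OF g(1) R(1)] R g
      assms(7)
    by (auto simp: sim_def subset_iff)
  ultimately show ?thesis by simp
qed

lemma sim_dim:
  assumes "sim c Q V Q' V' g" "qspace Q V"
  shows "Fq.dim V' = Fq.dim V"
  using assms dim_image_inj[of g V] by (auto simp: sim_def qspace.subspace qspace.finite)

text \<open>A similarity maps totally isotropic subspaces to such subspaces, so the two Witt indices
  bound each other. Together with the dimension they determine the dimension of the kernel.\<close>

lemma witt_type_sim_eq:
  assumes "qspace Q V" "qspace Q' V'" "sim c Q V Q' V' g" "c \<noteq> 0" "witt_type Q V e"
    "witt_type Q' V' e'"
  shows "e = e'"
proof -
  obtain k R B where w: "witt_decomp Q V k R B" "anisotropic Q B"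
    "Fq.dim B = 0 \<and> e = 1 \<or> Fq.dim B = 1 \<and> e = 0 \<or> Fq.dim B = 2 \<and> e = - 1"
    using assms(5) unfolding witt_type_def by blast
  obtain k' R' B' where w': "witt_decomp Q' V' k' R' B'" "anisotropic Q' B'"
    "Fq.dim B' = 0 \<and> e' = 1 \<or> Fq.dim B' = 1 \<and> e' = 0 \<or> Fq.dim B' = 2 \<and> e' = - 1"
    using assms(6) unfolding witt_type_def by blast
  obtain h where h: "sim (1 / c) Q' V' Q V h"
    using sim_inverse[OF assms(3) qspace.subspace[OF assms(1)] assms(4)] by blast
  have "k = k'"
    using witt_index_le[OF w(1) assms(1) w(2) w'(1) assms(2) w'(2) assms(3)]
      witt_index_le[OF w'(1) assms(2) w'(2) w(1) assms(1) w(2) h] by simp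
  then have "Fq.dim B = Fq.dim B'"
    using witt_decomp_dim[OF w(1) assms(1)] witt_decomp_dim[OF w'(1) assms(2)]
      sim_dim[OF assms(3,1)] by simp
  then show ?thesis using w(3) w'(3) by auto
qed

lemma sim_id: "sim 1 Q V Q V (\<lambda>x. x)"
  using Fq.linear_ident by (simp add: sim_def)

lemma witt_type_unique:
  assumes "qspace Q V" "witt_type Q V e" "witt_type Q V e'"
  shows "e = e'"
  using witt_type_sim_eq[OF assms(1,1) sim_id _ assms(2,3)] by simp

lemma sim_radical:
  assumes "qspace Q V" "sim c Q V Q' V' g" "c \<noteq> 0"
  shows "radical Q' V' = g ` radical Q V"
proof -
  have "V' = g ` V" using assms by (simp add: sim_def)
  then show ?thesis
    using sim_polar[OF assms(2) qspace.subspace[OF assms(1)]] assms(3)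
    by (auto simp: radical_def)
qed

lemma witt_type_sim:
  assumes "qspace Q V" "qspace Q' V'" "sim c Q V Q' V' g" "c \<noteq> 0" "witt_type Q V e"
  shows "witt_type Q' V' e"
proof -
  have "radical Q' V' = {0}"
    using sim_radical[OF assms(1,3,4)] witt_type_nondegenerate[OF assms(1,5)] assms(3)
      lin_zero[of g] by (simp add: sim_def)
  then obtain e' where e': "witt_type Q' V' e'" using witt_type_exists[OF assms(2)] by blast
  then show ?thesis using witt_type_sim_eq[OF assms(1-5)] by blast
qed

lemma witt_type_witt_decomp: "witt_decomp Q V k R B \<Longrightarrow> witt_type Q B e \<Longrightarrow> witt_type Q V e"
  unfolding witt_type_def using witt_decomp_trans by blast

lemma max_isotropic_dim_eq:
  fixes Q :: "(nat \<Rightarrow> 'a::{field,finite}) \<Rightarrow> 'a"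
  assumes "witt_decomp Q (coord_space m) k R B" "qspace Q (coord_space m)" "anisotropic Q B"
  shows "max_isotropic_dim m Q = k"
  unfolding max_isotropic_dim_def
proof (rule Max_eqI)
  let ?D = "{Fq.dim W |W. totally_isotropic Q W \<and> W \<subseteq> coord_space m}"
  show "finite ?D"
  proof (rule finite_subset)
    show "?D \<subseteq> Fq.dim ` Pow (coord_space m :: (nat \<Rightarrow> 'a) set)" by blast
  qed (simp add: finite_coord_space)
  show "y \<le> k" if "y \<in> ?D" for y
    using that witt_decomp_isotropic_dim_le[OF assms] by (auto simp: totally_isotropic_def)
  show "k \<in> ?D"
    using witt_decomp_subsets[OF assms(1)] witt_decomp_orth[OF assms(1,2)]
    by (auto simp: totally_isotropic_def intro!: exI[of _ R])
qed

text \<open>Since \<open>m = 2 * k + dim B\<close> with \<open>k\<close> the maximal isotropic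
  dimension, kernel dimensions 0, 1 and 2 mean \<open>k = m / 2\<close>, \<open>m\<close> odd and
  \<open>k + 1 = m / 2\<close>. For \<open>m = 0\<close> only the first is possible, so the zero
  space gets type 1.\<close>

lemma form_of_type_witt_type:
  fixes Q :: "(nat \<Rightarrow> 'a::{field,finite}) \<Rightarrow> 'a"
  assumes "(2::'a) \<noteq> 0"
  shows "form_of_type m e Q \<longleftrightarrow> qspace Q (coord_space m) \<and> witt_type Q (coord_space m) e"
proof -
  have main: "witt_type Q (coord_space m) e \<longleftrightarrow>
     (odd m \<and> e = 0 \<or>
      even m \<and> e = 1 \<and> max_isotropic_dim m Q = m div 2 \<or>
      even m \<and> e = -1 \<and> max_isotropic_dim m Q + 1 = m div 2)"
    if q: "qspace Q (coord_space m)" and r: "radical Q (coord_space m) = {0}"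
  proof -
    obtain k R B where w: "witt_decomp Q (coord_space m) k R B" "anisotropic Q B"
      using witt_decomp_exists[OF q r] by blast
    have B2: "Fq.dim B \<le> 2" using w witt_decomp_qspace q qspace.anisotropic_dim_le_2 by blast
    have m: "m = 2 * k + Fq.dim B" using witt_decomp_dim[OF w(1) q] by (simp add: dim_coord_space)
    have k: "max_isotropic_dim m Q = k" by (rule max_isotropic_dim_eq[OF w(1) q w(2)])
    have "witt_type Q (coord_space m) (1 - int (Fq.dim B))"
      using w B2 unfolding witt_type_def by fastforce
    then have "witt_type Q (coord_space m) e \<longleftrightarrow> e = 1 - int (Fq.dim B)"
      using witt_type_unique[OF q] by blast
    also have "\<dots> \<longleftrightarrow> (odd m \<and> e = 0 \<or> even m \<and> e = 1 \<and> k = m div 2 \<or> even m \<and> e = -1 \<and> k + 1 = m div 2)"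
    proof -
      consider "Fq.dim B = 0" | "Fq.dim B = 1" | "Fq.dim B = 2" using B2 by linarith
      then show ?thesis unfolding m by cases auto
    qed
    finally show ?thesis unfolding k .
  qed
  show ?thesis
    unfolding form_of_type_def qspace_coord_space[OF assms]
    using main witt_type_nondegenerate by blast
qed

section \<open>Types of orthogonal sums\<close>

lemma witt_type_osum_kernel:
  assumes "qspace Q K" "osum Q K A D" "witt_decomp Q A k R B"
  shows "qspace Q (ssum B D)" "osum Q (ssum B D) B D" "witt_type Q (ssum B D) e \<Longrightarrow> witt_type Q K e"
proof -
  have *: "witt_decomp Q K k R (ssum B D)" "osum Q (ssum B D) B D"
    using witt_decomp_osum[OF assms(3,1,2)] by auto
  then show "qspace Q (ssum B D)" "osum Q (ssum B D) B D" "witt_type Q (ssum B D) e \<Longrightarrow> witt_type Q K e"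
    using witt_decomp_qspace assms(1) witt_type_witt_decomp by blast+
qed

text \<open>The rule (-1)(-1) = 1. The planes are similar with multiplier -1, which produces a
  totally isotropic plane; in dimension 4 that leaves a zero kernel.\<close>

lemma witt_type_anisotropic_pair:
  assumes "qspace Q K" "osum Q K A B" "anisotropic Q A" "anisotropic Q B"
    and "Fq.dim A = 2" "Fq.dim B = 2"
  shows "witt_type Q K 1"
proof -
  interpret qspace Q K by fact
  have sub: "A \<subseteq> K" "B \<subseteq> K" using osum_subset[OF assms(2)] by auto
  have ss: "Fq.subspace A" "Fq.subspace B" "A \<inter> B = {0}"
    and orth: "\<forall>a\<in>A. \<forall>b\<in>B. polar Q a b = 0"
    using assms(2) by (auto simp: osum_def)
  have q: "qspace Q A" "qspace Q B" using sub ss qspace_subspace by auto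
  obtain g where g: "sim (- 1) Q A Q B g"
    using anisotropic_sim[OF q assms(3-6), of "- 1"] by auto
  have gB: "g a \<in> B" if "a \<in> A" for a using g that by (auto simp: sim_def)
  have lg: "lin g" using g by (simp add: sim_def)
  \<comment> \<open>The graph of an anti-isometry is totally isotropic.\<close>
  define W where "W = (\<lambda>a. a + g a) ` A"
  have lin_f: "lin (\<lambda>a. a + g a)"
    using lg Fq.linear_ident by (rule Fq2.linear_compose_add[rotated])
  have "inj_on (\<lambda>a. a + g a) A"
    by (rule inj_onI) (rule ssum_unique(1)[OF ss], auto intro: gB)
  then have "Fq.dim W = 2"
    unfolding W_def using dim_image_inj[OF lin_f _ ss(1) qspace.finite[OF q(1)]] assms(5) by simp
  moreover have "Fq.subspace W" unfolding W_def using lin_f ss(1) by (rule subspace_image)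
  moreover have "W \<subseteq> K" using sub gB by (auto simp: W_def subset_iff)
  moreover have "\<forall>x\<in>W. Q x = 0"
    using g gB orth by (auto simp: W_def Q_add sim_def)
  moreover have rad: "radical Q K = {0}"
    using osum_nondegenerate_iff[OF assms(1,2)] qspace.anisotropic_radical[OF q(1) assms(3)]
      qspace.anisotropic_radical[OF q(2) assms(4)] by simp
  moreover obtain k R C where w: "witt_decomp Q K k R C" "anisotropic Q C"
    using witt_decomp_exists[OF assms(1) rad] by blast
  ultimately have "2 \<le> k" using witt_decomp_isotropic_dim_le[OF w(1) assms(1) w(2)] by metis
  moreover have "4 = 2 * k + Fq.dim C"
    using witt_decomp_dim[OF w(1) assms(1)] osum_dim[OF assms(1,2)] assms(5,6) by simp
  ultimately have "Fq.dim C = 0" by simp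
  then show ?thesis using w unfolding witt_type_def by blast
qed

text \<open>A nontrivial zero of \<open>a\<^sup>2 * Q u + b\<^sup>2 * Q v\<close> exists exactly
  when minus the discriminant is a square. The plane is then hyperbolic, otherwise
  anisotropic.\<close>

lemma witt_type_line_pair:
  assumes "qspace Q K" "osum Q K (Fq.span {u}) (Fq.span {v})" "Q u \<noteq> 0" "Q v \<noteq> 0"
  shows "witt_type Q K (if is_square (- (Q u * Q v)) then 1 else - 1)"
proof -
  interpret qspace Q K by fact
  have uv: "u \<in> K" "v \<in> K" "polar Q u v = 0"
    using osum_subset[OF assms(2)] assms(2) by (auto simp: osum_def Fq.span_base)
  have dim: "Fq.dim K = 2"
  proof -
    have "u \<noteq> 0" "v \<noteq> 0" using assms(3,4) by auto
    then show ?thesis using osum_dim[OF assms(1,2)] by (simp add: dim_singleton)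
  qed
  have KQ: "\<exists>a b. x = vscale a u + vscale b v" if "x \<in> K" for x
    using that assms(2) by (auto simp: osum_def ssum_def Fq.span_singleton)
  have Quv: "Q (vscale a u + vscale b v) = a\<^sup>2 * Q u + b\<^sup>2 * Q v" for a b
    using uv by (simp add: Q_add Q_scale polar_simps)
  show ?thesis
  proof (cases "anisotropic Q K")
    case True
    have "\<not> is_square (- (Q u * Q v))"
    proof
      assume "is_square (- (Q u * Q v))"
      then obtain s where s: "- (Q u * Q v) = s\<^sup>2" by (auto simp: is_square_def)
      \<comment> \<open>Its value is \<open>s\<^sup>2 * Q u + (Q u)\<^sup>2 * Q v\<close>, which is
        zero by the choice of \<open>s\<close>.\<close>
      define z where "z = vscale s u + vscale (Q u) v"
      have "Q z = 0" unfolding z_def Quv s[symmetric] by (simp add: power2_eq_square)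
      then have "z = 0" using True uv by (simp add: anisotropic_def z_def)
      moreover have "polar Q z v = Q u * Q v" using uv by (simp add: z_def polar_simps)
      ultimately show False using assms(3,4) uv by simp
    qed
    then show ?thesis using witt_decomp.base[OF subspace] True dim unfolding witt_type_def by auto
  next
    case False
    then obtain z where z: "z \<in> K" "Q z = 0" "z \<noteq> 0" by (auto simp: anisotropic_def)
    obtain a b where ab: "z = vscale a u + vscale b v" using KQ z by blast
    have eq: "a\<^sup>2 * Q u + b\<^sup>2 * Q v = 0" using z Quv ab by simp
    have "a \<noteq> 0" using eq assms(3,4) z(3) ab by auto
    have "b \<noteq> 0" using eq assms(3,4) z(3) ab by auto
    have "- (Q u * Q v) = (b * Q v / a)\<^sup>2"
    proof -
      have "Q u = - (b\<^sup>2 * Q v) / a\<^sup>2"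
        using eq \<open>a \<noteq> 0\<close> by (simp add: field_simps eq_neg_iff_add_eq_0)
      then show ?thesis by (simp add: power2_eq_square)
    qed
    then have sq: "is_square (- (Q u * Q v))" unfolding is_square_def by blast
    have zs: "Fq.span {z} \<subseteq> K" using z by (intro Fq.span_minimal) (auto simp: subspace)
    have "radical Q (Fq.span {x}) = {0}" if x: "x \<in> K" "Q x \<noteq> 0" for x
    proof -
      have "anisotropic Q (Fq.span {x})"
        using x by (auto simp: anisotropic_def Fq.span_singleton Q_scale)
      moreover have "Fq.span {x} \<subseteq> K" using x by (intro Fq.span_minimal) (auto simp: subspace)
      ultimately show ?thesis using qspace.anisotropic_radical qspace_subspace Fq.subspace_span
        by blast
    qed
    then have "radical Q K = {0}"
      using osum_nondegenerate_iff[OF assms(1,2)] uv assms(3,4) by blast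
    moreover have "\<forall>x\<in>Fq.span {z}. Q x = 0" using z by (auto simp: Fq.span_singleton Q_scale)
    ultimately obtain B where B: "witt_decomp Q K (Fq.dim (Fq.span {z})) (Fq.span {z}) B"
      using witt_decomp_isotropic_exists[OF assms(1) _ Fq.subspace_span zs] by blast
    have "Fq.dim B = 0" using witt_decomp_dim[OF B assms(1)] dim dim_singleton[OF z(3)] by simp
    moreover have "qspace Q B" using witt_decomp_qspace[OF B assms(1)] .
    ultimately have "anisotropic Q B"
      using dim_0_iff[of B] qspace.subspace qspace.finite by (auto simp: anisotropic_def)
    then show ?thesis using B \<open>Fq.dim B = 0\<close> sq unfolding witt_type_def by auto
  qed
qed

text \<open>After removing the hyperbolic planes of both summands only kernels of dimension 0 or 2
  remain, and two kernels of dimension 2 cancel.\<close>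

lemma witt_type_sum_even:
  assumes "qspace Q K" "osum Q K A D" "witt_type Q A e" "witt_type Q D f" "e \<noteq> 0" "f \<noteq> 0"
  shows "witt_type Q K (e * f)"
proof -
  obtain k R B where w: "witt_decomp Q A k R B" "anisotropic Q B"
    "Fq.dim B = 0 \<and> e = 1 \<or> Fq.dim B = 2 \<and> e = - 1"
    using assms(3,5) unfolding witt_type_def by blast
  note o1 = witt_type_osum_kernel[OF assms(1,2) w(1)]
  have qB: "qspace Q B"
    using osum_subset[OF o1(2)] o1(2) qspace.qspace_subspace[OF o1(1)] by (auto simp: osum_def)
  show ?thesis
  proof (cases "e = 1")
    case True
    then have "B = {0}" using w(3) dim_0_iff[of B] qB qspace.subspace qspace.finite by fastforce
    then show ?thesis using o1(3)[of f] assms(4) True by simp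
  next
    case False
    then have e: "Fq.dim B = 2" "e = - 1" using w(3) by auto
    obtain l S C where w': "witt_decomp Q D l S C" "anisotropic Q C"
      "Fq.dim C = 0 \<and> f = 1 \<or> Fq.dim C = 2 \<and> f = - 1"
      using assms(4,6) unfolding witt_type_def by blast
    note o2 = witt_type_osum_kernel[OF o1(1) osum_commute[OF o1(2)] w'(1)]
    have qC: "qspace Q C"
      using osum_subset[OF o2(2)] o2(2) qspace.qspace_subspace[OF o2(1)] by (auto simp: osum_def)
    have "witt_type Q (ssum C B) (e * f)"
    proof (cases "f = 1")
      case True
      then have "C = {0}" using w'(3) dim_0_iff[of C] qC qspace.subspace qspace.finite by fastforce
      then show ?thesis
        using e True w(2) witt_decomp.base[OF qspace.subspace[OF qB]] unfolding witt_type_def by auto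
    next
      case False
      then have "Fq.dim C = 2" "f = - 1" using w'(3) by auto
      then show ?thesis using witt_type_anisotropic_pair[OF o2(1,2) w'(2) w(2)] e by simp
    qed
    then show ?thesis using o1(3) o2(3) by blast
  qed
qed

text \<open>The square class of \<open>Q u\<close> is what type 0 does not record, so the vector
  \<open>u\<close> is exposed for the comparison of multipliers.\<close>

lemma witt_type_0_kernel:
  assumes "qspace Q V" "witt_type Q V 0"
  shows "\<exists>k R u. witt_decomp Q V k R (Fq.span {u}) \<and> Q u \<noteq> 0 \<and> u \<noteq> 0 \<and> u \<in> V"
proof -
  obtain k R B where w: "witt_decomp Q V k R B" "anisotropic Q B" "Fq.dim B = 1"
    using assms(2) unfolding witt_type_def by auto
  have B: "Fq.subspace B" "B \<subseteq> V" using witt_decomp_subsets[OF w(1)] by auto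
  obtain u where u: "u \<noteq> 0" "B = Fq.span {u}" using dim_1_span[OF B(1) w(3)] by blast
  then have "u \<in> B" by (simp add: Fq.span_base)
  then have "Q u \<noteq> 0" using w(2) u by (auto simp: anisotropic_def)
  then show ?thesis using w u B \<open>u \<in> B\<close> by blast
qed

lemma witt_type_sum_odd:
  assumes "qspace Q K" "osum Q K A D" "witt_decomp Q A k R (Fq.span {u})"
    "witt_decomp Q D l S (Fq.span {v})"
    and "Q u \<noteq> 0" "Q v \<noteq> 0"
  shows "witt_type Q K (if is_square (- (Q u * Q v)) then 1 else - 1)"
proof -
  note o1 = witt_type_osum_kernel[OF assms(1-3)]
  note o2 = witt_type_osum_kernel[OF o1(1) osum_commute[OF o1(2)] assms(4)]
  show ?thesis
    using witt_type_line_pair[OF o2(1,2) assms(6,5)] o1(3) o2(3) by (simp add: mult.commute)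
qed

text \<open>The multiplier is free here, because a zero kernel and an anisotropic plane both accept
  every nonzero \<open>c\<close>.\<close>

lemma witt_type_even_sim:
  assumes "qspace Q V" "qspace Q' V'" "witt_type Q V e" "witt_type Q' V' e" "e \<noteq> 0"
    and "Fq.dim V = Fq.dim V'" "c \<noteq> 0"
  shows "\<exists>g. sim c Q V Q' V' g"
proof -
  obtain k R B where w: "witt_decomp Q V k R B" "anisotropic Q B"
    "Fq.dim B = 0 \<and> e = 1 \<or> Fq.dim B = 2 \<and> e = - 1"
    using assms(3,5) unfolding witt_type_def by blast
  obtain k' R' B' where w': "witt_decomp Q' V' k' R' B'" "anisotropic Q' B'"
    "Fq.dim B' = 0 \<and> e = 1 \<or> Fq.dim B' = 2 \<and> e = - 1"
    using assms(4,5) unfolding witt_type_def by blast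
  have q: "qspace Q B" "qspace Q' B'" using witt_decomp_qspace w w' assms by blast+
  have k: "k' = k"
    using witt_decomp_dim[OF w(1) assms(1)] witt_decomp_dim[OF w'(1) assms(2)] w(3) w'(3) assms(6)
      by auto
  have "\<exists>g. sim c Q B Q' B' g"
  proof (cases "e = 1")
    case True
    then have "B = {0}" "B' = {0}"
      using w(3) w'(3) dim_0_iff[of B] dim_0_iff[of B'] q qspace.subspace qspace.finite by fastforce+
    then have "sim c Q B Q' B' (\<lambda>x. x)"
      using qspace.Q_zero[OF q(1)] qspace.Q_zero[OF q(2)] Fq.linear_ident by (auto simp: sim_def)
    then show ?thesis by blast
  next
    case False
    then show ?thesis using anisotropic_sim[OF q w(2) w'(2) _ _ assms(7)] w(3) w'(3) by auto
  qed
  then obtain gB where "sim c Q B Q' B' gB" by blast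
  from witt_decomp_sim[OF w(1) w'(1)[unfolded k] assms(1,2,7) this] show ?thesis by blast
qed

text \<open>The kernels are lines, so \<open>c\<close> is constrained: it must carry
  \<open>Q u\<close> into the square class of \<open>Q' u'\<close>. The scalar \<open>t\<close>
  witnesses this.\<close>

lemma witt_type_odd_sim:
  assumes "qspace Q V" "qspace Q' V'" "witt_decomp Q V k R (Fq.span {u})"
    "witt_decomp Q' V' k' R' (Fq.span {u'})"
    and "u \<in> V" "u' \<in> V'" "Q u \<noteq> 0" "Q' u' \<noteq> 0" "Fq.dim V = Fq.dim V'"
    and "c \<noteq> 0" "t \<noteq> 0" "Q' u' * t\<^sup>2 = c * Q u"
  shows "\<exists>g. sim c Q V Q' V' g"
proof -
  have u0: "u \<noteq> 0" "u' \<noteq> 0" using qspace.Q_zero assms by metis+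
  have "k' = k"
    using witt_decomp_dim[OF assms(3,1)] witt_decomp_dim[OF assms(4,2)] dim_singleton[OF u0(1)]
      dim_singleton[OF u0(2)]
      assms(9) by simp
  moreover obtain g where "sim c Q (Fq.span {u}) Q' (Fq.span {u'}) g"
    using line_sim[OF assms(1,2,5,6) u0 assms(11,12)] by blast
  ultimately show ?thesis using witt_decomp_sim[OF assms(3) _ assms(1,2,10)] assms(4) by blast
qed

lemma is_square_mult:
  assumes "(2::'a::{field,finite}) \<noteq> 0" "is_square a \<longleftrightarrow> is_square (b::'a)"
  shows "is_square (a * b)"
proof (cases "is_square a")
  case True
  then obtain x y where "a = x\<^sup>2" "b = y\<^sup>2" using assms(2) by (auto simp: is_square_def)
  then have "a * b = (x * y)\<^sup>2" by (simp add: power_mult_distrib)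
  then show ?thesis unfolding is_square_def by blast
next
  case False
  then show ?thesis using nonsquare_mult[OF assms(1), of a b] assms(2) by blast
qed

text \<open>In each parity case the common multiplier is chosen to match the odd-dimensional summand;
  if both are odd-dimensional, the type of the sum fixes the product of their discriminants.\<close>

lemma osum_sim:
  assumes K: "qspace Q K" "qspace Q' K'" and o: "osum Q K A D" "osum Q' K' A' D'"
    and d: "Fq.dim A = Fq.dim A'" "Fq.dim D = Fq.dim D'"
    and t: "witt_type Q K e" "witt_type Q' K' e" "witt_type Q D f" "witt_type Q' D' f"
    and l: "odd (Fq.dim K) \<Longrightarrow> odd (Fq.dim D) \<Longrightarrow> witt_type Q A l \<and> witt_type Q' A' l"
  shows "\<exists>c gA gD. c \<noteq> 0 \<and> sim c Q A Q' A' gA \<and> sim c Q D Q' D' gD"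
proof -
  have sub: "A \<subseteq> K" "D \<subseteq> K" "A' \<subseteq> K'" "D' \<subseteq> K'"
    using osum_subset[OF o(1)] osum_subset[OF o(2)] by auto
  have q: "qspace Q A" "qspace Q D" "qspace Q' A'" "qspace Q' D'"
    using o sub qspace.qspace_subspace[OF K(1)] qspace.qspace_subspace[OF K(2)]
    by (auto simp: osum_def)
  have two: "(2::'a) \<noteq> 0" using K(1) by (rule qspace.two)
  have dK: "Fq.dim K = Fq.dim A + Fq.dim D" "Fq.dim K' = Fq.dim A + Fq.dim D"
    using osum_dim[OF K(1) o(1)] osum_dim[OF K(2) o(2)] d by auto
  have rad: "radical Q A = {0}" "radical Q' A' = {0}"
    using witt_type_nondegenerate[OF K(1) t(1)] osum_nondegenerate_iff[OF K(1) o(1)]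
      witt_type_nondegenerate[OF K(2) t(2)] osum_nondegenerate_iff[OF K(2) o(2)] by auto
  obtain x where x: "witt_type Q A x" using witt_type_exists[OF q(1) rad(1)] by blast
  obtain x' where x': "witt_type Q' A' x'" using witt_type_exists[OF q(3) rad(2)] by blast
  note px = witt_type_parity(1)[OF q(1) x] and px' = witt_type_parity(1)[OF q(3) x']
    and pf = witt_type_parity(1)[OF q(2) t(3)]
  \<comment> \<open>For a single odd-dimensional summand the quotient of the two kernel values
    serves as multiplier, with \<open>t = 1\<close>.\<close>
  have odd_sim: "\<exists>c g. c \<noteq> 0 \<and> sim c Q B Q' B' g"
    if B: "qspace Q B" "qspace Q' B'" "witt_type Q B 0" "witt_type Q' B' 0" "Fq.dim B = Fq.dim B'"
      for B B'
  proof -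
    obtain k R u where u: "witt_decomp Q B k R (Fq.span {u})" "Q u \<noteq> 0" "u \<noteq> 0" "u \<in> B"
      using witt_type_0_kernel[OF B(1,3)] by blast
    obtain k' R' u' where u': "witt_decomp Q' B' k' R' (Fq.span {u'})" "Q' u' \<noteq> 0" "u' \<noteq> 0" "u' \<in> B'"
      using witt_type_0_kernel[OF B(2,4)] by blast
    show ?thesis
      using witt_type_odd_sim[OF B(1,2) u(1) u'(1) u(4) u'(4) u(2) u'(2) B(5), of "Q' u' / Q u" 1]
        u u'
      by (intro exI[of _ "Q' u' / Q u"]) simp
  qed
  show ?thesis
  proof (cases "odd (Fq.dim D)")
    case True
    then have f: "f = 0" using pf by simp
    show ?thesis
    proof (cases "odd (Fq.dim K)")
      case odd: True
      \<comment> \<open>\<open>K\<close> and \<open>D\<close> both have type 0 in this case, which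
        leaves the type of \<open>A\<close> open; the assumption on \<open>l\<close> supplies it.
        The even-dimensional \<open>A\<close> then accepts the multiplier of
        \<open>D\<close>.\<close>
      then have xl: "x = l" "x' = l"
        using l[OF odd True] x x' witt_type_unique q by blast+
      have "x \<noteq> 0" using px dK True odd by simp
      obtain c g where g: "c \<noteq> 0" "sim c Q D Q' D' g"
        using odd_sim[OF q(2,4)] t(3,4) f d by blast
      obtain h where "sim c Q A Q' A' h"
        using witt_type_even_sim[OF q(1,3) x _ \<open>x \<noteq> 0\<close> d(1) g(1)] x' xl by blast
      then show ?thesis using g by blast
    next
      case False
      then have "x = 0" "x' = 0" using px px' dK True d by simp_all
      then obtain k R u k' R' u' where
        u: "witt_decomp Q A k R (Fq.span {u})" "Q u \<noteq> 0" "u \<noteq> 0" "u \<in> A" and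
        u': "witt_decomp Q' A' k' R' (Fq.span {u'})" "Q' u' \<noteq> 0" "u' \<noteq> 0" "u' \<in> A'"
        using witt_type_0_kernel[OF q(1)] witt_type_0_kernel[OF q(3)] x x' by metis
      obtain m S v m' S' v' where
        v: "witt_decomp Q D m S (Fq.span {v})" "Q v \<noteq> 0" "v \<noteq> 0" "v \<in> D" and
        v': "witt_decomp Q' D' m' S' (Fq.span {v'})" "Q' v' \<noteq> 0" "v' \<noteq> 0" "v' \<in> D'"
        using witt_type_0_kernel[OF q(2)] witt_type_0_kernel[OF q(4)] t f by metis
      \<comment> \<open>The type of \<open>K\<close> tells whether minus the product of the two
        kernel values is a square, so the answer is the same for both forms.\<close>
      have "e = (if is_square (- (Q u * Q v)) then 1 else - 1)"
        using witt_type_unique[OF K(1) t(1) witt_type_sum_odd[OF K(1) o(1) u(1) v(1) u(2) v(2)]] .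
      moreover have "e = (if is_square (- (Q' u' * Q' v')) then 1 else - 1)"
        using witt_type_unique[OF K(2) t(2) witt_type_sum_odd[OF K(2) o(2) u'(1) v'(1) u'(2) v'(2)]] .
      ultimately have "is_square (- (Q u * Q v)) \<longleftrightarrow> is_square (- (Q' u' * Q' v'))"
        by (auto split: if_splits)
      then have "is_square (- (Q u * Q v) * - (Q' u' * Q' v'))" by (rule is_square_mult[OF two])
      then obtain s where s: "(Q u * Q v) * (Q' u' * Q' v') = s\<^sup>2" by (auto simp: is_square_def)
      \<comment> \<open>This multiplier fits \<open>D\<close> with \<open>t = 1\<close>. It also
        fits \<open>A\<close>, because the product of all four kernel values is the square of
        \<open>s\<close>; the scalar \<open>r\<close> below solves the resulting equation.\<close>
      define c where "c = Q' v' / Q v"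
      have c: "c \<noteq> 0" "Q' v' * 1\<^sup>2 = c * Q v" using v v' by (simp_all add: c_def)
      have "s \<noteq> 0" using s u v u' v' by auto
      define r where "r = s / (Q v * Q' u')"
      have "r \<noteq> 0" using \<open>s \<noteq> 0\<close> v u' by (simp add: r_def)
      have "Q' u' * r\<^sup>2 = c * Q u"
        unfolding r_def power_divide s[symmetric] c_def using v u'
        by (simp add: power2_eq_square field_simps)
      then obtain g where "sim c Q A Q' A' g"
        using witt_type_odd_sim[OF q(1,3) u(1) u'(1) u(4) u'(4) u(2) u'(2) d(1) c(1) \<open>r \<noteq> 0\<close>] by blast
      moreover obtain h where "sim c Q D Q' D' h"
        using witt_type_odd_sim[OF q(2,4) v(1) v'(1) v(4) v'(4) v(2) v'(2) d(2) c(1) _ c(2)] by auto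
      ultimately show ?thesis using c(1) by blast
    qed
  next
    case False
    then have f: "f \<noteq> 0" using pf by simp
    show ?thesis
    proof (cases "odd (Fq.dim A)")
      case True
      then have "x = 0" "x' = 0" using px px' d by simp_all
      then obtain c g where g: "c \<noteq> 0" "sim c Q A Q' A' g"
        using odd_sim[OF q(1,3)] x x' d by blast
      then show ?thesis using witt_type_even_sim[OF q(2,4) t(3,4) f d(2) g(1)] by blast
    next
      case even: False
      then have nz: "x \<noteq> 0" "x' \<noteq> 0" using px px' d by simp_all
      \<comment> \<open>Multiplicativity with a nonzero \<open>f\<close> recovers the type of
        \<open>A\<close> from those of \<open>K\<close> and \<open>D\<close>.\<close>
      have "e = x * f"
        using witt_type_unique[OF K(1) t(1) witt_type_sum_even[OF K(1) o(1) x t(3) nz(1) f]] .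
      moreover have "e = x' * f"
        using witt_type_unique[OF K(2) t(2) witt_type_sum_even[OF K(2) o(2) x' t(4) nz(2) f]] .
      ultimately have "x = x'" using f by simp
      then obtain g h where "sim 1 Q A Q' A' g" "sim 1 Q D Q' D' h"
        using witt_type_even_sim[OF q(1,3) x _ nz(1) d(1), of 1] x'
          witt_type_even_sim[OF q(2,4) t(3,4) f d(2), of 1] by auto
      then show ?thesis using zero_neq_one by metis
    qed
  qed
qed

section \<open>Equivalence of subspaces with equal parameters\<close>

text \<open>The last line makes \<open>A\<close> play for the perp of \<open>U\<close> the role that
  \<open>D\<close> plays for \<open>U\<close>: a complement of the radical, hence a carrier of the
  perp type.\<close>

definition orth_split ::
  "((nat \<Rightarrow> 'a::field) \<Rightarrow> 'a) \<Rightarrow> (nat \<Rightarrow> 'a) set \<Rightarrow> (nat \<Rightarrow> 'a) set \<Rightarrow>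
    (nat \<Rightarrow> 'a) set \<Rightarrow> (nat \<Rightarrow> 'a) set \<Rightarrow> (nat \<Rightarrow> 'a) set \<Rightarrow> bool" where
  "orth_split Q V U D W A \<longleftrightarrow> osum Q V D W \<and> U = ssum D (radical Q U) \<and> D \<inter> radical Q U = {0} \<and>
     witt_decomp Q W (Fq.dim (radical Q U)) (radical Q U) A \<and> radical Q D = {0} \<and> radical Q A = {0} \<and>
     {v \<in> V. \<forall>u\<in>U. polar Q v u = 0} = ssum A (radical Q U) \<and> A \<inter> radical Q U = {0}"

text \<open>Any complement \<open>D\<close> of the radical works: a vector in the radical of
  \<open>D\<close> is orthogonal to all of \<open>U\<close>, so it lies in the radical of
  \<open>U\<close> and vanishes. The radical of \<open>U\<close> is then a totally isotropic
  subspace of the non-degenerate \<open>W\<close>, where it finds its hyperbolic partners.\<close>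

lemma orth_split_exists:
  assumes V: "qspace Q V" "radical Q V = {0}" and U: "Fq.subspace U" "U \<subseteq> V"
  shows "\<exists>D W A. orth_split Q V U D W A"
proof -
  interpret qspace Q V by fact
  interpret U: qspace Q U using U by (simp add: qspace_subspace)
  define R where "R = radical Q U"
  have R: "Fq.subspace R" "R \<subseteq> U" "\<And>x u. x \<in> R \<Longrightarrow> u \<in> U \<Longrightarrow> polar Q x u = 0"
    using U.subspace_radical by (auto simp: R_def radical_def)
  have R': "polar Q u x = 0" if "x \<in> R" "u \<in> U" for x u
    using R(3)[OF that] by (simp add: polar_sym)
  obtain D where D: "Fq.subspace D" "D \<subseteq> U" "D \<inter> R = {0}" "ssum D R = U"
    using subspace_complement[OF U(1) R(1,2)] by blast
  have DV: "D \<subseteq> V" "R \<subseteq> V" using D R U by auto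
  have "x = 0" if x: "x \<in> radical Q D" for x
  proof -
    have xD: "x \<in> D" using x by (simp add: radical_def)
    have "polar Q x u = 0" if "u \<in> U" for u
    proof -
      obtain d r where "u = d + r" "d \<in> D" "r \<in> R" using \<open>u \<in> U\<close> D(4) by (auto simp: ssum_def)
      then show ?thesis
        using x xD DV D(2) R' by (auto simp: radical_def polar_add_right subset_iff)
    qed
    then have "x \<in> R" using xD D(2) by (auto simp: R_def radical_def)
    then show ?thesis using xD D(3) by blast
  qed
  moreover have "0 \<in> radical Q D" using Fq.subspace_0[OF D(1)] DV by (auto simp: radical_def)
  ultimately have radD: "radical Q D = {0}" by blast
  define W where "W = {v \<in> V. \<forall>a\<in>D. polar Q v a = 0}"
  have o: "osum Q V D W" unfolding W_def by (rule osum_orth[OF V(1) D(1) DV(1) radD])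
  have qW: "qspace Q W" using o osum_subset[OF o] by (intro qspace_subspace) (auto simp: osum_def)
  have radW: "radical Q W = {0}" using osum_nondegenerate_iff[OF V(1) o] V(2) by simp
  have RW: "R \<subseteq> W" using DV R D(2) by (auto simp: W_def)
  have "\<forall>x\<in>R. Q x = 0" using R by (metis U.polar_same subsetD)
  then obtain A where A: "witt_decomp Q W (Fq.dim R) R A"
    using witt_decomp_isotropic_exists[OF qW radW R(1) RW] by blast
  have radA: "radical Q A = {0}" using witt_decomp_nondegenerate[OF A qW] radW by simp
  have *: "{v \<in> W. \<forall>r\<in>R. polar Q v r = 0} = ssum R A" "R \<inter> A = {0}"
    using witt_decomp_orth[OF A qW] by auto
  have "{v \<in> V. \<forall>u\<in>U. polar Q v u = 0} = {v \<in> W. \<forall>r\<in>R. polar Q v r = 0}"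
  proof (intro equalityI subsetI)
    fix v assume "v \<in> {v \<in> V. \<forall>u\<in>U. polar Q v u = 0}"
    then show "v \<in> {v \<in> W. \<forall>r\<in>R. polar Q v r = 0}" using D(2) R(2) by (auto simp: W_def)
  next
    fix v assume v: "v \<in> {v \<in> W. \<forall>r\<in>R. polar Q v r = 0}"
    then have vV: "v \<in> V" by (simp add: W_def)
    have "polar Q v u = 0" if "u \<in> U" for u
    proof -
      obtain d r where "u = d + r" "d \<in> D" "r \<in> R" using \<open>u \<in> U\<close> D(4) by (auto simp: ssum_def)
      then show ?thesis using v vV DV by (auto simp: W_def polar_add_right subset_iff)
    qed
    then show "v \<in> {v \<in> V. \<forall>u\<in>U. polar Q v u = 0}" using vV by simp
  qed
  then have "{v \<in> V. \<forall>u\<in>U. polar Q v u = 0} = ssum A R" "A \<inter> R = {0}"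
    using * by (auto simp: ssum_commute[of A])
  then have "orth_split Q V U D W A"
    using o A radD radA D(3,4) by (simp add: orth_split_def R_def)
  then show ?thesis by blast
qed

text \<open>The last claim says that \<open>U\<close> and its perp have the same radical, so the
  type of the perp can be computed on \<open>A\<close>.\<close>

lemma orth_split_dim:
  assumes "qspace Q V" "Fq.subspace U" "U \<subseteq> V" "orth_split Q V U D W A"
  shows "qspace Q D" "qspace Q W" "qspace Q A" "D \<subseteq> V" "A \<subseteq> V"
    "Fq.dim U = Fq.dim D + Fq.dim (radical Q U)"
    "Fq.dim V = Fq.dim D + 2 * Fq.dim (radical Q U) + Fq.dim A"
    "radical Q (ssum A (radical Q U)) = radical Q U"
proof -
  interpret qspace Q V by fact
  interpret U: qspace Q U using assms by (simp add: qspace_subspace)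
  have o: "osum Q V D W" and w: "witt_decomp Q W (Fq.dim (radical Q U)) (radical Q U) A"
    using assms(4) by (auto simp: orth_split_def)
  show sub: "D \<subseteq> V" and qD: "qspace Q D" and qW: "qspace Q W"
    using o osum_subset[OF o] qspace_subspace by (auto simp: osum_def)
  show qA: "qspace Q A" by (rule witt_decomp_qspace[OF w qW])
  show AV: "A \<subseteq> V" using witt_decomp_subsets[OF w] osum_subset[OF o] by auto
  have R: "Fq.subspace (radical Q U)" "finite (radical Q U)" "radical Q U \<subseteq> U"
    using U.subspace_radical U.finite by (auto simp: radical_def)
  have "Fq.dim (ssum D (radical Q U)) = Fq.dim D + Fq.dim (radical Q U)"
    using assms(4) qspace.subspace[OF qD] qspace.finite[OF qD] R
    by (intro dim_ssum) (auto simp: orth_split_def)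
  moreover have "ssum D (radical Q U) = U" using assms(4) by (simp add: orth_split_def)
  ultimately show "Fq.dim U = Fq.dim D + Fq.dim (radical Q U)" by simp
  show "Fq.dim V = Fq.dim D + 2 * Fq.dim (radical Q U) + Fq.dim A"
    using osum_dim[OF assms(1) o] witt_decomp_dim[OF w qW] by simp
  have perp: "{v \<in> V. \<forall>u\<in>U. polar Q v u = 0} = ssum A (radical Q U)"
    using assms(4) by (simp add: orth_split_def)
  have AR: "polar Q a r = 0" "polar Q r a = 0" if "a \<in> A" "r \<in> radical Q U" for a r
  proof -
    have "a \<in> ssum A (radical Q U)" using ssum_superset1[OF R(1)] that by auto
    then show "polar Q a r = 0" using perp that R by auto
    then show "polar Q r a = 0" by (simp add: polar_sym)
  qed
  show "radical Q (ssum A (radical Q U)) = radical Q U"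
  proof (intro equalityI subsetI)
    fix x assume x: "x \<in> radical Q (ssum A (radical Q U))"
    then obtain a r where ar: "x = a + r" "a \<in> A" "r \<in> radical Q U"
      by (auto simp: radical_def ssum_def)
    have "polar Q a b = 0" if "b \<in> A" for b
    proof -
      have "b \<in> ssum A (radical Q U)" using ssum_superset1[OF R(1)] that by auto
      then have "polar Q x b = 0" using x by (simp add: radical_def)
      moreover have "a \<in> V" "r \<in> V" "b \<in> V" using ar AV R assms(3) that by auto
      ultimately show ?thesis using ar AR(2)[OF that ar(3)] by (simp add: polar_add)
    qed
    then have "a \<in> radical Q A" using ar by (simp add: radical_def)
    then have "a = 0" using assms(4) by (simp add: orth_split_def)
    then show "x \<in> radical Q U" using ar by simp
  next
    fix x assume x: "x \<in> radical Q U"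
    have xV: "x \<in> V" using x R assms(3) by auto
    have "polar Q x y = 0" if "y \<in> ssum A (radical Q U)" for y
    proof -
      obtain a r where ar: "y = a + r" "a \<in> A" "r \<in> radical Q U"
        using \<open>y \<in> ssum _ _\<close> by (auto simp: ssum_def)
      have "polar Q x r = 0" using x ar by (auto simp: radical_def)
      moreover have "a \<in> V" "r \<in> V" using ar AV R assms(3) by auto
      ultimately show ?thesis using ar AR(2)[OF ar(2) x] xV by (simp add: polar_add_right)
    qed
    moreover have "x \<in> ssum A (radical Q U)"
      using ssum_superset2[OF qspace.subspace[OF qA]] x by auto
    ultimately show "x \<in> radical Q (ssum A (radical Q U))" by (simp add: radical_def)
  qed
qed

lemma qspace_pullback:
  assumes "qspace Q V" "lin h" "Fq.subspace V'" "finite V'" "h ` V' \<subseteq> V"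
  shows "qspace (\<lambda>v. Q (h v)) V'"
proof -
  interpret qspace Q V by fact
  have p: "polar (\<lambda>v. Q (h v)) v w = polar Q (h v) (h w)" for v w
    by (simp add: polar_def lin_add[OF assms(2)])
  have h: "h v \<in> V" if "v \<in> V'" for v using assms(5) that by auto
  show ?thesis
    by unfold_locales
      (use assms(3,4) two h in \<open>auto simp: p lin_add[OF assms(2)] lin_scale[OF assms(2)] Q_scale polar_add polar_scale\<close>)
qed

text \<open>A complement of the radical is a model of the quotient. Every admissible
  \<open>p\<close> restricts to an isometry from \<open>D\<close> onto the coordinate space, and
  conversely coordinates on \<open>D\<close> give an admissible \<open>p\<close>.\<close>

lemma space_has_type_witt_type:
  fixes Q :: "(nat \<Rightarrow> 'a::{field,finite}) \<Rightarrow> 'a"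
  assumes U: "qspace Q U" and D: "Fq.subspace D" "U = ssum D (radical Q U)" "D \<inter> radical Q U = {0}"
  shows "space_has_type Q U e \<longleftrightarrow> witt_type Q D e"
proof -
  interpret qspace Q U by fact
  note R = subspace_radical
  have DU: "D \<subseteq> U" using ssum_superset1[OF R, of D] D(2) by simp
  have qD: "qspace Q D" using DU D(1) by (simp add: qspace_subspace)
  have dec: "\<exists>d r. v = d + r \<and> d \<in> D \<and> r \<in> radical Q U" if v: "v \<in> U" for v
  proof -
    have "v \<in> ssum D (radical Q U)" using v D(2) by simp
    then show ?thesis by (auto simp: ssum_def)
  qed
  have RU: "r \<in> U" if "r \<in> radical Q U" for r using that by (simp add: radical_def)
  show ?thesis
  proof
    assume "space_has_type Q U e"
    then obtain m p Q' where p: "lin p" "p ` U = coord_space m" "{v \<in> U. p v = 0} = radical Q U"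
      "\<forall>v\<in>U. Q' (p v) = Q v" "form_of_type m e Q'"
      unfolding space_has_type_def by blast
    have Q': "qspace Q' (coord_space m)" "witt_type Q' (coord_space m) e"
      using p(5) form_of_type_witt_type[OF two] by auto
    have "inj_on p D"
    proof (rule inj_onI)
      fix x y assume xy: "x \<in> D" "y \<in> D" "p x = p y"
      have "p (x - y) + p y = p x" using lin_add[OF p(1), of "x - y" y] by simp
      then have "p (x - y) = 0" using xy by simp
      moreover have "x - y \<in> U" using subsetD[OF DU xy(1)] subsetD[OF DU xy(2)] by simp
      ultimately have "x - y \<in> radical Q U" using p(3) by blast
      moreover have "x - y \<in> D" using xy D(1) Fq.subspace_diff by blast
      ultimately have "x - y = 0" using D(3) by blast
      then show "x = y" by simp
    qed
    moreover have "p ` D = coord_space m"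
    proof -
      have "p v \<in> p ` D" if v: "v \<in> U" for v
      proof -
        obtain d r where dr: "v = d + r" "d \<in> D" "r \<in> radical Q U" using dec[OF v] by blast
        have "p r = 0" using p(3) dr by blast
        then have "p v = p d" using dr by (simp add: lin_add[OF p(1)])
        then show ?thesis using dr by simp
      qed
      then have "p ` U \<subseteq> p ` D" by auto
      with image_mono[OF DU, of p] show ?thesis unfolding p(2) by simp
    qed
    ultimately have s: "sim 1 Q D Q' (coord_space m) p"
      using p(1,4) DU by (auto simp: sim_def)
    obtain h where h: "sim (1 / 1) Q' (coord_space m) Q D h"
      using sim_inverse[OF s D(1)] by auto
    then show "witt_type Q D e" using witt_type_sim[OF Q'(1) qD _ _ Q'(2)] by simp
  next
    assume t: "witt_type Q D e"
    define m where "m = Fq.dim D"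
    obtain g where g: "lin g" "inj_on g D" "g ` D = coord_space m"
      using subspace_isomorphism[OF D(1) qspace.finite[OF qD] subspace_coord_space finite_coord_space]
        dim_coord_space m_def by metis
    obtain h where h: "lin h" "\<forall>v\<in>D. h (g v) = v"
      using Fq2.linear_exists_left_inverse_on[OF g(1) D(1) g(2)] by blast
    \<comment> \<open>Coordinates on \<open>D\<close>, extended by zero on the radical so that the
      kernel is as required.\<close>
    obtain p where p: "lin p" "\<forall>d\<in>D. p d = g d" "\<forall>r\<in>radical Q U. p r = 0"
      using linear_glue[OF D(1) R D(3) g(1) Fq2.linear_zero] by blast
    define Q' where "Q' v = Q (h v)" for v
    have hD: "h ` coord_space m \<subseteq> D" unfolding g(3)[symmetric] using h(2) by auto
    have q': "qspace Q' (coord_space m)"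
      unfolding Q'_def
        by (rule qspace_pullback[OF qD h(1) subspace_coord_space finite_coord_space hD])
    have "sim 1 Q D Q' (coord_space m) g" using g h by (simp add: sim_def Q'_def)
    then have "witt_type Q' (coord_space m) e" using witt_type_sim[OF qD q' _ _ t] by simp
    then have form: "form_of_type m e Q'" using q' form_of_type_witt_type[OF two] by blast
    have pv: "p (d + r) = g d" if "d \<in> D" "r \<in> radical Q U" for d r
      using p that by (simp add: lin_add[OF p(1)])
    have im: "p ` U = coord_space m"
    proof (intro equalityI subsetI)
      fix x assume "x \<in> p ` U"
      then obtain v where v: "x = p v" "v \<in> U" by blast
      then show "x \<in> coord_space m" using dec[OF v(2)] pv g(3) by fastforce
    next
      fix x :: "nat \<Rightarrow> 'a" assume "x \<in> coord_space m"
      then obtain d where "d \<in> D" "x = g d" using g(3) by blast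
      then show "x \<in> p ` U" using p(2) DU by force
    qed
    have ker: "{v \<in> U. p v = 0} = radical Q U"
    proof (intro equalityI subsetI)
      fix v assume v: "v \<in> {v \<in> U. p v = 0}"
      then obtain d r where dr: "v = d + r" "d \<in> D" "r \<in> radical Q U" using dec by blast
      then have "g d = g 0" using v pv lin_zero[OF g(1)] by simp
      then have "d = 0" using g(2) dr Fq.subspace_0[OF D(1)] by (auto simp: inj_on_def)
      then show "v \<in> radical Q U" using dr by simp
    qed (use p(3) RU in auto)
    have "Q' (p v) = Q v" if v: "v \<in> U" for v
    proof -
      obtain d r where dr: "v = d + r" "d \<in> D" "r \<in> radical Q U" using dec[OF v] by blast
      have "polar Q r d = 0" using dr DU by (auto simp: radical_def)
      then have "polar Q d r = 0" by (simp add: polar_sym)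
      moreover have "Q r = 0"
      proof -
        have "polar Q r r = 0" using dr(3) by (auto simp: radical_def)
        then show ?thesis using RU[OF dr(3)] by simp
      qed
      ultimately have "Q v = Q d" using dr by (simp add: Q_add)
      then show ?thesis using pv[OF dr(2,3)] h(2) dr by (simp add: Q'_def)
    qed
    then show "space_has_type Q U e"
      unfolding space_has_type_def using p(1) im ker form by blast
  qed
qed

lemma space_has_type_orth_split:
  assumes "qspace Q V" "Fq.subspace U" "U \<subseteq> V" "orth_split Q V U D W A"
  shows "space_has_type Q U e \<longleftrightarrow> witt_type Q D e"
    "space_has_type Q {v \<in> V. \<forall>u\<in>U. polar Q v u = 0} e \<longleftrightarrow> witt_type Q A e"
proof -
  interpret qspace Q V by fact
  note os = orth_split_dim[OF assms]
  have U: "qspace Q U" using assms qspace_subspace by blast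
  have U_eq: "U = ssum D (radical Q U)" "D \<inter> radical Q U = {0}"
    and perp: "{v \<in> V. \<forall>u\<in>U. polar Q v u = 0} = ssum A (radical Q U)" "A \<inter> radical Q U = {0}"
    using assms(4) by (simp_all add: orth_split_def)
  show "space_has_type Q U e \<longleftrightarrow> witt_type Q D e"
    by (rule space_has_type_witt_type[OF U qspace.subspace[OF os(1)] U_eq])
  have R: "Fq.subspace (radical Q U)" "radical Q U \<subseteq> V"
    using qspace.subspace_radical[OF U] assms(3) by (auto simp: radical_def)
  have "qspace Q (ssum A (radical Q U))"
    using subspace_ssum[OF qspace.subspace[OF os(3)] R(1)] ssum_subset[OF subspace os(5) R(2)]
    by (rule qspace_subspace)
  then show "space_has_type Q {v \<in> V. \<forall>u\<in>U. polar Q v u = 0} e \<longleftrightarrow> witt_type Q A e"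
    unfolding perp(1)
    by (rule space_has_type_witt_type[OF _ qspace.subspace[OF os(3)]]) (simp_all add: os(8) perp(2))
qed

text \<open>Forms are only determined up to a common scalar, so subspaces with equal parameters are
  equivalent under similarities rather than isometries.\<close>

lemma has_params_transitive:
  fixes Q Q' :: "(nat \<Rightarrow> 'a::{field,finite}) \<Rightarrow> 'a"
  assumes two: "(2::'a) \<noteq> 0"
    and form: "form_of_type n e Q" "form_of_type n e Q'"
    and par: "has_params n Q (i, j, d, lo) U" "has_params n Q' (i, j, d, lo) U'"
    and lo: "lo = None \<longrightarrow> even (int n * (int j - int i))"
  shows "\<exists>c g. c \<noteq> 0 \<and> sim c Q (coord_space n) Q' (coord_space n) g \<and> g ` U = U'"
proof -
  let ?V = "coord_space n :: (nat \<Rightarrow> 'a) set"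
  have V: "qspace Q ?V" "qspace Q' ?V" and t: "witt_type Q ?V e" "witt_type Q' ?V e"
    using form form_of_type_witt_type[OF two] by auto
  have sing: "singular_space n Q i j d U" "singular_space n Q' i j d U'"
    using par by (cases lo; simp)+
  then have U: "Fq.subspace U" "U \<subseteq> ?V" "Fq.subspace U'" "U' \<subseteq> ?V"
    and dims: "Fq.dim U = j" "Fq.dim (radical Q U) = i" "Fq.dim U' = j" "Fq.dim (radical Q' U') = i"
    and ty: "space_has_type Q U d" "space_has_type Q' U' d"
    by (auto simp: singular_space_def)
  obtain D W A where s: "orth_split Q ?V U D W A"
    using orth_split_exists[OF V(1) witt_type_nondegenerate[OF V(1) t(1)] U(1,2)] by blast
  obtain D' W' A' where s': "orth_split Q' ?V U' D' W' A'"
    using orth_split_exists[OF V(2) witt_type_nondegenerate[OF V(2) t(2)] U(3,4)] by blast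
  note os = orth_split_dim[OF V(1) U(1,2) s] and os' = orth_split_dim[OF V(2) U(3,4) s']
  note ht = space_has_type_orth_split[OF V(1) U(1,2) s]
    and ht' = space_has_type_orth_split[OF V(2) U(3,4) s']
  have o: "osum Q ?V D W" "osum Q' ?V D' W'"
    and w: "witt_decomp Q W i (radical Q U) A" "witt_decomp Q' W' i (radical Q' U') A'"
    using s s' dims by (auto simp: orth_split_def)
  \<comment> \<open>\<open>A\<close> _|_ \<open>D\<close> is what remains of the whole space after
    removing \<open>i\<close> hyperbolic planes, so it inherits the type \<open>e\<close>.\<close>
  have k: "witt_decomp Q ?V i (radical Q U) (ssum A D)" "osum Q (ssum A D) A D"
    "witt_decomp Q' ?V i (radical Q' U') (ssum A' D')" "osum Q' (ssum A' D') A' D'"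
    using witt_decomp_osum[OF w(1) V(1) osum_commute[OF o(1)]]
      witt_decomp_osum[OF w(2) V(2) osum_commute[OF o(2)]]
    by auto
  have qK: "qspace Q (ssum A D)" "qspace Q' (ssum A' D')"
    using witt_decomp_qspace k V by blast+
  have tK: "witt_type Q (ssum A D) e" "witt_type Q' (ssum A' D') e"
  proof -
    have "radical Q (ssum A D) = {0}" "radical Q' (ssum A' D') = {0}"
      using witt_decomp_nondegenerate[OF k(1) V(1)] witt_decomp_nondegenerate[OF k(3) V(2)]
        witt_type_nondegenerate[OF V(1) t(1)] witt_type_nondegenerate[OF V(2) t(2)] by auto
    then obtain x x' where x: "witt_type Q (ssum A D) x" "witt_type Q' (ssum A' D') x'"
      using witt_type_exists qK by meson
    then have "x = e" "x' = e"
      using witt_type_unique[OF V(1) witt_type_witt_decomp[OF k(1)] t(1)]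
        witt_type_unique[OF V(2) witt_type_witt_decomp[OF k(3)] t(2)]
      by blast+
    then show "witt_type Q (ssum A D) e" "witt_type Q' (ssum A' D') e" using x by auto
  qed
  have dAD: "Fq.dim A = Fq.dim A'" "Fq.dim D = Fq.dim D'"
    using os(6,7) os'(6,7) dims by simp_all
  have tD: "witt_type Q D d" "witt_type Q' D' d" using ht(1) ht'(1) ty by auto
  \<comment> \<open>The only place where the perp type enters. These dimensions are
    \<open>n - 2 i\<close> and \<open>j - i\<close>, so \<open>n (j - i)\<close> is odd; then
    \<open>lo\<close> is not \<open>None\<close>, and \<open>the lo\<close> is the perp
    type.\<close>
  have "odd (Fq.dim (ssum A D)) \<Longrightarrow> odd (Fq.dim D) \<Longrightarrow> witt_type Q A (the lo) \<and> witt_type Q' A' (the lo)"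
  proof -
    assume odd: "odd (Fq.dim (ssum A D))" "odd (Fq.dim D)"
    have "n = 2 * i + Fq.dim (ssum A D)"
      using witt_decomp_dim[OF k(1) V(1)] by (simp add: dim_coord_space)
    moreover have "int j - int i = int (Fq.dim D)" using os(6) dims by simp
    ultimately have "odd (int n * (int j - int i))" using odd by simp
    then obtain l where l: "lo = Some l" using lo by (cases lo) auto
    then have "perp_type n Q U l" "perp_type n Q' U' l" using par by auto
    then show ?thesis using ht(2) ht'(2) l by (simp add: perp_type_def perp_def)
  qed
  then obtain c gA gD where g: "c \<noteq> 0" "sim c Q A Q' A' gA" "sim c Q D Q' D' gD"
    using osum_sim[OF qK k(2,4) dAD tK tD] by blast
  \<comment> \<open>Extends \<open>gA\<close> over the hyperbolic planes so that the radicals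
    correspond. Joined with \<open>gD\<close>, it carries \<open>U\<close>, the sum of
    \<open>D\<close> and its radical, to \<open>U'\<close>.\<close>
  obtain gW where gW: "sim c Q W Q' W' gW" "gW ` radical Q U = radical Q' U'"
    using witt_decomp_sim[OF w os(2) os'(2) g(1,2)] by blast
  have "gD ` D = D'" using g(3) by (simp add: sim_def)
  moreover have "radical Q U \<subseteq> W" using witt_decomp_subsets[OF w(1)] by blast
  ultimately obtain h where "sim c Q ?V Q' ?V h"
    "h ` ssum D (radical Q U) = ssum D' (radical Q' U')"
    using sim_osum_subspace[OF V o g(3) gW(1) _ gW(2) subset_refl] by blast
  moreover have "ssum D (radical Q U) = U" "ssum D' (radical Q' U') = U'"
    using s s' by (auto simp: orth_split_def)
  ultimately show ?thesis using g(1) by metis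
qed

section \<open>Counting\<close>

text \<open>The sum of all field elements is unchanged by the shift \<open>x + 1\<close>, so the
  order of the field is zero in the field. If 2 were zero, an odd order would give 1 = 0.\<close>

lemma two_neq_zero:
  assumes "odd CARD('a::{field,finite})"
  shows "(2::'a) \<noteq> 0"
proof
  assume two: "(2::'a) = 0"
  have "(\<Sum>x\<in>(UNIV::'a set). x) = (\<Sum>x\<in>(UNIV::'a set). x + 1)"
    by (rule sum.reindex_bij_witness[of _ "\<lambda>x. x + 1" "\<lambda>x. x - 1"]) auto
  then have "of_nat CARD('a) = (0::'a)" by (simp add: sum.distrib)
  moreover obtain k where "CARD('a) = 2 * k + 1" using assms oddE by blast
  ultimately show False using two by simp
qed

section \<open>Similarities preserve types and counts\<close>

lemma space_has_type_sim:
  assumes S: "qspace Q S" "qspace Q' S'" "sim c Q S Q' S' g" "c \<noteq> 0"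
  shows "space_has_type Q S e \<longleftrightarrow> space_has_type Q' S' e"
proof -
  \<comment> \<open>Stated for arbitrary spaces, so that the inverse similarity gives the converse.
    A complement of the radical is carried to a complement of the radical.\<close>
  have *: "space_has_type Q' S' e"
    if S: "qspace Q S" "qspace Q' S'" "sim c Q S Q' S' g" "c \<noteq> 0" and ty: "space_has_type Q S e"
    for Q Q' :: "(nat \<Rightarrow> 'a) \<Rightarrow> 'a" and S S' c g
  proof -
    interpret qspace Q S by fact
    define R where "R = radical Q S"
    have R: "Fq.subspace R" "R \<subseteq> S" using subspace_radical by (auto simp: R_def radical_def)
    obtain D where D: "Fq.subspace D" "D \<subseteq> S" "D \<inter> R = {0}" "ssum D R = S"
      using subspace_complement[OF subspace R] by blast
    have g: "lin g" "inj_on g S" "S' = g ` S" using S(3) by (auto simp: sim_def)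
    have R': "radical Q' S' = g ` R" unfolding R_def by (rule sim_radical[OF S(1,3,4)])
    have "g ` (D \<inter> R) = g ` D \<inter> g ` R" using g(2) D(2) R(2) by (rule inj_on_image_Int)
    then have int: "g ` D \<inter> g ` R = {0}" using D(3) lin_zero[OF g(1)] by simp
    have sum: "S' = ssum (g ` D) (g ` R)"
      using g(3) D(4) image_ssum[OF g(1)] by metis
    have q: "qspace Q D" using D qspace_subspace by blast
    have q': "qspace Q' (g ` D)"
      using qspace.qspace_subspace[OF S(2) subspace_image[OF g(1) D(1)]] g(3) D(2) by blast
    have "witt_type Q D e"
      using space_has_type_witt_type[OF S(1) D(1)] D(3,4) ty by (simp add: R_def)
    then have "witt_type Q' (g ` D) e"
      by (rule witt_type_sim[OF q q' sim_subspace[OF S(3) D(2)] S(4)])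
    then show ?thesis
      using space_has_type_witt_type[OF S(2) subspace_image[OF g(1) D(1)]] sum int
      unfolding R' by blast
  qed
  obtain h where "sim (1 / c) Q' S' Q S h"
    using sim_inverse[OF S(3) qspace.subspace[OF S(1)] S(4)] by blast
  then show ?thesis using *[OF S] *[OF S(2,1)] S(4) by auto
qed

text \<open>Domain and image may lie in different ambient spaces, as required for coordinates on a
  subspace \<open>T\<close> of \<open>coord_space n\<close>.\<close>

lemma singular_space_sim:
  assumes V: "qspace Q V" "qspace Q' V'" "V \<subseteq> coord_space n" "V' \<subseteq> coord_space n'"
    and s: "sim c Q V Q' V' g" "c \<noteq> 0" and S: "Fq.subspace S" "S \<subseteq> V"
  shows "singular_space n Q i j d S \<longleftrightarrow> singular_space n' Q' i j d (g ` S)"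
proof -
  have g: "lin g" "inj_on g V" "V' = g ` V" using s(1) by (auto simp: sim_def)
  have S': "Fq.subspace (g ` S)" "g ` S \<subseteq> V'" using subspace_image[OF g(1) S(1)] g(3) S(2) by auto
  have q: "qspace Q S" "qspace Q' (g ` S)"
    using qspace.qspace_subspace[OF V(1) S] qspace.qspace_subspace[OF V(2) S'] .
  have sS: "sim c Q S Q' (g ` S) g" by (rule sim_subspace[OF s(1) S(2)])
  have R: "radical Q' (g ` S) = g ` radical Q S" by (rule sim_radical[OF q(1) sS s(2)])
  have "radical Q S \<subseteq> V" "radical Q S \<subseteq> S" using S(2) by (auto simp: radical_def)
  then have "Fq.dim (g ` radical Q S) = Fq.dim (radical Q S)"
    using dim_image_inj[OF g(1) inj_on_subset[OF g(2)] qspace.subspace_radical[OF q(1)]]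
      finite_subset[OF _ qspace.finite[OF q(1)]] by blast
  moreover have "Fq.dim (g ` S) = Fq.dim S" using sim_dim[OF sS q(1)] .
  ultimately show ?thesis
    using S S' V(3,4) R space_has_type_sim[OF q sS s(2)] by (auto simp: singular_space_def)
qed

lemma sim_orth:
  assumes "sim c Q V Q' V' g" "Fq.subspace V" "c \<noteq> 0" "S \<subseteq> V" "U \<subseteq> V"
  shows "g ` {x \<in> S. \<forall>y\<in>U. polar Q x y = 0} = {x \<in> g ` S. \<forall>y\<in>g ` U. polar Q' x y = 0}"
proof -
  have "polar Q' (g x) (g y) = c * polar Q x y" if "x \<in> S" "y \<in> U" for x y
    using sim_polar[OF assms(1,2)] that assms(4,5) by blast
  then show ?thesis using assms(3) by auto
qed

lemma perp_Int: "S \<subseteq> coord_space n \<Longrightarrow> perp n Q U \<inter> S = {x \<in> S. \<forall>y\<in>U. polar Q x y = 0}"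
  by (auto simp: perp_def)

lemma space_has_type_orth_sim:
  assumes "qspace Q V" "qspace Q' V'" "sim c Q V Q' V' g" "c \<noteq> 0"
    and "Fq.subspace S" "S \<subseteq> V" "U \<subseteq> V"
  shows "space_has_type Q {x \<in> S. \<forall>y\<in>U. polar Q x y = 0} e \<longleftrightarrow>
    space_has_type Q' {x \<in> g ` S. \<forall>y\<in>g ` U. polar Q' x y = 0} e"
proof -
  interpret qspace Q V by fact
  let ?L = "{x \<in> S. \<forall>y\<in>U. polar Q x y = 0}"
  have "?L = S \<inter> {x \<in> V. \<forall>y\<in>U. polar Q x y = 0}" using assms(6) by blast
  then have L: "Fq.subspace ?L" "?L \<subseteq> V"
    using Fq.subspace_inter[OF assms(5) subspace_orth[OF assms(7)]] assms(6) by auto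
  have g: "lin g" "V' = g ` V" using assms(3) by (auto simp: sim_def)
  have "qspace Q' (g ` ?L)"
    using qspace.qspace_subspace[OF assms(2) subspace_image[OF g(1) L(1)]] g(2) L(2) by blast
  from space_has_type_sim[OF qspace_subspace[OF L] this sim_subspace[OF assms(3) L(2)] assms(4)]
  show ?thesis unfolding sim_orth[OF assms(3) subspace assms(4,6,7)] .
qed

text \<open>Taking images matches the two families; a subspace of \<open>V'\<close> is reached from
  its preimage within \<open>V\<close>.\<close>

lemma card_subspaces_sim:
  assumes g: "sim c Q V Q' V' g" and V: "Fq.subspace V"
    and P: "\<And>S. P S \<Longrightarrow> Fq.subspace S \<and> S \<subseteq> V" and P': "\<And>S. P' S \<Longrightarrow> Fq.subspace S \<and> S \<subseteq> V'"
    and eq: "\<And>S. Fq.subspace S \<Longrightarrow> S \<subseteq> V \<Longrightarrow> P S \<longleftrightarrow> P' (g ` S)"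
  shows "card {S. P S} = card {S. P' S}"
proof -
  have lin: "lin g" and inj: "inj_on g V" and im: "g ` V = V'" using g by (auto simp: sim_def)
  have "inj_on (image g) {S. P S}"
    using inj_on_image_Pow[OF inj] P by (auto intro: inj_on_subset)
  moreover have "image g ` {S. P S} = {S. P' S}"
  proof (intro equalityI subsetI)
    fix T assume "T \<in> {S. P' S}"
    then have T: "P' T" "Fq.subspace T" "T \<subseteq> V'" using P' by auto
    define S where "S = V \<inter> {v. g v \<in> T}"
    have "Fq.subspace {v. g v \<in> T}"
      using T(2) by (auto simp: Fq.subspace_def lin_add[OF lin] lin_scale[OF lin] lin_zero[OF lin])
    then have S: "Fq.subspace S" "S \<subseteq> V" unfolding S_def using V Fq.subspace_inter by auto
    have "g ` S = T" using T(3) im by (auto simp: S_def)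
    then show "T \<in> image g ` {S. P S}" using eq[OF S] T(1) by blast
  qed (use eq P in blast)
  ultimately have "bij_betw (image g) {S. P S} {S. P' S}" by (simp add: bij_betw_def)
  then show ?thesis by (rule bij_betw_same_card)
qed

definition gamma_spaces ::
  "nat \<Rightarrow> ((nat \<Rightarrow> 'a::field) \<Rightarrow> 'a) \<Rightarrow> nat \<Rightarrow> int \<Rightarrow> nat \<Rightarrow> int \<Rightarrow> (nat \<Rightarrow> 'a) set \<Rightarrow> (nat \<Rightarrow> 'a) set set" where
  "gamma_spaces n Q k z j h U = {S. singular_space n Q 0 k z S \<and> S \<inter> U = {0} \<and>
     singular_space n Q 0 (k + j) h (Fq.span (U \<union> S))}"

text \<open>Restricting the span to \<open>V\<close> makes this serve twice: with the full space as
  \<open>V\<close> it gives the invariance of the count, and with a non-singular \<open>T\<close> as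
  \<open>V\<close> it transfers the contribution of \<open>T\<close> to coordinates.\<close>

lemma card_gamma_spaces_sim:
  assumes V: "qspace Q V" "qspace Q' V'" "V \<subseteq> coord_space n" "V' = coord_space n'"
    and s: "sim c Q V Q' V' g" "c \<noteq> 0" and U: "Fq.subspace U" "U \<subseteq> V"
  shows "card {S \<in> gamma_spaces n Q k z j h U. Fq.span (U \<union> S) \<subseteq> V} =
    card (gamma_spaces n' Q' k z j h (g ` U))"
proof -
  have lin: "lin g" and inj: "inj_on g V" and im: "g ` V = V'" using s by (auto simp: sim_def)
  note sV = qspace.subspace[OF V(1)]
  have "card {S. S \<in> gamma_spaces n Q k z j h U \<and> Fq.span (U \<union> S) \<subseteq> V} =
    card {S. S \<in> gamma_spaces n' Q' k z j h (g ` U)}"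
  proof (rule card_subspaces_sim[OF s(1) sV])
    fix S assume "S \<in> gamma_spaces n Q k z j h U \<and> Fq.span (U \<union> S) \<subseteq> V"
    then show "Fq.subspace S \<and> S \<subseteq> V"
      using Fq.span_superset[of "U \<union> S"] by (auto simp: gamma_spaces_def singular_space_def)
  next
    fix S assume "S \<in> gamma_spaces n' Q' k z j h (g ` U)"
    then show "Fq.subspace S \<and> S \<subseteq> V'" by (simp add: gamma_spaces_def singular_space_def V(4))
  next
    fix S assume S: "Fq.subspace S" "S \<subseteq> V"
    have span: "Fq.span (U \<union> S) \<subseteq> V" using U S sV by (intro Fq.span_minimal) auto
    have "Fq.span (g ` U \<union> g ` S) = g ` Fq.span (U \<union> S)"
      using Fq2.linear_span_image[OF lin, of "U \<union> S"] by (simp add: image_Un)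
    moreover have "g ` S \<inter> g ` U = {0} \<longleftrightarrow> S \<inter> U = {0}"
    proof -
      have "g ` S \<inter> g ` U = g ` (S \<inter> U)" using inj_on_image_Int[OF inj S(2) U(2)] by simp
      moreover have "g ` (S \<inter> U) = g ` {0} \<longleftrightarrow> S \<inter> U = {0}"
        using inj_on_image_eq_iff[OF inj, of "S \<inter> U" "{0}"] S Fq.subspace_0[OF sV] by auto
      ultimately show ?thesis using lin_zero[OF lin] by simp
    qed
    ultimately show "S \<in> gamma_spaces n Q k z j h U \<and> Fq.span (U \<union> S) \<subseteq> V \<longleftrightarrow>
      g ` S \<in> gamma_spaces n' Q' k z j h (g ` U)"
      using singular_space_sim[OF V(1-3) _ s, of n'] S span V(4)
      by (simp add: gamma_spaces_def)
  qed
  then show ?thesis by simp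
qed

lemma gamma_spaces_span:
  "S \<in> gamma_spaces n Q k z j h U \<Longrightarrow> Fq.span (U \<union> S) \<subseteq> coord_space n"
  by (simp add: gamma_spaces_def singular_space_def)

text \<open>Any admissible pair is the image of the given one under a similarity. A count that
  similarities preserve therefore has a common value, and the given pair determines it.\<close>

lemma common_count_eq:
  fixes Q :: "(nat \<Rightarrow> 'a::{field,finite}) \<Rightarrow> 'a"
  assumes two: "(2::'a) \<noteq> 0"
    and form: "form_of_type n e Q" and par: "has_params n Q (i, j, d, lo) U"
    and lo: "lo = None \<longrightarrow> even (int n * (int j - int i))"
    and inv: "\<And>Q Q' U c g. qspace Q (coord_space n) \<Longrightarrow> qspace Q' (coord_space n) \<Longrightarrow> c \<noteq> 0 \<Longrightarrow>
      sim c Q (coord_space n) Q' (coord_space n) g \<Longrightarrow> Fq.subspace U \<Longrightarrow> U \<subseteq> coord_space n \<Longrightarrow>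
      count Q U = count Q' (g ` U)"
  shows "common_count (i, j, d, lo) (n, e) count = count Q U"
proof -
  have q: "qspace Q (coord_space n)" if "form_of_type n e Q" for Q :: "(nat \<Rightarrow> 'a) \<Rightarrow> 'a"
    using that form_of_type_witt_type[OF two] by blast
  have main: "count Q' U' = count Q U" if *: "form_of_type n e Q'"
    "has_params n Q' (i, j, d, lo) U'" for Q' U'
  proof -
    obtain c g where "c \<noteq> 0" "sim c Q (coord_space n) Q' (coord_space n) g" "g ` U = U'"
      using has_params_transitive[OF two form *(1) par *(2) lo] by blast
    moreover have "Fq.subspace U" "U \<subseteq> coord_space n"
      using par by (cases lo; simp add: singular_space_def)+
    ultimately show ?thesis using inv[OF q[OF form] q[OF *(1)]] by metis
  qed
  show ?thesis
    unfolding common_count_def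
  proof (rule the_equality)
    show "\<forall>Q' U'. form_of_type (fst (n, e)) (snd (n, e)) Q' \<and>
      has_params (fst (n, e)) Q' (i, j, d, lo) U' \<longrightarrow> count Q' U' = count Q U"
      using main by simp
  next
    fix x
    assume "\<forall>Q' U'. form_of_type (fst (n, e)) (snd (n, e)) Q' \<and>
      has_params (fst (n, e)) Q' (i, j, d, lo) U' \<longrightarrow> count Q' U' = x"
    then show "x = count Q U" using form par by simp
  qed
qed

section \<open>The numbers beta and gamma evaluated at one pair\<close>

context
  fixes n i j :: nat and e d :: int and lo :: "int option"
    and Q :: "(nat \<Rightarrow> 'a::{field,finite}) \<Rightarrow> 'a" and U :: "(nat \<Rightarrow> 'a) set"
  assumes two: "(2::'a) \<noteq> 0"
    and form: "form_of_type n e Q" and par: "has_params n Q (i, j, d, lo) U"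
    and lo: "lo = None \<longrightarrow> even (int n * (int j - int i))"
begin

lemma gamma_eq: "gamma TYPE('a) (i, j, d, lo) (n, e) (k, z) h = card (gamma_spaces n Q k z j h U)"
proof -
  have "common_count (i, j, d, lo) (n, e)
      (\<lambda>(Q :: (nat \<Rightarrow> 'a) \<Rightarrow> 'a) U. card (gamma_spaces n Q k z j h U)) =
    card (gamma_spaces n Q k z j h U)"
  proof (rule common_count_eq[OF two form par lo])
    fix Q Q' :: "(nat \<Rightarrow> 'a) \<Rightarrow> 'a" and U :: "(nat \<Rightarrow> 'a) set" and c g
    assume *: "qspace Q (coord_space n)" "qspace Q' (coord_space n)" "c \<noteq> 0"
      "sim c Q (coord_space n) Q' (coord_space n) g" "Fq.subspace U" "U \<subseteq> coord_space n"
    have eq: "{S \<in> gamma_spaces n Q k z j h U. Fq.span (U \<union> S) \<subseteq> coord_space n} =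
        gamma_spaces n Q k z j h U"
      using gamma_spaces_span by blast
    then show "card (gamma_spaces n Q k z j h U) = card (gamma_spaces n Q' k z j h (g ` U))"
      using card_gamma_spaces_sim[OF *(1,2) subset_refl refl *(4,3,5,6), of k z j h, unfolded eq]
      by blast
  qed
  then show ?thesis by (simp add: gamma_spaces_def)
qed

lemma beta_eq:
  "beta TYPE('a) (i, j, d, lo) (n, e) (k, z) = card {S. singular_space n Q 0 k z S \<and> U \<subseteq> S}"
  unfolding beta.simps
proof (rule common_count_eq[OF two form par lo])
  fix Q Q' :: "(nat \<Rightarrow> 'a) \<Rightarrow> 'a" and U :: "(nat \<Rightarrow> 'a) set" and c g
  assume *: "qspace Q (coord_space n)" "qspace Q' (coord_space n)" "c \<noteq> 0"
    "sim c Q (coord_space n) Q' (coord_space n) g" "Fq.subspace U" "U \<subseteq> coord_space n"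
  have inj: "inj_on g (coord_space n)" using *(4) by (simp add: sim_def)
  show "card {S. singular_space n Q 0 k z S \<and> U \<subseteq> S} =
    card {S. singular_space n Q' 0 k z S \<and> g ` U \<subseteq> S}"
  proof (rule card_subspaces_sim[OF *(4) subspace_coord_space])
    fix S :: "(nat \<Rightarrow> 'a) set" assume S: "Fq.subspace S" "S \<subseteq> coord_space n"
    have "g ` U \<subseteq> g ` S \<longleftrightarrow> U \<subseteq> S" 
      using inj_on_image_mem_iff[OF inj _ S(2)] *(6) unfolding image_subset_iff by blast
    then show "singular_space n Q 0 k z S \<and> U \<subseteq> S \<longleftrightarrow> singular_space n Q' 0 k z (g ` S) \<and> g ` U \<subseteq> g ` S"
      using singular_space_sim[OF *(1,2) subset_refl subset_refl *(4,3) S] by simp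
  qed (simp_all add: singular_space_def)
qed

lemma beta_perp_eq:
  "beta_perp TYPE('a) v (i, j, d, lo) (n, e) (k, z) =
    card {S. singular_space n Q 0 k z S \<and> U \<subseteq> S \<and> perp_type_in n Q S U v}"
  unfolding beta_perp.simps
proof (rule common_count_eq[OF two form par lo])
  fix Q Q' :: "(nat \<Rightarrow> 'a) \<Rightarrow> 'a" and U :: "(nat \<Rightarrow> 'a) set" and c g
  assume *: "qspace Q (coord_space n)" "qspace Q' (coord_space n)" "c \<noteq> 0"
    "sim c Q (coord_space n) Q' (coord_space n) g" "Fq.subspace U" "U \<subseteq> coord_space n"
  have inj: "inj_on g (coord_space n)" and im: "g ` coord_space n = coord_space n"
    using *(4) by (auto simp: sim_def)
  show "card {S. singular_space n Q 0 k z S \<and> U \<subseteq> S \<and> perp_type_in n Q S U v} =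
    card {S. singular_space n Q' 0 k z S \<and> g ` U \<subseteq> S \<and> perp_type_in n Q' S (g ` U) v}"
  proof (rule card_subspaces_sim[OF *(4) subspace_coord_space])
    fix S :: "(nat \<Rightarrow> 'a) set" assume S: "Fq.subspace S" "S \<subseteq> coord_space n"
    have "g ` U \<subseteq> g ` S \<longleftrightarrow> U \<subseteq> S" 
      using inj_on_image_mem_iff[OF inj _ S(2)] *(6) unfolding image_subset_iff by blast
    moreover have "perp_type_in n Q S U v \<longleftrightarrow> perp_type_in n Q' (g ` S) (g ` U) v"
    proof -
      have "g ` S \<subseteq> coord_space n" using im S(2) by blast
      then show ?thesis
        using space_has_type_orth_sim[OF *(1,2,4,3) S *(6)] S(2)
        by (simp add: perp_type_in_def perp_Int)
    qed
    ultimately show "singular_space n Q 0 k z S \<and> U \<subseteq> S \<and> perp_type_in n Q S U v \<longleftrightarrow>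
      singular_space n Q' 0 k z (g ` S) \<and> g ` U \<subseteq> g ` S \<and> perp_type_in n Q' (g ` S) (g ` U) v"
      using singular_space_sim[OF *(1,2) subset_refl subset_refl *(4,3) S] by simp
  qed (simp_all add: singular_space_def)
qed

end

text \<open>With a zero radical the quotient map witnessing the type is injective, hence an isometry
  onto a coordinate space, whose dimension must then be \<open>m\<close>.\<close>

lemma nonsingular_space_coordinates:
  fixes Q :: "(nat \<Rightarrow> 'a::{field,finite}) \<Rightarrow> 'a"
  assumes "qspace Q (coord_space n)" "singular_space n Q 0 m h T"
  shows "qspace Q T" "radical Q T = {0}"
    "\<exists>p Q'. sim 1 Q T Q' (coord_space m) p \<and> form_of_type m h Q' \<and> qspace Q' (coord_space m)"
proof -
  interpret qspace Q "coord_space n" by fact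
  have T: "Fq.subspace T" "T \<subseteq> coord_space n" "Fq.dim T = m" "Fq.dim (radical Q T) = 0"
    "space_has_type Q T h"
    using assms(2) by (auto simp: singular_space_def)
  show q: "qspace Q T" using T qspace_subspace by blast
  have "finite (radical Q T)" using qspace.finite[OF q] by (auto simp: radical_def)
  then show rad: "radical Q T = {0}"
    using T(4) dim_0_iff[OF qspace.subspace_radical[OF q]] by simp
  obtain m' p Q' where p: "lin p" "p ` T = coord_space m'" "{v \<in> T. p v = 0} = radical Q T"
    "\<forall>v\<in>T. Q' (p v) = Q v" "form_of_type m' h Q'"
    using T(5) unfolding space_has_type_def by blast
  have "inj_on p T"
  proof (rule inj_onI)
    fix x y assume xy: "x \<in> T" "y \<in> T" "p x = p y"
    have "p (x - y) + p y = p x" using lin_add[OF p(1), of "x - y" y] by simp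
    moreover have "x - y \<in> T" using xy T(1) Fq.subspace_diff by blast
    ultimately have "x - y \<in> {v \<in> T. p v = 0}" using xy by simp
    then show "x = y" using p(3) rad by simp
  qed
  then have s: "sim 1 Q T Q' (coord_space m') p" using p by (simp add: sim_def)
  then have "m' = m" using sim_dim[OF s q] T(3) by (simp add: dim_coord_space)
  then show "\<exists>p Q'. sim 1 Q T Q' (coord_space m) p \<and> form_of_type m h Q' \<and> qspace Q' (coord_space m)"
    using s p(5) form_of_type_witt_type[OF two] by blast
qed

lemma card_gamma_spaces_fibres:
  fixes Q :: "(nat \<Rightarrow> 'a::{field,finite}) \<Rightarrow> 'a"
  assumes "qspace Q (coord_space n)" "U \<subseteq> coord_space n"
  shows "card (gamma_spaces n Q k z j h U) =
    (\<Sum>T | singular_space n Q 0 (k + j) h T \<and> U \<subseteq> T.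
       card {S \<in> gamma_spaces n Q k z j h U. Fq.span (U \<union> S) \<subseteq> T})"
proof -
  let ?G = "gamma_spaces n Q k z j h U" and ?T = "{T. singular_space n Q 0 (k + j) h T \<and> U \<subseteq> T}"
  have "?G \<subseteq> Pow (coord_space n)" "?T \<subseteq> Pow (coord_space n)"
    by (auto simp: gamma_spaces_def singular_space_def)
  then have fin: "finite ?G" "finite ?T"
    by (simp_all add: finite_subset finite_coord_space)
  have span: "(\<lambda>S. Fq.span (U \<union> S)) ` ?G \<subseteq> ?T"
    using Fq.span_superset by (fastforce simp: gamma_spaces_def)
  have "(\<Sum>T\<in>?T. \<Sum>S | S \<in> ?G \<and> Fq.span (U \<union> S) = T. 1) = (\<Sum>S\<in>?G. 1 :: nat)"
    by (rule sum.group[OF fin span])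
  then have "card ?G = (\<Sum>T\<in>?T. card {S \<in> ?G. Fq.span (U \<union> S) = T})" by simp
  \<comment> \<open>Span and \<open>T\<close> both have dimension \<open>k + j\<close>, so
    containment already means equality. Containment is the form in which coordinates on
    \<open>T\<close> apply.\<close>
  also have "\<dots> = (\<Sum>T\<in>?T. card {S \<in> ?G. Fq.span (U \<union> S) \<subseteq> T})"
  proof (rule sum.cong[OF refl])
    fix T assume T: "T \<in> ?T"
    have "Fq.span (U \<union> S) = T" if "S \<in> ?G" "Fq.span (U \<union> S) \<subseteq> T" for S
    proof (rule subspace_eq_if_dim)
      show "Fq.subspace T" "finite T"
        using T finite_coord_space by (auto simp: singular_space_def intro: finite_subset)
      show "Fq.dim (Fq.span (U \<union> S)) = Fq.dim T"
        using T that(1) by (simp add: gamma_spaces_def singular_space_def)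
    qed (use that in auto)
    then have "{S \<in> ?G. Fq.span (U \<union> S) = T} = {S \<in> ?G. Fq.span (U \<union> S) \<subseteq> T}" by blast
    then show "card {S \<in> ?G. Fq.span (U \<union> S) = T} = card {S \<in> ?G. Fq.span (U \<union> S) \<subseteq> T}" by simp
  qed
  finally show ?thesis .
qed

text \<open>\<open>lo'\<close> concerns the position of \<open>U\<close> inside \<open>T\<close>,
  not in the whole space: coordinates on \<open>T\<close> turn the perp type of \<open>U\<close> in
  \<open>T\<close> into an ordinary perp type.\<close>

lemma card_gamma_spaces_fibre:
  fixes Q :: "(nat \<Rightarrow> 'a::{field,finite}) \<Rightarrow> 'a"
  assumes q: "qspace Q (coord_space n)" and U: "singular_space n Q i j d U" "U \<subseteq> T"
    and T: "singular_space n Q 0 (k + j) h T"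
    and lo': "lo' = None \<longrightarrow> even (int (k + j) * (int j - int i))"
      "\<And>v. lo' = Some v \<Longrightarrow> perp_type_in n Q T U v"
  shows "card {S \<in> gamma_spaces n Q k z j h U. Fq.span (U \<union> S) \<subseteq> T} =
    gamma TYPE('a) (i, j, d, lo') (k + j, h) (k, z) h"
proof -
  note T' = nonsingular_space_coordinates[OF q T]
  obtain p Q' where p: "sim 1 Q T Q' (coord_space (k + j)) p" "form_of_type (k + j) h Q'"
    "qspace Q' (coord_space (k + j))"
    using T'(3) by blast
  have two: "(2::'a) \<noteq> 0" using q by (rule qspace.two)
  have Tn: "T \<subseteq> coord_space n" and Us: "Fq.subspace U"
    using T U by (auto simp: singular_space_def)
  have sing: "singular_space (k + j) Q' i j d (p ` U)"
    using singular_space_sim[OF T'(1) p(3) Tn subset_refl p(1) _ Us U(2), of i j d] U(1) by simp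
  have "perp_type (k + j) Q' (p ` U) v" if "lo' = Some v" for v
  proof -
    have im: "p ` T = coord_space (k + j)" using p(1) by (simp add: sim_def)
    have "space_has_type Q {x \<in> T. \<forall>y\<in>U. polar Q x y = 0} v"
      using lo'(2)[OF that] Tn by (simp add: perp_type_in_def perp_Int)
    then show ?thesis
      using space_has_type_orth_sim[OF T'(1) p(3,1) _ qspace.subspace[OF T'(1)] subset_refl U(2), of v]
      by (simp add: perp_type_def perp_def im)
  qed
  then have par: "has_params (k + j) Q' (i, j, d, lo') (p ` U)" using sing by (cases lo') auto
  show ?thesis
    unfolding gamma_eq[OF two p(2) par lo'(1)]
    by (rule card_gamma_spaces_sim[OF T'(1) p(3) Tn refl p(1) _ Us U(2)]) simp
qed

text \<open>The dimension of \<open>T\<close> is \<open>dim D + 2 i + dim A\<close> with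
  \<open>dim D = j - i\<close>. As \<open>T\<close> and \<open>D\<close> have odd dimension,
  \<open>A\<close> has even dimension, so its unique type is 1 or -1.\<close>

lemma perp_type_in_cases:
  fixes Q :: "(nat \<Rightarrow> 'a::{field,finite}) \<Rightarrow> 'a"
  assumes q: "qspace Q (coord_space n)" and U: "singular_space n Q i j d U" "U \<subseteq> T"
    and T: "singular_space n Q 0 (k + j) h T" and odd: "odd (k + j)" "odd (int j - int i)"
  shows "perp_type_in n Q T U 1 \<longleftrightarrow> \<not> perp_type_in n Q T U (- 1)"
proof -
  note T' = nonsingular_space_coordinates[OF q T]
  have Tn: "T \<subseteq> coord_space n" "Fq.dim T = k + j" and Us: "Fq.subspace U"
    and dims: "Fq.dim U = j" "Fq.dim (radical Q U) = i"
    using T U by (auto simp: singular_space_def)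
  obtain D W A where s: "orth_split Q T U D W A" using orth_split_exists[OF T'(1,2) Us U(2)] by blast
  note os = orth_split_dim[OF T'(1) Us U(2) s]
  have pt: "perp_type_in n Q T U v \<longleftrightarrow> witt_type Q A v" for v
    using space_has_type_orth_split(2)[OF T'(1) Us U(2) s] Tn(1)
      by (simp add: perp_type_in_def perp_Int)
  obtain v where v: "witt_type Q A v" using witt_type_exists[OF os(3)] s
    by (auto simp: orth_split_def)
  have "int j - int i = int (Fq.dim D)" using os(6) dims by simp
  then have "even (Fq.dim A)" using os(7) Tn(2) dims odd by simp
  then have "v \<in> {1, -1}" using witt_type_parity[OF os(3) v] by auto
  moreover have "witt_type Q A w \<longleftrightarrow> w = v" for w using witt_type_unique[OF os(3) v] v by blast
  ultimately show ?thesis unfolding pt by auto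
qed

theorem theorem4p22:
  fixes n j i k :: nat and \<delta> \<epsilon> \<zeta> \<eta> l :: int and lo :: "int option"
    and Q :: "(nat \<Rightarrow> 'a::{field,finite}) \<Rightarrow> 'a" and U :: "(nat \<Rightarrow> 'a) set"
  assumes "odd CARD('a)"
    and "i \<le> j" and "int i \<le> int n - int j" and "int k \<le> int n - int j"
    and "\<delta> \<in> {0, 1, -1}" and "\<epsilon> \<in> {0, 1, -1}" and "\<zeta> \<in> {0, 1, -1}" and "\<eta> \<in> {0, 1, -1}"
    and "l \<in> {1, -1}"
    and "odd (int j - int i - \<delta>)" and "odd (int n - \<epsilon>)" and "odd (int k - \<zeta>)"
    and "odd (int (k + j) - \<eta>)"
    and "lo = (if odd (int n * (int j - int i)) then Some l else None)"
    and "form_of_type n \<epsilon> Q" and "has_params n Q (i, j, \<delta>, lo) U"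
  shows "(even (k + j) \<or> even (int j - int i) \<longrightarrow>
            gamma TYPE('a) (i, j, \<delta>, lo) (n, \<epsilon>) (k, \<zeta>) \<eta> =
              beta TYPE('a) (i, j, \<delta>, lo) (n, \<epsilon>) (k + j, \<eta>) *
              gamma TYPE('a) (i, j, \<delta>, None) (k + j, \<eta>) (k, \<zeta>) \<eta>) \<and>
         (odd (k + j) \<and> odd (int j - int i) \<longrightarrow>
            gamma TYPE('a) (i, j, 0, lo) (n, \<epsilon>) (k, \<zeta>) 0 =
              (\<Sum>\<nu>\<in>{1, -1}. beta_perp TYPE('a) \<nu> (i, j, 0, lo) (n, \<epsilon>) (k + j, 0) *
                 gamma TYPE('a) (i, j, 0, Some \<nu>) (k + j, 0) (k, \<zeta>) 0))"
proof (intro conjI impI)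
  have two: "(2::'a) \<noteq> 0" using assms(1) by (rule two_neq_zero)
  note form = assms(15) and par = assms(16)
  have lo: "lo = None \<longrightarrow> even (int n * (int j - int i))" using assms(14) by (auto split: if_splits)
  have q: "qspace Q (coord_space n)" using form form_of_type_witt_type[OF two] by blast
  have U: "singular_space n Q i j \<delta> U" using par by (cases lo) auto
  then have Un: "U \<subseteq> coord_space n" by (simp add: singular_space_def)
  note count = two form par lo
  {
    assume even: "even (k + j) \<or> even (int j - int i)"
    let ?g = "gamma TYPE('a) (i, j, \<delta>, None) (k + j, \<eta>) (k, \<zeta>) \<eta>"
    \<comment> \<open>Evenness of \<open>(k + j) (j - i)\<close> allows the parameter
      \<open>None\<close> in every \<open>T\<close>, so all fibres have the same size.\<close>
    have "card {S \<in> gamma_spaces n Q k \<zeta> j \<eta> U. Fq.span (U \<union> S) \<subseteq> T} = ?g"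
      if "singular_space n Q 0 (k + j) \<eta> T \<and> U \<subseteq> T" for T
      using that even by (intro card_gamma_spaces_fibre[OF q U]) auto
    \<comment> \<open>If there is no such \<open>T\<close>, the first factor is 0 and an unspecified
      value of \<open>?g\<close> does no harm.\<close>
    then have "card (gamma_spaces n Q k \<zeta> j \<eta> U) =
        card {T. singular_space n Q 0 (k + j) \<eta> T \<and> U \<subseteq> T} * ?g"
      unfolding card_gamma_spaces_fibres[OF q Un] by simp
    then show "gamma TYPE('a) (i, j, \<delta>, lo) (n, \<epsilon>) (k, \<zeta>) \<eta> =
        beta TYPE('a) (i, j, \<delta>, lo) (n, \<epsilon>) (k + j, \<eta>) * ?g"
      unfolding gamma_eq[OF count] beta_eq[OF count] .
  next
    assume "odd (k + j) \<and> odd (int j - int i)"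
    then have odd: "odd (k + j)" "odd (int j - int i)" by auto
    \<comment> \<open>With \<open>j - i\<close> odd, \<delta> is even.\<close>
    then have "\<delta> = 0" using assms(5,10) by auto
    note U = U[unfolded this] and count = count[unfolded this]
    let ?g = "\<lambda>\<nu>. gamma TYPE('a) (i, j, 0, Some \<nu>) (k + j, 0) (k, \<zeta>) 0"
    let ?T = "{T. singular_space n Q 0 (k + j) 0 T \<and> U \<subseteq> T}"
    let ?P = "\<lambda>\<nu>. {T. singular_space n Q 0 (k + j) 0 T \<and> U \<subseteq> T \<and> perp_type_in n Q T U \<nu>}"
    let ?c = "\<lambda>T. card {S \<in> gamma_spaces n Q k \<zeta> j 0 U. Fq.span (U \<union> S) \<subseteq> T}"
    have fibre: "?c T = ?g \<nu>" if "T \<in> ?P \<nu>" for T \<nu>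
      using that by (intro card_gamma_spaces_fibre[OF q U]) auto
    \<comment> \<open>The perp type of \<open>U\<close> in \<open>T\<close> is exactly one of 1 and
      -1, so it partitions the spaces \<open>T\<close> into two classes with constant fibre
      size.\<close>
    have split: "?T = ?P 1 \<union> ?P (- 1)" "?P 1 \<inter> ?P (- 1) = {}"
      using perp_type_in_cases[OF q U _ _ odd] by blast+
    have "?T \<subseteq> Pow (coord_space n)" by (auto simp: singular_space_def)
    then have "finite ?T" by (rule finite_subset) (simp add: finite_coord_space)
    then have fin: "finite (?P 1)" "finite (?P (- 1))" by (auto intro: finite_subset[of _ ?T])
    have "card (gamma_spaces n Q k \<zeta> j 0 U) = (\<Sum>T\<in>?P 1. ?c T) + (\<Sum>T\<in>?P (- 1). ?c T)"
      unfolding card_gamma_spaces_fibres[OF q Un] split(1)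
      by (rule sum.union_disjoint[OF fin split(2)])
    also have "\<dots> = (\<Sum>T\<in>?P 1. ?g 1) + (\<Sum>T\<in>?P (- 1). ?g (- 1))"
      using fibre by (intro arg_cong2[where f = "(+)"] sum.cong refl) blast+
    finally show "gamma TYPE('a) (i, j, 0, lo) (n, \<epsilon>) (k, \<zeta>) 0 =
        (\<Sum>\<nu>\<in>{1, -1}. beta_perp TYPE('a) \<nu> (i, j, 0, lo) (n, \<epsilon>) (k + j, 0) * ?g \<nu>)"
      unfolding gamma_eq[OF count] beta_perp_eq[OF count] by simp
  }
qed

end
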